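(* Let $S$ be a regular ring with a $p$-basis $x=x_1,\dots,x_n$ and let $\pi:S\twoheadrightarrow R:=S/J$ be a surjective ring map. Then the elements $y_i=\pi(x_i)$ form a $p$-generating set $y$ for $R$. The surjection $(S;x)\to(R;y)$ factors uniquely through $$(S;x)\xrightarrow{\ \pi_\infty\ }G(R;y)\xrightarrow{\ \phi_0\ }R,$$ and the map $\pi_\infty:(S;x)\to G(R;y)$ is just the completion of $S$ along $J$. In particular, $G(R;y)\cong\widehat{S}^J$.
   Context: Fix a prime $p$; rings are commutative of characteristic $p$, and regular rings are Noetherian. $R^p\subseteq R$ is the image of Frobenius. A finite tuple $x=x_1,\dots,x_n$ in $R$ is a $p$-generating set if $R=R^p[x_1,\dots,x_n]$; it is a $p$-basis if in addition the monomials $x_1^{b_1}\cdots x_n^{b_n}$, $0\le b_i\le p-1$, are linearly independent over $R^p$. A map of pairs $(R;x)\to(S;y)$ is a ring map $R\to S$ together with a map of tuples $x\to y$ compatible with it. Gabber's construction: given an $F$-finite Noetherian ring $R$ with $p$-generating set $x$, put $R_0=R$, $x^{(0)}=x$, and inductively $R_{i}=R_{i-1}[X_1,\dots,X_n]/(X_j^p-x_j^{(i-1)})_{j}$ with $x_j^{(i)}$ the class of $X_j$, and $\phi:R_i\to R_{i-1}$ the surjection with $r\mapsto r^p$ for $r\in R_{i-1}$ and $X_j\mapsto x_j^{(i-1)}$. Then $G(R;x):=\varprojlim_\phi R_i$, a regular ring with $p$-basis $x_\infty=(x^{(i)})_i$, in bijection with $x$, and $\phi_0:G(R;x)\to R$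 is the projection, which is surjective. *)

theory Defs
  imports "HOL-Algebra.Algebra" "HOL-Library.Extended_Nat"
begin

section \<open>Regular rings\<close>

text \<open>
  The localization of \<open>R\<close> at (the complement of) a prime ideal \<open>P\<close>: classes of fractions
  \<open>(a, s)\<close>, with \<open>(a, s)\<close> and \<open>(b, t)\<close> identified iff \<open>u (a t - b s) = 0\<close> for some \<open>u\<close>
  outside \<open>P\<close>.
\<close>

definition frac_rel :: "('a, 'm) ring_scheme \<Rightarrow> 'a set \<Rightarrow> (('a \<times> 'a) \<times> ('a \<times> 'a)) set" where
  "frac_rel R P = {((a, s), (b, t)). a \<in> carrier R \<and> b \<in> carrier R \<and>
     s \<in> carrier R - P \<and> t \<in> carrier R - P \<and>
     (\<exists>u \<in> carrier R - P. u \<otimes>\<^bsub>R\<^esub> (a \<otimes>\<^bsub>R\<^esub> t \<ominus>\<^bsub>R\<^esub> b \<otimes>\<^bsub>R\<^esub> s) = \<zero>\<^bsub>R\<^esub>)}"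

definition frac :: "('a, 'm) ring_scheme \<Rightarrow> 'a set \<Rightarrow> 'a \<Rightarrow> 'a \<Rightarrow> ('a \<times> 'a) set" where
  "frac R P a s = frac_rel R P `` {(a, s)}"

definition localization :: "('a, 'm) ring_scheme \<Rightarrow> 'a set \<Rightarrow> (('a \<times> 'a) set) ring" where
  "localization R P =
    \<lparr> carrier = (carrier R \<times> (carrier R - P)) // frac_rel R P,
      monoid.mult = (\<lambda>U V. \<Union>(a, s) \<in> U. \<Union>(b, t) \<in> V. frac R P (a \<otimes>\<^bsub>R\<^esub> b) (s \<otimes>\<^bsub>R\<^esub> t)),
      one = frac R P \<one>\<^bsub>R\<^esub> \<one>\<^bsub>R\<^esub>,
      ring.zero = frac R P \<zero>\<^bsub>R\<^esub> \<one>\<^bsub>R\<^esub>,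
      add = (\<lambda>U V. \<Union>(a, s) \<in> U. \<Union>(b, t) \<in> V.
               frac R P (a \<otimes>\<^bsub>R\<^esub> t \<oplus>\<^bsub>R\<^esub> b \<otimes>\<^bsub>R\<^esub> s) (s \<otimes>\<^bsub>R\<^esub> t)) \<rparr>"

definition krull_dim :: "('a, 'm) ring_scheme \<Rightarrow> enat" where
  "krull_dim R = (SUP k \<in> {k. \<exists>P :: nat \<Rightarrow> 'a set.
     (\<forall>i \<le> k. primeideal (P i) R) \<and> (\<forall>i < k. P i \<subset> P (Suc i))}. enat k)"

definition regular_local_ring :: "('a, 'm) ring_scheme \<Rightarrow> bool" where
  "regular_local_ring R \<longleftrightarrow> cring R \<and> noetherian_ring R \<and> (\<exists>!m. maximalideal m R) \<and>
     (\<exists>A \<subseteq> carrier R. finite A \<and> maximalideal (Idl\<^bsub>R\<^esub> A) R \<and> enat (card A) = krull_dim R)"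

definition regular_ring :: "('a, 'm) ring_scheme \<Rightarrow> bool" where
  "regular_ring R \<longleftrightarrow> cring R \<and> noetherian_ring R \<and>
     (\<forall>P. primeideal P R \<longrightarrow> regular_local_ring (localization R P))"


section \<open>Characteristic p, p-generating sets, p-bases\<close>

text \<open>
  The zero ring is allowed, since a quotient \<open>S/J\<close> may be zero.
\<close>

definition char_p :: "nat \<Rightarrow> ('a, 'm) ring_scheme \<Rightarrow> bool" where
  "char_p p R \<longleftrightarrow> [p] \<cdot>\<^bsub>R\<^esub> \<one>\<^bsub>R\<^esub> = \<zero>\<^bsub>R\<^esub>"

text \<open>
  A tuple of length \<open>n\<close> is a function on \<open>nat\<close> of which only the values on \<open>{..<n}\<close> matter.
\<close>

definition frob_image :: "nat \<Rightarrow> ('a, 'm) ring_scheme \<Rightarrow> 'a set" where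
  "frob_image p R = (\<lambda>r. r [^]\<^bsub>R\<^esub> p) ` carrier R"

definition monomial :: "('a, 'm) ring_scheme \<Rightarrow> nat \<Rightarrow> (nat \<Rightarrow> 'a) \<Rightarrow> (nat \<Rightarrow> nat) \<Rightarrow> 'a" where
  "monomial R n x b = (\<Otimes>\<^bsub>R\<^esub>i \<in> {..<n}. x i [^]\<^bsub>R\<^esub> b i)"

definition p_generating :: "nat \<Rightarrow> ('a, 'm) ring_scheme \<Rightarrow> nat \<Rightarrow> (nat \<Rightarrow> 'a) \<Rightarrow> bool" where
  "p_generating p R n x \<longleftrightarrow> x \<in> {..<n} \<rightarrow> carrier R \<and>
     generate_ring R (frob_image p R \<union> x ` {..<n}) = carrier R"

definition p_basis :: "nat \<Rightarrow> ('a, 'm) ring_scheme \<Rightarrow> nat \<Rightarrow> (nat \<Rightarrow> 'a) \<Rightarrow> bool" where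
  "p_basis p R n x \<longleftrightarrow> p_generating p R n x \<and>
     (\<forall>c \<in> ({..<n} \<rightarrow>\<^sub>E {..<p}) \<rightarrow> frob_image p R.
        (\<Oplus>\<^bsub>R\<^esub>b \<in> {..<n} \<rightarrow>\<^sub>E {..<p}. c b \<otimes>\<^bsub>R\<^esub> monomial R n x b) = \<zero>\<^bsub>R\<^esub> \<longrightarrow>
        (\<forall>b \<in> {..<n} \<rightarrow>\<^sub>E {..<p}. c b = \<zero>\<^bsub>R\<^esub>))"


section \<open>Maps of pairs\<close>

text \<open>
  A map of pairs \<open>(R; x) \<rightarrow> (S; y)\<close> is a ring map together with a map of the index sets of the
  tuples. Both components are extensional, so that equality of maps of pairs is HOL equality.
\<close>

definition pair_maps :: "('a, 'm) ring_scheme \<Rightarrow> nat \<Rightarrow> (nat \<Rightarrow> 'a) \<Rightarrow>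
    ('b, 'k) ring_scheme \<Rightarrow> nat \<Rightarrow> (nat \<Rightarrow> 'b) \<Rightarrow> (('a \<Rightarrow> 'b) \<times> (nat \<Rightarrow> nat)) set" where
  "pair_maps R n x S m y = {(f, \<sigma>). f \<in> ring_hom R S \<and> f \<in> extensional (carrier R) \<and>
     \<sigma> \<in> {..<n} \<rightarrow>\<^sub>E {..<m} \<and> (\<forall>i < n. f (x i) = y (\<sigma> i))}"

definition pair_comp :: "('a, 'm) ring_scheme \<Rightarrow> nat \<Rightarrow> ('b \<Rightarrow> 'c) \<times> (nat \<Rightarrow> nat) \<Rightarrow>
    ('a \<Rightarrow> 'b) \<times> (nat \<Rightarrow> nat) \<Rightarrow> ('a \<Rightarrow> 'c) \<times> (nat \<Rightarrow> nat)" where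
  "pair_comp R n G F =
     (compose (carrier R) (fst G) (fst F), compose {..<n} (snd G) (snd F))"

text \<open>The map of pairs with underlying function \<open>f\<close> that matches the tuples index by index.\<close>

definition idx_pair_map :: "('a, 'm) ring_scheme \<Rightarrow> nat \<Rightarrow> ('a \<Rightarrow> 'b) \<Rightarrow>
    ('a \<Rightarrow> 'b) \<times> (nat \<Rightarrow> nat)" where
  "idx_pair_map R n f = (restrict f (carrier R), restrict (\<lambda>i. i) {..<n})"


section \<open>Sequential inverse limits and adic completion\<close>

definition inv_limit :: "(nat \<Rightarrow> ('a, 'm) ring_scheme) \<Rightarrow> (nat \<Rightarrow> 'a \<Rightarrow> 'a) \<Rightarrow> (nat \<Rightarrow> 'a) ring" where
  "inv_limit A t =
    \<lparr> carrier = {s. (\<forall>i. s i \<in> carrier (A i)) \<and> (\<forall>i. t i (s (Suc i)) = s i)},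
      monoid.mult = (\<lambda>r s i. r i \<otimes>\<^bsub>A i\<^esub> s i),
      one = (\<lambda>i. \<one>\<^bsub>A i\<^esub>),
      ring.zero = (\<lambda>i. \<zero>\<^bsub>A i\<^esub>),
      add = (\<lambda>r s i. r i \<oplus>\<^bsub>A i\<^esub> s i) \<rparr>"

abbreviation ideal_power :: "('a, 'm) ring_scheme \<Rightarrow> 'a set \<Rightarrow> nat \<Rightarrow> 'a set" where
  "ideal_power R J k \<equiv> J [^]\<^bsub>ideals_set R\<^esub> k"

text \<open>
  The transition map sends a coset of \<open>J\<^sup>k\<^sup>+\<^sup>1\<close> to the coset of \<open>J\<^sup>k\<close> containing it.
\<close>

definition adic_completion :: "('a, 'm) ring_scheme \<Rightarrow> 'a set \<Rightarrow> (nat \<Rightarrow> 'a set) ring" where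
  "adic_completion R J =
     inv_limit (\<lambda>k. R Quot (ideal_power R J k)) (\<lambda>k c. ideal_power R J k <+>\<^bsub>R\<^esub> c)"

definition to_adic_completion :: "('a, 'm) ring_scheme \<Rightarrow> 'a set \<Rightarrow> 'a \<Rightarrow> nat \<Rightarrow> 'a set" where
  "to_adic_completion R J r = (\<lambda>k. ideal_power R J k +>\<^bsub>R\<^esub> r)"


section \<open>Gabber's construction\<close>

text \<open>
  The ring \<open>A[X\<^sub>0, \<dots>, X\<^sub>n\<^sub>-\<^sub>1]\<close>. A polynomial is its coefficient function on monomials, a monomial
  being a multiset of variable indices.
\<close>

definition mpoly_ring :: "nat \<Rightarrow> ('a, 'm) ring_scheme \<Rightarrow> (nat multiset \<Rightarrow> 'a) ring" where
  "mpoly_ring n A =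
    \<lparr> carrier = ring.indexed_pset A {..<n} (carrier A),
      monoid.mult = (\<lambda>f g m. \<Oplus>\<^bsub>A\<^esub>k \<in> {k. k \<subseteq># m}. f k \<otimes>\<^bsub>A\<^esub> g (m - k)),
      one = ring.indexed_const A \<one>\<^bsub>A\<^esub>,
      ring.zero = ring.indexed_const A \<zero>\<^bsub>A\<^esub>,
      add = ring.indexed_padd A \<rparr>"

definition root_ideal :: "nat \<Rightarrow> nat \<Rightarrow> ('a, 'm) ring_scheme \<Rightarrow> (nat \<Rightarrow> 'a) \<Rightarrow>
    (nat multiset \<Rightarrow> 'a) set" where
  "root_ideal p n A a = Idl\<^bsub>mpoly_ring n A\<^esub>
     ((\<lambda>j. ring.indexed_var A j [^]\<^bsub>mpoly_ring n A\<^esub> p \<ominus>\<^bsub>mpoly_ring n A\<^esub> ring.indexed_const A (a j))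
        ` {..<n})"

definition root_adjunction :: "nat \<Rightarrow> nat \<Rightarrow> ('a, 'm) ring_scheme \<Rightarrow> (nat \<Rightarrow> 'a) \<Rightarrow>
    (nat multiset \<Rightarrow> 'a) set ring" where
  "root_adjunction p n A a = mpoly_ring n A Quot root_ideal p n A a"

text \<open>
  The literal iteration of \<open>root_adjunction\<close> would live in a different type at each stage.
  The following type holds all stages: stage \<open>0\<close> is a copy of \<open>R\<close> under \<open>Base\<close>, and a coset
  occurring at a later stage is encoded, injectively, by a chosen representing polynomial.
  Each stage is the image of the literal quotient ring under this encoding.
\<close>

datatype 'a tower = Base (the_base: 'a) | Adj "nat multiset \<Rightarrow> 'a tower"

definition encode :: "(nat multiset \<Rightarrow> 'a tower) set \<Rightarrow> 'a tower" where
  "encode c = Adj (SOME f. f \<in> c)"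

primrec gabber_stage :: "nat \<Rightarrow> nat \<Rightarrow> ('a, 'm) ring_scheme \<Rightarrow> (nat \<Rightarrow> 'a) \<Rightarrow> nat \<Rightarrow>
    'a tower ring \<times> (nat \<Rightarrow> 'a tower)" where
  "gabber_stage p n R x 0 = (image_ring Base R, Base \<circ> x)"
| "gabber_stage p n R x (Suc i) =
    (let A = fst (gabber_stage p n R x i); a = snd (gabber_stage p n R x i) in
      (image_ring encode (root_adjunction p n A a),
       \<lambda>j. encode (root_ideal p n A a +>\<^bsub>mpoly_ring n A\<^esub> ring.indexed_var A j)))"

abbreviation gabber_ring :: "nat \<Rightarrow> nat \<Rightarrow> ('a, 'm) ring_scheme \<Rightarrow> (nat \<Rightarrow> 'a) \<Rightarrow> nat \<Rightarrow>
    'a tower ring" where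
  "gabber_ring p n R x i \<equiv> fst (gabber_stage p n R x i)"

abbreviation gabber_tuple :: "nat \<Rightarrow> nat \<Rightarrow> ('a, 'm) ring_scheme \<Rightarrow> (nat \<Rightarrow> 'a) \<Rightarrow> nat \<Rightarrow>
    nat \<Rightarrow> 'a tower" where
  "gabber_tuple p n R x i \<equiv> snd (gabber_stage p n R x i)"

text \<open>
  The map \<open>\<phi>\<close> from stage \<open>i + 1\<close> to stage \<open>i\<close>: on representing polynomials it is
  \<open>\<Sum> r\<^sub>m X\<^sup>m \<mapsto> \<Sum> r\<^sub>m\<^sup>p x\<^sup>m\<close>, i.e. the ring map with \<open>r \<mapsto> r\<^sup>p\<close> and \<open>X\<^sub>j \<mapsto> x\<^sub>j\<close>. The value does not
  depend on the representative, as \<open>X\<^sub>j\<^sup>p - x\<^sub>j\<close> goes to \<open>x\<^sub>j\<^sup>p - x\<^sub>j\<^sup>p = 0\<close>.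
\<close>

definition frob_eval :: "nat \<Rightarrow> nat \<Rightarrow> ('a, 'm) ring_scheme \<Rightarrow> (nat \<Rightarrow> 'a) \<Rightarrow>
    (nat multiset \<Rightarrow> 'a) \<Rightarrow> 'a" where
  "frob_eval p n A a f =
     (\<Oplus>\<^bsub>A\<^esub>m \<in> {m. f m \<noteq> \<zero>\<^bsub>A\<^esub>}. (f m [^]\<^bsub>A\<^esub> p) \<otimes>\<^bsub>A\<^esub> monomial A n a (count m))"

definition gabber_phi :: "nat \<Rightarrow> nat \<Rightarrow> ('a, 'm) ring_scheme \<Rightarrow> (nat \<Rightarrow> 'a) \<Rightarrow> nat \<Rightarrow>
    'a tower \<Rightarrow> 'a tower" where
  "gabber_phi p n R x i u =
    (case u of Base r \<Rightarrow> undefined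
             | Adj f \<Rightarrow> frob_eval p n (gabber_ring p n R x i) (gabber_tuple p n R x i) f)"

definition gabber :: "nat \<Rightarrow> nat \<Rightarrow> ('a, 'm) ring_scheme \<Rightarrow> (nat \<Rightarrow> 'a) \<Rightarrow>
    (nat \<Rightarrow> 'a tower) ring" where
  "gabber p n R x = inv_limit (gabber_ring p n R x) (gabber_phi p n R x)"

definition gabber_basis :: "nat \<Rightarrow> nat \<Rightarrow> ('a, 'm) ring_scheme \<Rightarrow> (nat \<Rightarrow> 'a) \<Rightarrow>
    nat \<Rightarrow> (nat \<Rightarrow> 'a tower)" where
  "gabber_basis p n R x j = (\<lambda>i. gabber_tuple p n R x i j)"

definition gabber_proj :: "(nat \<Rightarrow> 'a tower) \<Rightarrow> 'a" where
  "gabber_proj s = the_base (s 0)"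

end

theory Submission
  imports Defs
begin

text \<open>
  Let \<open>J\<^sub>0 = J\<close> and let \<open>J\<^sub>k\<^sub>+\<^sub>1\<close> be the ideal generated by the \<open>p\<close>-th powers of elements of \<open>J\<^sub>k\<close>. As \<open>S\<close> is
  reduced, the Frobenius identifies \<open>S\<close> with \<open>S\<^sup>p\<close>, over which \<open>S\<close> is free on the restricted monomials in
  \<open>x\<close>. Hence \<open>r \<mapsto> r\<^sup>p\<close>, \<open>X\<^sub>j \<mapsto> x\<^sub>j\<close> induces an isomorphism from \<open>(S/J\<^sub>k)[X]/(X\<^sub>j\<^sup>p - x\<^sub>j)\<close> to \<open>S/J\<^sub>k\<^sub>+\<^sub>1\<close>, so by
  induction the \<open>k\<close>-th stage of Gabber's tower is \<open>S/J\<^sub>k\<close> and \<open>\<phi>\<close> is the canonical projection. The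
  filtrations \<open>J\<^sub>k\<close> and \<open>J\<^sup>k\<close> are cofinal because \<open>S\<close> is Noetherian.

  Reducedness comes from regularity: if \<open>Q\<close> is locally generated by as many elements as the length of
  a chain of primes below it, then dividing out these generators one at a time, with Krull's
  principal ideal theorem controlling the length of the chain, shows that \<open>S\<^sub>Q\<close> is a domain.
\<close>

section \<open>Local Noetherian ideal theory\<close>

text \<open>Localizations are used only to read off what regularity gives. All other local arguments
  stay in the global ring, through saturations. Nakayama's lemma, the Artinian property and the
  bound on ideal powers come from maximal members of families of ideals instead of finite generating
  sets.

  The isomorphism at one stage rests on coordinates with respect to the restricted monomials: an
  element of the ideal generated by the p-th powers of \<open>K\<close> has its coordinates, after
  extraction of p-th roots, in \<open>K\<close>. This is flatness of the Frobenius made explicit.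

  Uniqueness of the factorization is an induction on stages. Two lifts of an element from stage k to
  stage k+1 differ by the image of an element of J_k, so their p-th powers agree; \<open>S\<close>
  is generated by p-th powers and the x_j, whose images are prescribed.

  The two filtrations move at different speeds: J_k lies in J^k, but J^N lies in J_k only for some N
  depending on k. That index is recorded as \<open>depth\<close>.\<close>

locale noetherian_cring = cring + noetherian_ring

context cring
begin

lemma mem_set_add_iff: "c \<in> I <+>\<^bsub>R\<^esub> J \<longleftrightarrow> (\<exists>a\<in>I. \<exists>b\<in>J. c = a \<oplus> b)"
  unfolding set_add_def' by auto

lemma mem_PIdl_iff: "c \<in> PIdl a \<longleftrightarrow> (\<exists>r\<in>carrier R. c = r \<otimes> a)"
  unfolding cgenideal_def by auto

lemma idealI_closed:
  assumes "I \<subseteq> carrier R" "\<zero> \<in> I"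
    and "\<And>a b. a \<in> I \<Longrightarrow> b \<in> I \<Longrightarrow> a \<oplus> b \<in> I"
    and "\<And>r a. r \<in> carrier R \<Longrightarrow> a \<in> I \<Longrightarrow> r \<otimes> a \<in> I"
  shows "ideal I R"
proof (rule idealI)
  show "ring R" by (rule ring_axioms)
  show "subgroup I (add_monoid R)"
  proof (rule add.subgroupI)
    fix a assume a: "a \<in> I"
    hence "(\<ominus> \<one>) \<otimes> a \<in> I" using assms(4) by simp
    moreover have "(\<ominus> \<one>) \<otimes> a = \<ominus> a" using a assms(1) l_minus[of \<one> a] by auto
    ultimately show "\<ominus> a \<in> I" by simp
  qed (use assms in auto)
  show "\<And>a x. \<lbrakk>a \<in> I; x \<in> carrier R\<rbrakk> \<Longrightarrow> x \<otimes> a \<in> I" using assms by blast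
  show "\<And>a x. \<lbrakk>a \<in> I; x \<in> carrier R\<rbrakk> \<Longrightarrow> a \<otimes> x \<in> I" using assms m_comm by (metis subsetD)
qed

lemma ideal_minus_closed:
  assumes "ideal I R" "a \<in> I" "b \<in> I" shows "a \<ominus> b \<in> I"
  using assms by (simp add: ideal.axioms(1) additive_subgroup.a_closed additive_subgroup.a_inv_closed a_minus_def)

lemma ideal_add_closed:
  assumes "ideal I R" "a \<in> I" "b \<in> I" shows "a \<oplus> b \<in> I"
  using assms by (simp add: ideal.axioms(1) additive_subgroup.a_closed)

lemma ideal_zero_closed:
  assumes "ideal I R" shows "\<zero> \<in> I"
  using assms by (simp add: ideal.axioms(1) additive_subgroup.zero_closed)

lemma ideal_subset_carrier:
  assumes "ideal I R" shows "I \<subseteq> carrier R"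
  using assms by (meson additive_subgroup.a_subset ideal.axioms(1))

lemma ideal_mult_closed:
  assumes "ideal I R" "a \<in> I" "r \<in> carrier R" shows "r \<otimes> a \<in> I"
  using assms by (simp add: ideal.I_l_closed)

lemma ideal_mult_closed':
  assumes "ideal I R" "a \<in> I" "r \<in> carrier R" shows "a \<otimes> r \<in> I"
  using assms by (simp add: ideal.I_r_closed)

lemma subset_set_add_left:
  assumes "ideal J R" "I \<subseteq> carrier R" shows "I \<subseteq> I <+>\<^bsub>R\<^esub> J"
  using assms ideal_zero_closed[OF assms(1)] by (force simp: mem_set_add_iff)

lemma subset_set_add_right:
  assumes "ideal I R" "J \<subseteq> carrier R" shows "J \<subseteq> I <+>\<^bsub>R\<^esub> J"
  using assms ideal_zero_closed[OF assms(1)] by (force simp: mem_set_add_iff)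

lemma colon_ideal:
  assumes "ideal N R" "a \<in> carrier R" shows "ideal {r \<in> carrier R. r \<otimes> a \<in> N} R"
proof (rule idealI_closed)
  show "\<zero> \<in> {r \<in> carrier R. r \<otimes> a \<in> N}" using assms ideal_zero_closed by simp
qed (use assms in \<open>auto simp: m_assoc l_distr ideal_mult_closed ideal_add_closed\<close>)

lemma primeideal_mult_notin:
  assumes "primeideal Q R" "s \<in> carrier R - Q" "t \<in> carrier R - Q"
  shows "s \<otimes> t \<in> carrier R - Q"
  using assms primeideal.I_prime by fastforce

lemma primeideal_one_notin:
  assumes "primeideal Q R" shows "\<one> \<in> carrier R - Q"
  using assms primeideal.I_notcarr primeideal.axioms(1) ideal.one_imp_carrier by fastforce

text \<open>
  The preimage of the localized ideal \<open>N\<^sub>Q\<close>. Inclusions \<open>I\<^sub>Q \<subseteq> N\<^sub>Q\<close> are expressed as \<open>I \<subseteq> saturation Q N\<close>.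
\<close>

definition saturation :: "'a set \<Rightarrow> 'a set \<Rightarrow> 'a set" where
  "saturation Q N = {a \<in> carrier R. \<exists>s\<in>carrier R - Q. s \<otimes> a \<in> N}"

lemma saturation_ideal:
  assumes Q: "primeideal Q R" and N: "ideal N R"
  shows "ideal (saturation Q N) R"
proof (rule idealI_closed)
  show "\<zero> \<in> saturation Q N"
    using primeideal_one_notin[OF Q] ideal_zero_closed[OF N] unfolding saturation_def by fastforce
next
  fix a b assume "a \<in> saturation Q N" "b \<in> saturation Q N"
  then obtain s t where st: "s \<in> carrier R - Q" "t \<in> carrier R - Q" "s \<otimes> a \<in> N" "t \<otimes> b \<in> N"
    and c: "a \<in> carrier R" "b \<in> carrier R" unfolding saturation_def by auto
  have "(s \<otimes> t) \<otimes> (a \<oplus> b) = t \<otimes> (s \<otimes> a) \<oplus> s \<otimes> (t \<otimes> b)" using st c by (simp, algebra)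
  moreover have "\<dots> \<in> N" using st c N by (simp add: ideal_add_closed ideal_mult_closed)
  ultimately show "a \<oplus> b \<in> saturation Q N"
    using primeideal_mult_notin[OF Q st(1,2)] c unfolding saturation_def by (auto intro!: bexI[of _ "s \<otimes> t"])
next
  fix r a assume r: "r \<in> carrier R" and "a \<in> saturation Q N"
  then obtain s where s: "s \<in> carrier R - Q" "s \<otimes> a \<in> N" and c: "a \<in> carrier R"
    unfolding saturation_def by auto
  have "s \<otimes> (r \<otimes> a) = r \<otimes> (s \<otimes> a)" using s c r by (simp, algebra)
  hence "s \<otimes> (r \<otimes> a) \<in> N" using s r N by (simp add: ideal_mult_closed)
  thus "r \<otimes> a \<in> saturation Q N" using s r c unfolding saturation_def by auto
qed (auto simp: saturation_def)

lemma saturation_increasing: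
  assumes Q: "primeideal Q R" and N: "ideal N R"
  shows "N \<subseteq> saturation Q N"
  using ideal_subset_carrier[OF N] primeideal_one_notin[OF Q] unfolding saturation_def
  by (auto intro!: bexI[of _ \<one>])

lemma saturation_saturated:
  assumes Q: "primeideal Q R" and N: "ideal N R"
    and "u \<in> carrier R - Q" "a \<in> carrier R" "u \<otimes> a \<in> saturation Q N"
  shows "a \<in> saturation Q N"
proof -
  from assms obtain s where s: "s \<in> carrier R - Q" "s \<otimes> (u \<otimes> a) \<in> N" unfolding saturation_def by auto
  hence "(s \<otimes> u) \<otimes> a \<in> N" using assms m_assoc by auto
  thus ?thesis using primeideal_mult_notin[OF Q s(1) assms(3)] assms(4)
    unfolding saturation_def by blast
qed

lemma saturation_mono: "N \<subseteq> N' \<Longrightarrow> saturation Q N \<subseteq> saturation Q N'"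
  unfolding saturation_def by auto

lemma saturation_prime:
  assumes "primeideal P R" "P \<subseteq> Q" shows "saturation Q P \<subseteq> P"
proof
  fix a assume "a \<in> saturation Q P"
  then obtain s where "s \<in> carrier R - Q" "s \<otimes> a \<in> P" "a \<in> carrier R" unfolding saturation_def by auto
  thus "a \<in> P" using primeideal.I_prime[OF assms(1), of s a] assms(2) by auto
qed

lemma ideal_add_PIdl:
  assumes "ideal I R" "a \<in> carrier R"
  shows "ideal (I <+>\<^bsub>R\<^esub> PIdl a) R" "I \<subseteq> I <+>\<^bsub>R\<^esub> PIdl a" "a \<in> I <+>\<^bsub>R\<^esub> PIdl a"
  using assms add_ideals cgenideal_ideal subset_set_add_left subset_set_add_right cgenideal_self
    ideal_subset_carrier by (meson subsetD)+

lemma mem_add_PIdl_iff: "c \<in> I <+>\<^bsub>R\<^esub> PIdl a \<longleftrightarrow> (\<exists>i\<in>I. \<exists>r\<in>carrier R. c = i \<oplus> r \<otimes> a)"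
  unfolding mem_set_add_iff Bex_def mem_PIdl_iff by blast

end

text \<open>A nonempty chain of ideals contains its own union, so Zorn's lemma applies to an
  arbitrary family of ideals, with no closure under unions to check.\<close>

lemma (in noetherian_ring) exists_maximal_ideal_in:
  assumes "C \<noteq> {}" and "\<And>I. I \<in> C \<Longrightarrow> ideal I R"
  shows "\<exists>M\<in>C. \<forall>I\<in>C. M \<subseteq> I \<longrightarrow> I = M"
proof (rule subset_Zorn_nonempty)
  fix D assume D: "D \<noteq> {}" "subset.chain C D"
  hence "subset.chain {I. ideal I R} D" using assms(2) unfolding pred_on.chain_def by auto
  hence "\<Union>D \<in> D" using D(1) ideal_chain_is_trivial by blast
  thus "\<Union>D \<in> C" using D(2) unfolding pred_on.chain_def by auto
qed (use assms in auto)

section \<open>Nakayama's lemma, and Artinian localizations at minimal primes\<close>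

context noetherian_cring
begin

text \<open>The hypothesis \<open>H\<close> stands for "I = N + QI locally" without forming N + QI:
  it is tested on every ideal that contains N and QI. Finite generation of I is replaced by a
  maximal ideal M among those containing N for which the conclusion fails; M turns out to contain
  QI, and \<open>H\<close> then contradicts its choice.\<close>

lemma local_nakayama:
  assumes Q: "primeideal Q R" and I: "ideal I R" and N: "ideal N R"
    and H: "\<And>W. \<lbrakk>ideal W R; N \<subseteq> W; \<And>k a. k \<in> Q \<Longrightarrow> a \<in> I \<Longrightarrow> k \<otimes> a \<in> W\<rbrakk> \<Longrightarrow> I \<subseteq> saturation Q W"
  shows "I \<subseteq> saturation Q N"
proof (rule ccontr)
  assume neg: "\<not> I \<subseteq> saturation Q N"
  define C where "C = {W. ideal W R \<and> N \<subseteq> W \<and> \<not> I \<subseteq> saturation Q W}"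
  have "N \<in> C" using N neg unfolding C_def by simp
  hence "\<exists>M\<in>C. \<forall>W\<in>C. M \<subseteq> W \<longrightarrow> W = M"
    by (intro exists_maximal_ideal_in) (auto simp: C_def)
  then obtain M where "M \<in> C" and max: "\<And>W. W \<in> C \<Longrightarrow> M \<subseteq> W \<Longrightarrow> W = M" by blast
  hence M: "ideal M R" "N \<subseteq> M" "\<not> I \<subseteq> saturation Q M" unfolding C_def by auto
  have Qc: "Q \<subseteq> carrier R" and Ic: "I \<subseteq> carrier R" and Mc: "M \<subseteq> carrier R"
    using Q I M ideal_subset_carrier primeideal.axioms(1) by blast+
  have Qi: "ideal Q R" using Q primeideal.axioms(1) by blast
  \<comment> \<open>Saturating twice adds nothing, so the saturation of M belongs to C as well, and
    maximality makes M saturated.\<close>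
  have sat: "saturation Q M = M"
  proof (rule max)
    have "saturation Q (saturation Q M) \<subseteq> saturation Q M"
      using saturation_saturated[OF Q M(1)] unfolding saturation_def[of Q "saturation Q M"] by auto
    thus "saturation Q M \<in> C" using M saturation_ideal[OF Q M(1)] saturation_increasing[OF Q M(1)]
      unfolding C_def by auto
  qed (rule saturation_increasing[OF Q M(1)])
  have "k \<otimes> a \<in> M" if k: "k \<in> Q" and a: "a \<in> I" for k a
  proof -
    have kc: "k \<in> carrier R" and ac: "a \<in> carrier R" using k a Qc Ic by auto
    let ?W = "M <+>\<^bsub>R\<^esub> PIdl (k \<otimes> a)"
    have W: "ideal ?W R" "M \<subseteq> ?W" "k \<otimes> a \<in> ?W" using ideal_add_PIdl[OF M(1)] kc ac by auto
    show ?thesis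
    proof (cases "I \<subseteq> saturation Q ?W")
      case True
      then obtain s where s: "s \<in> carrier R - Q" "s \<otimes> a \<in> ?W" using a unfolding saturation_def by auto
      then obtain x r where xr: "x \<in> M" "r \<in> carrier R" "s \<otimes> a = x \<oplus> r \<otimes> (k \<otimes> a)"
        unfolding mem_add_PIdl_iff by blast
      have xc: "x \<in> carrier R" using xr(1) Mc by auto
      have rk: "r \<otimes> k \<in> Q" using ideal_mult_closed[OF Qi k xr(2)] .
      \<comment> \<open>As k lies in Q and s does not, \<open>s - r k\<close> lies outside Q. It
        becomes a unit in the localization, so a itself falls into the saturated ideal M.\<close>
      have "(s \<ominus> r \<otimes> k) \<otimes> a = s \<otimes> a \<ominus> r \<otimes> (k \<otimes> a)"
        using s(1) xr(2) kc ac by (simp, algebra)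
      also have "\<dots> = x" unfolding xr(3) using xc xr(2) kc ac by algebra
      finally have "(s \<ominus> r \<otimes> k) \<otimes> a \<in> M" using xr(1) by simp
      moreover have "s \<ominus> r \<otimes> k \<in> carrier R - Q"
      proof -
        have "s \<in> Q" if "s \<ominus> r \<otimes> k \<in> Q"
        proof -
          have "s = (s \<ominus> r \<otimes> k) \<oplus> r \<otimes> k" using s(1) xr(2) kc by (simp, algebra)
          thus ?thesis using that rk ideal_add_closed[OF Qi] by metis
        qed
        thus ?thesis using s(1) xr(2) kc by auto
      qed
      ultimately have "a \<in> saturation Q M" using ac unfolding saturation_def by blast
      hence "a \<in> M" using sat by simp
      thus ?thesis using ideal_mult_closed[OF M(1) _ kc] by simp
    next
      case False
      hence "?W \<in> C" using W M unfolding C_def by auto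
      hence "?W = M" using max W by blast
      thus ?thesis using W(3) by simp
    qed
  qed
  hence "I \<subseteq> saturation Q M" using H[OF M(1,2)] by blast
  thus False using M(3) by simp
qed

text \<open>The descending chain condition for the ring (R/W)_Q, phrased with ideals of R above
  W.\<close>

definition loc_artinian :: "'a set \<Rightarrow> 'a set \<Rightarrow> bool" where
  "loc_artinian Q W \<longleftrightarrow> (\<forall>I. (\<forall>i::nat. ideal (I i) R \<and> W \<subseteq> I i \<and> I (Suc i) \<subseteq> I i) \<longrightarrow>
     (\<exists>k0. \<forall>k\<ge>k0. I k \<subseteq> saturation Q (I (Suc k))))"

text \<open>Locally, (W + (a))/W is a quotient of the residue field at Q, so a chain can change
  there at most once. Beyond that change and beyond stabilization modulo a, either a lies in the
  next member, or every r with r a in the present member lies in Q and then r a already lies in W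
  locally.\<close>

lemma loc_artinian_step:
  assumes Q: "primeideal Q R" and W: "ideal W R" and a: "a \<in> carrier R"
    and Qa: "\<And>q. q \<in> Q \<Longrightarrow> q \<otimes> a \<in> saturation Q W"
    and art: "loc_artinian Q (W <+>\<^bsub>R\<^esub> PIdl a)"
  shows "loc_artinian Q W"
  unfolding loc_artinian_def
proof (intro allI impI)
  fix I assume H: "\<forall>i::nat. ideal (I i) R \<and> W \<subseteq> I i \<and> I (Suc i) \<subseteq> I i"
  have anti: "I j \<subseteq> I i" if "i \<le> j" for i j
    using that H by (induction rule: dec_induct) auto
  define I' where "I' = (\<lambda>i. I i <+>\<^bsub>R\<^esub> PIdl a)"
  have "ideal (I' i) R \<and> (W <+>\<^bsub>R\<^esub> PIdl a) \<subseteq> I' i \<and> I' (Suc i) \<subseteq> I' i" for i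
    using H ideal_add_PIdl[of "I i" a] a unfolding I'_def mem_add_PIdl_iff subset_iff by blast
  then obtain k0 where k0: "\<forall>k\<ge>k0. I' k \<subseteq> saturation Q (I' (Suc k))"
    using art unfolding loc_artinian_def by blast
  have Ic: "I i \<subseteq> carrier R" for i using H ideal_subset_carrier by blast
  \<comment> \<open>The saturations decrease, so a either belongs to all of them or is outside from
    some index on.\<close>
  have "\<exists>i0. \<forall>i\<ge>i0. a \<in> saturation Q (I (Suc i)) \<or> a \<notin> saturation Q (I i)"
  proof (cases "\<exists>i. a \<notin> saturation Q (I i)")
    case True
    then obtain i where i: "a \<notin> saturation Q (I i)" by blast
    hence "\<forall>j\<ge>i. a \<notin> saturation Q (I j)" using anti saturation_mono by (meson subsetD)
    thus ?thesis by blast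
  qed auto
  then obtain i0 where i0: "\<forall>i\<ge>i0. a \<in> saturation Q (I (Suc i)) \<or> a \<notin> saturation Q (I i)" by blast
  have "I k \<subseteq> saturation Q (I (Suc k))" if k: "k \<ge> max k0 i0" for k
  proof
    fix b assume b: "b \<in> I k"
    have bc: "b \<in> carrier R" using b Ic by auto
    have Ik: "ideal (I k) R" "ideal (I (Suc k)) R" using H by auto
    have "b \<in> I' k" using b ideal_add_PIdl(2)[OF Ik(1) a] unfolding I'_def by auto
    then obtain s where s: "s \<in> carrier R - Q" "s \<otimes> b \<in> I' (Suc k)"
      using k0 k unfolding saturation_def by (auto dest!: spec[of _ k])
    then obtain c r where cr: "c \<in> I (Suc k)" "r \<in> carrier R" "s \<otimes> b = c \<oplus> r \<otimes> a"
      unfolding I'_def mem_add_PIdl_iff by blast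
    have cc: "c \<in> carrier R" using cr Ic by auto
    have ra: "r \<otimes> a = s \<otimes> b \<ominus> c" unfolding cr(3) using cc cr(2) a by algebra
    have "c \<in> I k" using cr(1) H by blast
    hence raI: "r \<otimes> a \<in> I k" unfolding ra
      using b s(1) by (auto intro!: ideal_minus_closed[OF Ik(1)] ideal_mult_closed[OF Ik(1)])
    let ?S = "saturation Q (I (Suc k))"
    have S: "ideal ?S R" using saturation_ideal[OF Q Ik(2)] .
    have "r \<otimes> a \<in> ?S"
    proof (cases "a \<in> ?S")
      case True thus ?thesis using ideal_mult_closed[OF S _ cr(2)] by blast
    next
      case False
      hence "a \<notin> saturation Q (I k)" using i0 k by auto
      hence "r \<in> Q" using raI cr(2) a unfolding saturation_def by blast
      hence "r \<otimes> a \<in> saturation Q W" using Qa by blast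
      thus ?thesis using saturation_mono[of W "I (Suc k)"] H by blast
    qed
    hence "s \<otimes> b \<in> ?S" unfolding cr(3)
      using ideal_add_closed[OF S] cr(1) saturation_increasing[OF Q Ik(2)] by blast
    thus "b \<in> ?S" using saturation_saturated[OF Q Ik(2) s(1) bc] by blast
  qed
  thus "\<exists>k0. \<forall>k\<ge>k0. I k \<subseteq> saturation Q (I (Suc k))" by blast
qed

text \<open>An associated prime of (R/M)_Q: among the annihilators of its nonzero elements, a
  maximal one is prime. The family is nonempty because M \<subseteq> Q keeps the unit element
  nonzero.\<close>

lemma exists_local_associated_prime:
  assumes Q: "primeideal Q R" and M: "ideal M R" and MQ: "M \<subseteq> Q"
  shows "\<exists>a\<in>carrier R. a \<notin> saturation Q M \<and>
    primeideal {r \<in> carrier R. r \<otimes> a \<in> saturation Q M} R"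
proof -
  let ?S = "saturation Q M"
  define L where "L = (\<lambda>a. {r \<in> carrier R. r \<otimes> a \<in> ?S})"
  have S: "ideal ?S R" using saturation_ideal[OF Q M] .
  have one: "\<one> \<notin> ?S" using MQ unfolding saturation_def by auto
  have Lid: "ideal (L a) R" if "a \<in> carrier R" for a unfolding L_def by (rule colon_ideal[OF S that])
  have "\<exists>W \<in> L ` (carrier R - ?S). \<forall>Y \<in> L ` (carrier R - ?S). W \<subseteq> Y \<longrightarrow> Y = W"
    by (rule exists_maximal_ideal_in) (use one Lid in auto)
  then obtain a where a: "a \<in> carrier R" "a \<notin> ?S"
    and max: "\<And>b. b \<in> carrier R \<Longrightarrow> b \<notin> ?S \<Longrightarrow> L a \<subseteq> L b \<Longrightarrow> L b = L a" by auto
  have "primeideal (L a) R"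
  proof (rule primeidealI[OF Lid[OF a(1)] is_cring])
    show "carrier R \<noteq> L a" using a unfolding L_def by (metis (no_types, lifting) l_one mem_Collect_eq one_closed)
  next
    fix u v assume uv: "u \<in> carrier R" "v \<in> carrier R" "u \<otimes> v \<in> L a"
    show "u \<in> L a \<or> v \<in> L a"
    proof (cases "u \<in> L a")
      case False
      hence ua: "u \<otimes> a \<in> carrier R" "u \<otimes> a \<notin> ?S" using uv a unfolding L_def by auto
      have "L a \<subseteq> L (u \<otimes> a)"
      proof
        fix r assume r: "r \<in> L a"
        hence "r \<in> carrier R" "r \<otimes> a \<in> ?S" unfolding L_def by auto
        moreover have "r \<otimes> (u \<otimes> a) = u \<otimes> (r \<otimes> a)" using calculation uv(1) a by algebra
        ultimately show "r \<in> L (u \<otimes> a)" using ideal_mult_closed[OF S] uv(1) unfolding L_def by simp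
      qed
      hence eq: "L (u \<otimes> a) = L a" using max[OF ua] by blast
      have "v \<otimes> (u \<otimes> a) = (u \<otimes> v) \<otimes> a" using uv(1,2) a(1) by algebra
      hence "v \<in> L (u \<otimes> a)" using uv unfolding L_def by simp
      thus ?thesis using eq by simp
    qed simp
  qed
  thus ?thesis using a unfolding L_def by blast
qed

text \<open>Noetherian induction on W. A maximal counterexample M inside Q has a local associated
  prime between M and Q, which must be Q. The element a annihilated by it spans a simple piece; M +
  (a) is no counterexample, and \<open>loc_artinian_step\<close> carries the property back to M. If
  M is not inside Q, the localization is zero.\<close>

lemma loc_artinian_if_minimal_prime:
  assumes Q: "primeideal Q R" and "ideal W R"
    and "\<And>P. \<lbrakk>primeideal P R; W \<subseteq> P; P \<subseteq> Q\<rbrakk> \<Longrightarrow> P = Q"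
  shows "loc_artinian Q W"
proof (rule ccontr)
  assume neg: "\<not> loc_artinian Q W"
  define C where "C = {W. ideal W R \<and> (\<forall>P. primeideal P R \<and> W \<subseteq> P \<and> P \<subseteq> Q \<longrightarrow> P = Q) \<and> \<not> loc_artinian Q W}"
  have "W \<in> C" using assms neg unfolding C_def by simp
  hence "\<exists>M\<in>C. \<forall>W\<in>C. M \<subseteq> W \<longrightarrow> W = M"
    by (intro exists_maximal_ideal_in) (auto simp: C_def)
  then obtain M where "M \<in> C" and max: "\<And>W. W \<in> C \<Longrightarrow> M \<subseteq> W \<Longrightarrow> W = M" by blast
  hence M: "ideal M R" "\<And>P. \<lbrakk>primeideal P R; M \<subseteq> P; P \<subseteq> Q\<rbrakk> \<Longrightarrow> P = Q" "\<not> loc_artinian Q M"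
    unfolding C_def by auto
  show False
  proof (cases "M \<subseteq> Q")
    case False
    then obtain s where "s \<in> M" "s \<in> carrier R - Q" using ideal_subset_carrier[OF M(1)] by auto
    hence "I k \<subseteq> saturation Q (I (Suc k))"
      if "\<forall>i::nat. ideal (I i) R \<and> M \<subseteq> I i \<and> I (Suc i) \<subseteq> I i" for I k
      using that ideal_subset_carrier[of "I k"] ideal_mult_closed'[OF M(1)]
      unfolding saturation_def by blast
    thus False using M(3) unfolding loc_artinian_def by blast
  next
    case True
    then obtain a where a: "a \<in> carrier R" "a \<notin> saturation Q M"
      and pr: "primeideal {r \<in> carrier R. r \<otimes> a \<in> saturation Q M} R" (is "primeideal ?L R")
      using exists_local_associated_prime[OF Q M(1)] by blast
    have S: "ideal (saturation Q M) R" using saturation_ideal[OF Q M(1)] .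
    have inc: "M \<subseteq> saturation Q M" using saturation_increasing[OF Q M(1)] .
    have "M \<subseteq> ?L" using inc ideal_mult_closed'[OF S _ a(1)] ideal_subset_carrier[OF M(1)] by auto
    moreover have "?L \<subseteq> Q"
      using a saturation_saturated[OF Q M(1)] by auto
    ultimately have "?L = Q" using M(2) pr by blast
    hence Qa: "\<And>q. q \<in> Q \<Longrightarrow> q \<otimes> a \<in> saturation Q M" by auto
    let ?W = "M <+>\<^bsub>R\<^esub> PIdl a"
    have W: "ideal ?W R" "M \<subseteq> ?W" "a \<in> ?W" using ideal_add_PIdl[OF M(1) a(1)] by auto
    have "?W \<noteq> M" using W(3) a(2) inc by auto
    hence "?W \<notin> C" using max W by blast
    hence "loc_artinian Q ?W" using M(2) W unfolding C_def by blast
    thus False using loc_artinian_step[OF Q M(1) a(1) Qa] M(3) by blast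
  qed
qed

end

section \<open>Symbolic powers and Krull's principal ideal theorem\<close>

context cring
begin

lemma ideal_prod_mono_right:
  assumes "J \<subseteq> J'" shows "I \<cdot> J \<subseteq> I \<cdot> J'"
proof
  fix a assume "a \<in> I \<cdot> J" thus "a \<in> I \<cdot> J'"
  proof (induction)
    case (prod i j) thus ?case using assms by (simp add: ideal_prod.prod subsetD)
  qed (rule ideal_prod.sum)
qed

lemma set_add_subset:
  assumes "ideal K R" "I \<subseteq> K" "J \<subseteq> K" shows "I <+>\<^bsub>R\<^esub> J \<subseteq> K"
  using assms(2,3) ideal_add_closed[OF assms(1)] unfolding mem_set_add_iff subset_iff by blast

text \<open>The preimage in R of the k-th symbolic power of P/P' in R/P': each step multiplies by P,
  adds P' and saturates at P.\<close>

primrec rel_symbolic_power :: "'a set \<Rightarrow> 'a set \<Rightarrow> nat \<Rightarrow> 'a set" where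
  "rel_symbolic_power P P' 0 = carrier R"
| "rel_symbolic_power P P' (Suc k) = saturation P (P' <+>\<^bsub>R\<^esub> (P \<cdot> rel_symbolic_power P P' k))"

lemma
  assumes P: "primeideal P R" and P': "ideal P' R"
  shows rel_symbolic_power_ideal: "ideal (rel_symbolic_power P P' k) R"
    and rel_symbolic_power_contains: "P' \<subseteq> rel_symbolic_power P P' k"
    and rel_symbolic_power_decreasing: "rel_symbolic_power P P' (Suc k) \<subseteq> rel_symbolic_power P P' k"
    and rel_symbolic_power_mult: "a \<in> rel_symbolic_power P P' k \<Longrightarrow> q \<in> P \<Longrightarrow>
      q \<otimes> a \<in> rel_symbolic_power P P' (Suc k)"
    and rel_symbolic_power_saturated: "u \<in> carrier R - P \<Longrightarrow> a \<in> carrier R \<Longrightarrow>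
      u \<otimes> a \<in> rel_symbolic_power P P' k \<Longrightarrow> a \<in> rel_symbolic_power P P' k"
proof -
  let ?L = "rel_symbolic_power P P'"
  have Pi: "ideal P R" using P primeideal.axioms(1) by blast
  have P'c: "P' \<subseteq> carrier R" using P' ideal_subset_carrier by blast
  have L: "ideal (?L k) R" for k
  proof (induction k)
    case (Suc k) thus ?case
      using saturation_ideal[OF P add_ideals[OF P' ideal_prod_is_ideal[OF Pi Suc]]] by simp
  qed (simp add: oneideal)
  have N: "ideal (P' <+>\<^bsub>R\<^esub> (P \<cdot> ?L k)) R" for k
    using add_ideals[OF P' ideal_prod_is_ideal[OF Pi L]] .
  have PL: "ideal (P \<cdot> ?L k) R" for k using ideal_prod_is_ideal[OF Pi L] .
  show "ideal (?L k) R" by (rule L)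
  show "P' \<subseteq> ?L k"
  proof (cases k)
    case (Suc j) thus ?thesis
      using subset_set_add_left[OF PL P'c, of j] saturation_increasing[OF P N[of j]] by auto
  qed (use P'c in simp)
  show "?L (Suc k) \<subseteq> ?L k"
  proof (induction k)
    case 0 thus ?case using ideal_subset_carrier[OF L[of "Suc 0"]] by simp
  next
    case (Suc k)
    have "P' <+>\<^bsub>R\<^esub> (P \<cdot> ?L (Suc k)) \<subseteq> P' <+>\<^bsub>R\<^esub> (P \<cdot> ?L k)"
      using ideal_prod_mono_right[OF Suc] unfolding mem_set_add_iff subset_iff by blast
    thus ?case using saturation_mono by simp
  qed
  show "q \<otimes> a \<in> ?L (Suc k)" if "a \<in> ?L k" "q \<in> P"
    using saturation_increasing[OF P N[of k]] ideal_prod.prod[OF that(2,1)]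
      subset_set_add_right[OF P' ideal_subset_carrier[OF PL[of k]]] by auto
  show "a \<in> ?L k" if "u \<in> carrier R - P" "a \<in> carrier R" "u \<otimes> a \<in> ?L k"
  proof (cases k)
    case (Suc j) thus ?thesis using saturation_saturated[OF P N[of j] that(1,2)] that(3) by simp
  qed (use that in simp)
qed

lemma primeideal_pow_mem:
  assumes "primeideal P R" "c \<in> carrier R" "c [^] (k::nat) \<in> P" shows "c \<in> P"
  using assms(3)
proof (induction k)
  case 0 thus ?case using primeideal_one_notin[OF assms(1)] by simp
next
  case (Suc k) thus ?case using primeideal.I_prime[OF assms(1), of "c [^] k" c] assms(2) by auto
qed

end

context noetherian_cring
begin

lemma loc_artinianD:
  assumes "loc_artinian Q W"
    and "\<And>i::nat. ideal (I i) R \<and> W \<subseteq> I i \<and> I (Suc i) \<subseteq> I i"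
  shows "\<exists>k. I k \<subseteq> saturation Q (I (Suc k))"
proof -
  have "\<exists>k0. \<forall>k\<ge>k0. I k \<subseteq> saturation Q (I (Suc k))"
    using assms unfolding loc_artinian_def by simp
  thus ?thesis by blast
qed

text \<open>Krull's principal ideal theorem, for the ring \<open>(R / P')\<^sub>Q\<close>.\<close>

theorem principal_ideal_theorem:
  assumes P': "primeideal P' R" and P: "primeideal P R" and Q: "primeideal Q R"
    and P'P: "P' \<subset> P" and PQ: "P \<subset> Q" and t: "t \<in> Q" "t \<notin> P'"
  shows "\<exists>M. primeideal M R \<and> P' \<subset> M \<and> t \<in> M \<and> M \<subset> Q"
proof (rule ccontr)
  assume neg: "\<not> ?thesis"
  let ?L = "rel_symbolic_power P P'"
  have P'i: "ideal P' R" and Pi: "ideal P R" and Qi: "ideal Q R"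
    using P' P Q primeideal.axioms(1) by blast+
  note L = rel_symbolic_power_ideal[OF P P'i] and L_contains = rel_symbolic_power_contains[OF P P'i]
    and L_dec = rel_symbolic_power_decreasing[OF P P'i] and L_mult = rel_symbolic_power_mult[OF P P'i]
    and L_sat = rel_symbolic_power_saturated[OF P P'i]
  have tc: "t \<in> carrier R" using t ideal_subset_carrier[OF Qi] by auto
  \<comment> \<open>Otherwise P would itself be a prime of the kind excluded by
    \<open>neg\<close>.\<close>
  have tP: "t \<notin> P" using neg P P'P PQ by blast
  define W where "W = P' <+>\<^bsub>R\<^esub> PIdl t"
  have W: "ideal W R" "P' \<subseteq> W" "t \<in> W" using ideal_add_PIdl[OF P'i tc] unfolding W_def by auto
  \<comment> \<open>Under \<open>neg\<close>, the only prime between P' + (t) and Q is Q.\<close>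
  have "loc_artinian Q W"
  proof (rule loc_artinian_if_minimal_prime[OF Q W(1)])
    fix M assume M: "primeideal M R" "W \<subseteq> M" "M \<subseteq> Q"
    thus "M = Q" using neg W t by blast
  qed
  moreover have "ideal (?L i <+>\<^bsub>R\<^esub> W) R \<and> W \<subseteq> ?L i <+>\<^bsub>R\<^esub> W \<and> ?L (Suc i) <+>\<^bsub>R\<^esub> W \<subseteq> ?L i <+>\<^bsub>R\<^esub> W" for i
  proof (intro conjI)
    show "?L (Suc i) <+>\<^bsub>R\<^esub> W \<subseteq> ?L i <+>\<^bsub>R\<^esub> W"
      using L_dec[of i] unfolding mem_set_add_iff subset_iff by blast
  qed (use L W add_ideals subset_set_add_right ideal_subset_carrier in blast)+
  ultimately obtain k where k: "?L k <+>\<^bsub>R\<^esub> W \<subseteq> saturation Q (?L (Suc k) <+>\<^bsub>R\<^esub> W)"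
    using loc_artinianD[of Q W "\<lambda>i. ?L i <+>\<^bsub>R\<^esub> W"] by blast
  have Lc: "?L i \<subseteq> carrier R" for i using L ideal_subset_carrier by blast
  \<comment> \<open>Stabilization modulo W writes s a, up to elements of \<open>?L (Suc k)\<close>,
    as t r. Since t r lies in the symbolic power \<open>?L k\<close> and t is outside P, r lies in
    it too. So locally at Q, \<open>?L k\<close> is \<open>?L (Suc k)\<close> plus t times itself,
    and t is in Q.\<close>
  have "?L k \<subseteq> saturation Q (?L (Suc k))"
  proof (rule local_nakayama[OF Q L L])
    fix N assume N: "ideal N R" "?L (Suc k) \<subseteq> N" and QL: "\<And>q a. q \<in> Q \<Longrightarrow> a \<in> ?L k \<Longrightarrow> q \<otimes> a \<in> N"
    show "?L k \<subseteq> saturation Q N"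
    proof
      fix a assume a: "a \<in> ?L k"
      hence ac: "a \<in> carrier R" using Lc by auto
      have "a \<in> ?L k <+>\<^bsub>R\<^esub> W" using subset_set_add_left[OF W(1) Lc] a by blast
      then obtain s where s: "s \<in> carrier R - Q" "s \<otimes> a \<in> ?L (Suc k) <+>\<^bsub>R\<^esub> W"
        using k unfolding saturation_def by auto
      then obtain b c r where bcr: "b \<in> ?L (Suc k)" "c \<in> P'" "r \<in> carrier R" "s \<otimes> a = b \<oplus> (c \<oplus> r \<otimes> t)"
        unfolding mem_set_add_iff[of _ "?L (Suc k)"] W_def Bex_def mem_add_PIdl_iff by blast
      have bc: "b \<oplus> c \<in> ?L (Suc k)" using bcr L_contains ideal_add_closed[OF L] by blast
      have carr: "b \<in> carrier R" "c \<in> carrier R" using bcr(1,2) Lc ideal_subset_carrier[OF P'i] by blast+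
      have eq: "t \<otimes> r = s \<otimes> a \<ominus> (b \<oplus> c)" unfolding bcr(4) using carr bcr(3) tc by algebra
      have "t \<otimes> r \<in> ?L k" unfolding eq
        using bc L_dec a s(1) by (auto intro!: ideal_minus_closed[OF L] ideal_mult_closed[OF L])
      hence "r \<in> ?L k" using L_sat tP tc bcr(3) by blast
      hence "t \<otimes> r \<in> N" using QL t by blast
      moreover have "s \<otimes> a = (b \<oplus> c) \<oplus> t \<otimes> r" unfolding bcr(4) using carr bcr(3) tc by algebra
      ultimately have "s \<otimes> a \<in> N" using bc N ideal_add_closed[OF N(1)] by auto
      thus "a \<in> saturation Q N" using s ac unfolding saturation_def by auto
    qed
  qed
  hence stable: "?L k \<subseteq> ?L (Suc k)"
    using L_sat[of _ _ "Suc k"] PQ unfolding saturation_def by blast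
  \<comment> \<open>By \<open>stable\<close>, \<open>?L k\<close> equals P' + P \<open>?L k\<close>
    locally at P, which is Nakayama's situation at the smaller prime P.\<close>
  have "?L k \<subseteq> saturation P P'"
  proof (rule local_nakayama[OF P L P'i])
    fix N assume N: "ideal N R" "P' \<subseteq> N" and PL: "\<And>q a. q \<in> P \<Longrightarrow> a \<in> ?L k \<Longrightarrow> q \<otimes> a \<in> N"
    have "P \<cdot> ?L k \<subseteq> N"
    proof
      fix a assume "a \<in> P \<cdot> ?L k" thus "a \<in> N"
        by (induction) (auto intro: PL ideal_add_closed[OF N(1)])
    qed
    hence "P' <+>\<^bsub>R\<^esub> (P \<cdot> ?L k) \<subseteq> N" using set_add_subset[OF N] by blast
    hence "?L (Suc k) \<subseteq> saturation P N" using saturation_mono by simp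
    thus "?L k \<subseteq> saturation P N" using stable by blast
  qed
  hence LP': "?L k \<subseteq> P'"
  proof -
    have "saturation P P' \<subseteq> P'" using saturation_prime[OF P'] P'P by blast
    thus ?thesis using \<open>?L k \<subseteq> saturation P P'\<close> by blast
  qed
  \<comment> \<open>The k-th power of c lies in \<open>?L k\<close>, hence in the prime P', which is
    the contradiction sought.\<close>
  obtain c where c: "c \<in> P" "c \<notin> P'" using P'P by blast
  have cc: "c \<in> carrier R" using c ideal_subset_carrier[OF Pi] by auto
  have "c [^] j \<in> ?L j" for j :: nat
  proof (induction j)
    case (Suc j)
    have "c [^] Suc j = c \<otimes> c [^] j" using cc m_comm by simp
    thus ?case using L_mult[OF Suc c(1)] by simp
  qed simp
  hence "c \<in> P'" using primeideal_pow_mem[OF P' cc] LP' by blast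
  thus False using c by simp
qed

text \<open>Dividing out one element shortens a chain of primes by only one. Working down from the
  top, the principal ideal theorem replaces a member that misses t by a prime that contains t and
  still lies strictly between its neighbours.\<close>

lemma prime_chain_through:
  assumes "\<And>i. i \<le> Suc d \<Longrightarrow> primeideal (P i) R" "\<And>i. i \<le> d \<Longrightarrow> P i \<subset> P (Suc i)"
    and "t \<in> P (Suc d)" "t \<notin> P 0"
  shows "\<exists>P'. (\<forall>i\<le>d. primeideal (P' i) R) \<and> (\<forall>i<d. P' i \<subset> P' (Suc i)) \<and>
    P' d = P (Suc d) \<and> P 0 \<subset> P' 0 \<and> t \<in> P' 0"
  using assms
proof (induction d arbitrary: P)
  case 0
  thus ?case by (intro exI[of _ "\<lambda>_. P 1"]) auto
next
  case (Suc d)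
  show ?case
  proof (cases "t \<in> P 1")
    case True
    thus ?thesis using Suc.prems by (intro exI[of _ "\<lambda>i. P (Suc i)"]) auto
  next
    case False
    obtain P' where P': "\<forall>i\<le>d. primeideal (P' i) R" "\<forall>i<d. P' i \<subset> P' (Suc i)"
      "P' d = P (Suc (Suc d))" "P 1 \<subset> P' 0" "t \<in> P' 0"
      using Suc.IH[of "\<lambda>i. P (Suc i)"] Suc.prems False by auto
    have "P 0 \<subset> P 1" using Suc.prems(2)[of 0] by simp
    moreover have "primeideal (P 0) R" "primeideal (P 1) R" using Suc.prems(1) by auto
    ultimately obtain M where M: "primeideal M R" "P 0 \<subset> M" "t \<in> M" "M \<subset> P' 0"
      using principal_ideal_theorem[of "P 0" "P 1" "P' 0" t] P' Suc.prems by auto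
    show ?thesis
    proof (intro exI[of _ "\<lambda>i. case i of 0 \<Rightarrow> M | Suc j \<Rightarrow> P' j"] conjI allI impI)
      fix i assume "i < Suc d"
      thus "(case i of 0 \<Rightarrow> M | Suc j \<Rightarrow> P' j) \<subset> (case Suc i of 0 \<Rightarrow> M | Suc j \<Rightarrow> P' j)"
        using P' M by (cases i) auto
    qed (use P' M in \<open>auto split: nat.split\<close>)
  qed
qed

text \<open>
  That is, \<open>(R / I)\<^sub>Q\<close> is a domain if it is regular: it is locally \<open>R / P\<^sub>0\<close>. The induction divides out
  a generator that is not in \<open>P\<^sub>0\<close>.
\<close>

lemma local_domain_if_regular:
  assumes "ideal I R" "I \<subseteq> P 0"
    and "\<And>i. i \<le> d \<Longrightarrow> primeideal (P i) R" "\<And>i. i < d \<Longrightarrow> P i \<subset> P (Suc i)"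
    and "finite T" "T \<subseteq> P d" "card T \<le> d"
    and "P d \<subseteq> saturation (P d) (Idl (I \<union> T))"
  shows "P 0 \<subseteq> saturation (P d) I"
  using assms
proof (induction d arbitrary: I P T)
  case 0
  \<comment> \<open>A finite T with at most zero elements is empty, so the generation hypothesis is
    already the claim.\<close>
  have "Idl I = I" using 0 by (simp add: genideal_minimal genideal_self[OF ideal_subset_carrier] subset_antisym)
  thus ?case using 0 by simp
next
  case (Suc d)
  let ?Q = "P (Suc d)"
  have Q: "primeideal ?Q R" and P0: "primeideal (P 0) R" using Suc.prems(3) by auto
  have Qi: "ideal ?Q R" and P0i: "ideal (P 0) R" using Q P0 primeideal.axioms(1) by blast+
  have mono: "i \<le> j \<Longrightarrow> j \<le> Suc d \<Longrightarrow> P i \<subseteq> P j" for i j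
    by (induction j rule: dec_induct) (use Suc.prems(4) in \<open>auto simp: Suc_le_eq\<close>)
  have Ic: "I \<subseteq> carrier R" using Suc.prems(1) ideal_subset_carrier by blast
  \<comment> \<open>If all generators were in P 0, the top prime would be contained in P 0,
    contradicting a strict chain of length at least one.\<close>
  have "\<exists>t\<in>T. t \<notin> P 0"
  proof (rule ccontr)
    assume "\<not> ?thesis"
    hence "I \<union> T \<subseteq> P 0" using Suc.prems(2) by auto
    hence "Idl (I \<union> T) \<subseteq> P 0" using genideal_minimal[OF P0i] by blast
    hence "?Q \<subseteq> saturation ?Q (P 0)" using Suc.prems(8) saturation_mono by blast
    also have "\<dots> \<subseteq> P 0" using saturation_prime[OF P0] mono by blast
    finally show False using mono[of 0 d] Suc.prems(4)[of d] by auto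
  qed
  then obtain t where t: "t \<in> T" "t \<notin> P 0" by blast
  have tc: "t \<in> carrier R" using t Suc.prems(6) ideal_subset_carrier[OF Qi] by auto
  obtain P' where P': "\<And>i. i\<le>d \<Longrightarrow> primeideal (P' i) R" "\<And>i. i<d \<Longrightarrow> P' i \<subset> P' (Suc i)"
    "P' d = ?Q" "P 0 \<subset> P' 0" "t \<in> P' 0"
  proof -
    have "t \<in> ?Q" using t Suc.prems(6) by auto
    moreover have "\<And>i. i \<le> d \<Longrightarrow> P i \<subset> P (Suc i)" using Suc.prems(4) by simp
    ultimately show ?thesis using prime_chain_through[of d P t] Suc.prems(3) t(2) that by blast
  qed
  define I' where "I' = I <+>\<^bsub>R\<^esub> PIdl t"
  have I': "ideal I' R" "I \<subseteq> I'" "t \<in> I'" using ideal_add_PIdl[OF Suc.prems(1) tc] unfolding I'_def by auto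
  have P'0i: "ideal (P' 0) R" using P'(1) primeideal.axioms(1) by blast
  have "P' 0 \<subseteq> saturation (P' d) I'"
  proof (rule Suc.IH[of I' P' "T - {t}"])
    have "PIdl t \<subseteq> P' 0" using cgenideal_minimal[OF P'0i P'(5)] .
    thus "I' \<subseteq> P' 0" unfolding I'_def using set_add_subset[OF P'0i] P'(4) Suc.prems(2) by blast
    show "finite (T - {t})" "T - {t} \<subseteq> P' d" using Suc.prems P' by auto
    show "card (T - {t}) \<le> d" using Suc.prems t by (simp add: card_Diff_singleton)
    have sub: "I' \<union> (T - {t}) \<subseteq> carrier R"
      using ideal_subset_carrier[OF I'(1)] Suc.prems(6) ideal_subset_carrier[OF Qi] by auto
    have "I \<union> T \<subseteq> Idl (I' \<union> (T - {t}))" using genideal_self[OF sub] I' by auto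
    hence "Idl (I \<union> T) \<subseteq> Idl (I' \<union> (T - {t}))" using genideal_minimal[OF genideal_ideal[OF sub]] by blast
    thus "P' d \<subseteq> saturation (P' d) (Idl (I' \<union> (T - {t})))"
      using Suc.prems(8) P'(3) saturation_mono by (metis subset_trans)
  qed (use P' I' in auto)
  hence loc: "P 0 \<subseteq> saturation ?Q I'" using P' by auto
  \<comment> \<open>From s a = i + r t with a and i in the prime P 0 and t outside it, r lies in P
    0. So P 0 is I + t P 0 locally, and Nakayama removes the second term.\<close>
  show ?case
  proof (rule local_nakayama[OF Q P0i Suc.prems(1)])
    fix N assume N: "ideal N R" "I \<subseteq> N" and H: "\<And>k a. k \<in> ?Q \<Longrightarrow> a \<in> P 0 \<Longrightarrow> k \<otimes> a \<in> N"
    show "P 0 \<subseteq> saturation ?Q N"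
    proof
      fix a assume a: "a \<in> P 0"
      have ac: "a \<in> carrier R" using a ideal_subset_carrier[OF P0i] by auto
      obtain s where s: "s \<in> carrier R - ?Q" "s \<otimes> a \<in> I'" using a loc unfolding saturation_def by auto
      then obtain i r where ir: "i \<in> I" "r \<in> carrier R" "s \<otimes> a = i \<oplus> r \<otimes> t"
        unfolding I'_def mem_add_PIdl_iff by blast
      have ic: "i \<in> carrier R" using ir Ic by auto
      have eq: "r \<otimes> t = s \<otimes> a \<ominus> i" unfolding ir(3) using ic ir(2) tc by algebra
      have "r \<otimes> t \<in> P 0" unfolding eq
        using a s(1) ir(1) Suc.prems(2) by (auto intro!: ideal_minus_closed[OF P0i] ideal_mult_closed[OF P0i])
      hence "r \<in> P 0" using primeideal.I_prime[OF P0 ir(2) tc] t by blast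
      hence "t \<otimes> r \<in> N" using H t Suc.prems(6) by auto
      hence "s \<otimes> a \<in> N" unfolding ir(3) using ir N ideal_add_closed[OF N(1)] m_comm[OF tc ir(2)] by auto
      thus "a \<in> saturation ?Q N" using s ac unfolding saturation_def by auto
    qed
  qed
qed

end

section \<open>Regular rings are reduced\<close>

text \<open>Turns a finite Krull dimension into a chain of primes of exactly that length.\<close>

lemma SUP_enat_attained:
  assumes "K \<noteq> {}" "(SUP k\<in>K. enat k) = enat d" shows "d \<in> K"
proof -
  have le: "k \<le> d" if "k \<in> K" for k
    using SUP_upper[OF that, of enat] assms(2) by simp
  hence fin: "finite K" using finite_nat_set_iff_bounded_le by blast
  have "(SUP k\<in>K. enat k) \<le> enat (Max K)"
    using fin by (intro SUP_least) simp
  hence "d \<le> Max K" using assms(2) by simp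
  moreover have "Max K \<in> K" using fin assms(1) by simp
  ultimately show ?thesis using le[of "Max K"] by (metis antisym)
qed

section \<open>Localization at a prime: extension and contraction of ideals\<close>

locale localization_at_prime = cring R for R (structure) +
  fixes Q assumes prime: "primeideal Q R"
begin

abbreviation "U \<equiv> carrier R - Q"
abbreviation "L \<equiv> localization R Q"

lemma one_U: "\<one> \<in> U" using primeideal_one_notin[OF prime] .
lemma mult_U: "s \<in> U \<Longrightarrow> t \<in> U \<Longrightarrow> s \<otimes> t \<in> U" using primeideal_mult_notin[OF prime] .

lemma frac_rel_iff: "((a, s), (b, t)) \<in> frac_rel R Q \<longleftrightarrow> a \<in> carrier R \<and> b \<in> carrier R \<and>
     s \<in> U \<and> t \<in> U \<and> (\<exists>u \<in> U. u \<otimes> (a \<otimes> t) = u \<otimes> (b \<otimes> s))"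
proof -
  have "u \<otimes> (a \<otimes> t \<ominus> b \<otimes> s) = \<zero> \<longleftrightarrow> u \<otimes> (a \<otimes> t) = u \<otimes> (b \<otimes> s)"
    if "a \<in> carrier R" "b \<in> carrier R" "s \<in> carrier R" "t \<in> carrier R" "u \<in> carrier R" for u
  proof -
    have "u \<otimes> (a \<otimes> t \<ominus> b \<otimes> s) = u \<otimes> (a \<otimes> t) \<ominus> u \<otimes> (b \<otimes> s)" using that by algebra
    thus ?thesis using that by simp
  qed
  thus ?thesis unfolding frac_rel_def by auto
qed

lemma equiv_frac_rel: "equiv (carrier R \<times> U) (frac_rel R Q)"
proof (rule equivI)
  show "frac_rel R Q \<subseteq> (carrier R \<times> U) \<times> (carrier R \<times> U)" unfolding frac_rel_def by auto
  show "refl_on (carrier R \<times> U) (frac_rel R Q)"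
    using one_U by (auto intro!: refl_onI simp: frac_rel_iff)
  show "sym (frac_rel R Q)"
  proof (rule symI, clarify)
    fix a s b t assume "((a, s), (b, t)) \<in> frac_rel R Q"
    thus "((b, t), (a, s)) \<in> frac_rel R Q" unfolding frac_rel_iff by metis
  qed
  show "trans (frac_rel R Q)"
  proof (rule transI, clarify)
    fix a s b t c w assume "((a, s), (b, t)) \<in> frac_rel R Q" "((b, t), (c, w)) \<in> frac_rel R Q"
    then obtain u v where c: "a \<in> carrier R" "b \<in> carrier R" "c \<in> carrier R" "s \<in> U" "t \<in> U" "w \<in> U"
      and uv: "u \<in> U" "v \<in> U" "u \<otimes> (a \<otimes> t) = u \<otimes> (b \<otimes> s)" "v \<otimes> (b \<otimes> w) = v \<otimes> (c \<otimes> t)"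
      unfolding frac_rel_iff by auto
    have cc: "s \<in> carrier R" "t \<in> carrier R" "w \<in> carrier R" "u \<in> carrier R" "v \<in> carrier R" using c uv by auto
    have "((u \<otimes> v) \<otimes> t) \<otimes> (a \<otimes> w) = (v \<otimes> w) \<otimes> (u \<otimes> (a \<otimes> t))" using c cc by algebra
    also have "\<dots> = (u \<otimes> s) \<otimes> (v \<otimes> (b \<otimes> w))" unfolding uv(3) using c cc by algebra
    also have "\<dots> = ((u \<otimes> v) \<otimes> t) \<otimes> (c \<otimes> s)" unfolding uv(4) using c cc by algebra
    finally show "((a, s), (c, w)) \<in> frac_rel R Q"
      unfolding frac_rel_iff using c mult_U[OF mult_U[OF uv(1,2)] c(5)] by blast
  qed
qed

lemma frac_eq_iff:
  assumes "a \<in> carrier R" "s \<in> U" "b \<in> carrier R" "t \<in> U"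
  shows "frac R Q a s = frac R Q b t \<longleftrightarrow> (\<exists>u \<in> U. u \<otimes> (a \<otimes> t) = u \<otimes> (b \<otimes> s))"
proof -
  have "frac R Q a s = frac R Q b t \<longleftrightarrow> ((a, s), (b, t)) \<in> frac_rel R Q"
    unfolding frac_def using eq_equiv_class_iff[OF equiv_frac_rel, of "(a,s)" "(b,t)"] assms by simp
  thus ?thesis unfolding frac_rel_iff using assms by simp
qed

lemma carrier_localization: "carrier L = {frac R Q a s |a s. a \<in> carrier R \<and> s \<in> U}"
  unfolding localization_def frac_def quotient_def by auto

lemma frac_closed: "a \<in> carrier R \<Longrightarrow> s \<in> U \<Longrightarrow> frac R Q a s \<in> carrier L"
  unfolding carrier_localization by blast

lemma frac_mult:
  assumes "a \<in> carrier R" "s \<in> U" "b \<in> carrier R" "t \<in> U"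
  shows "frac R Q a s \<otimes>\<^bsub>L\<^esub> frac R Q b t = frac R Q (a \<otimes> b) (s \<otimes> t)"
proof -
  let ?f = "\<lambda>x y. frac R Q (fst x \<otimes> fst y) (snd x \<otimes> snd y)"
  have "congruent2 (frac_rel R Q) (frac_rel R Q) ?f"
  proof (rule congruent2I', clarsimp)
    fix a s b t c w d z assume "((a, s), (b, t)) \<in> frac_rel R Q" "((c, w), (d, z)) \<in> frac_rel R Q"
    then obtain u v where c: "{a, b, c, d} \<subseteq> carrier R" "{s, t, w, z} \<subseteq> U" and uv: "{u, v} \<subseteq> U"
      "u \<otimes> (a \<otimes> t) = u \<otimes> (b \<otimes> s)" "v \<otimes> (c \<otimes> z) = v \<otimes> (d \<otimes> w)"
      unfolding frac_rel_iff by auto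
    have cc: "a \<in> carrier R" "b \<in> carrier R" "c \<in> carrier R" "d \<in> carrier R" "s \<in> carrier R"
      "t \<in> carrier R" "w \<in> carrier R" "z \<in> carrier R" "u \<in> carrier R" "v \<in> carrier R" using c uv by auto
    have "(u \<otimes> v) \<otimes> ((a \<otimes> c) \<otimes> (t \<otimes> z)) = (u \<otimes> (a \<otimes> t)) \<otimes> (v \<otimes> (c \<otimes> z))" using cc by algebra
    also have "\<dots> = (u \<otimes> v) \<otimes> ((b \<otimes> d) \<otimes> (s \<otimes> w))" unfolding uv(2,3) using cc by algebra
    finally show "frac R Q (a \<otimes> c) (s \<otimes> w) = frac R Q (b \<otimes> d) (t \<otimes> z)"
      using mult_U[of u v] uv(1) c mult_U by (subst frac_eq_iff) auto
  qed
  from UN_equiv_class2[OF equiv_frac_rel equiv_frac_rel this, of "(a, s)" "(b, t)"] assms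
  show ?thesis unfolding localization_def frac_def[of R Q a s] frac_def[of R Q b t] by (simp add: split_def)
qed

lemma frac_add:
  assumes "a \<in> carrier R" "s \<in> U" "b \<in> carrier R" "t \<in> U"
  shows "frac R Q a s \<oplus>\<^bsub>L\<^esub> frac R Q b t = frac R Q (a \<otimes> t \<oplus> b \<otimes> s) (s \<otimes> t)"
proof -
  let ?f = "\<lambda>x y. frac R Q (fst x \<otimes> snd y \<oplus> fst y \<otimes> snd x) (snd x \<otimes> snd y)"
  have "congruent2 (frac_rel R Q) (frac_rel R Q) ?f"
  proof (rule congruent2I', clarsimp)
    fix a s b t c w d z assume "((a, s), (b, t)) \<in> frac_rel R Q" "((c, w), (d, z)) \<in> frac_rel R Q"
    then obtain u v where c: "{a, b, c, d} \<subseteq> carrier R" "{s, t, w, z} \<subseteq> U" and uv: "{u, v} \<subseteq> U"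
      "u \<otimes> (a \<otimes> t) = u \<otimes> (b \<otimes> s)" "v \<otimes> (c \<otimes> z) = v \<otimes> (d \<otimes> w)"
      unfolding frac_rel_iff by auto
    have cc: "a \<in> carrier R" "b \<in> carrier R" "c \<in> carrier R" "d \<in> carrier R" "s \<in> carrier R"
      "t \<in> carrier R" "w \<in> carrier R" "z \<in> carrier R" "u \<in> carrier R" "v \<in> carrier R" using c uv by auto
    have "(u \<otimes> v) \<otimes> ((a \<otimes> w \<oplus> c \<otimes> s) \<otimes> (t \<otimes> z)) =
      (v \<otimes> w \<otimes> z) \<otimes> (u \<otimes> (a \<otimes> t)) \<oplus> (u \<otimes> s \<otimes> t) \<otimes> (v \<otimes> (c \<otimes> z))" using cc by algebra
    also have "\<dots> = (u \<otimes> v) \<otimes> ((b \<otimes> z \<oplus> d \<otimes> t) \<otimes> (s \<otimes> w))" unfolding uv(2,3) using cc by algebra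
    finally show "frac R Q (a \<otimes> w \<oplus> c \<otimes> s) (s \<otimes> w) = frac R Q (b \<otimes> z \<oplus> d \<otimes> t) (t \<otimes> z)"
      using mult_U[of u v] uv(1) c mult_U by (subst frac_eq_iff) auto
  qed
  from UN_equiv_class2[OF equiv_frac_rel equiv_frac_rel this, of "(a, s)" "(b, t)"] assms
  show ?thesis unfolding localization_def frac_def[of R Q a s] frac_def[of R Q b t] by (simp add: split_def)
qed

lemma one_localization: "\<one>\<^bsub>L\<^esub> = frac R Q \<one> \<one>"
  and zero_localization: "\<zero>\<^bsub>L\<^esub> = frac R Q \<zero> \<one>"
  unfolding localization_def by auto

lemma frac_self: "s \<in> U \<Longrightarrow> frac R Q s s = \<one>\<^bsub>L\<^esub>"
  unfolding one_localization using one_U by (subst frac_eq_iff) (auto intro!: bexI[of _ \<one>])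

lemma frac_split: "a \<in> carrier R \<Longrightarrow> s \<in> U \<Longrightarrow> frac R Q a s = frac R Q a \<one> \<otimes>\<^bsub>L\<^esub> frac R Q \<one> s"
  using one_U by (simp add: frac_mult)

lemma frac_cancel:
  assumes "a \<in> carrier R" "s \<in> U" shows "frac R Q s \<one> \<otimes>\<^bsub>L\<^esub> frac R Q a s = frac R Q a \<one>"
  using assms one_U mult_U by (auto simp: frac_mult frac_eq_iff intro!: bexI[of _ \<one>] m_comm)

definition extension :: "'a set \<Rightarrow> ('a \<times> 'a) set set" where
  "extension I = {frac R Q a s |a s. a \<in> I \<and> s \<in> U}"

lemma extension_ideal:
  assumes L: "cring L" and I: "ideal I R" shows "ideal (extension I) L"
proof (rule cring.idealI_closed[OF L])
  have Ic: "I \<subseteq> carrier R" using ideal_subset_carrier[OF I] .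
  show "extension I \<subseteq> carrier L" using Ic unfolding extension_def carrier_localization by blast
  show "\<zero>\<^bsub>L\<^esub> \<in> extension I"
    unfolding zero_localization extension_def using one_U ideal_zero_closed[OF I] by blast
  show "\<alpha> \<oplus>\<^bsub>L\<^esub> \<beta> \<in> extension I" if mem: "\<alpha> \<in> extension I" "\<beta> \<in> extension I" for \<alpha> \<beta>
  proof -
    obtain a s b t where ab: "a \<in> I" "s \<in> U" "\<alpha> = frac R Q a s" "b \<in> I" "t \<in> U" "\<beta> = frac R Q b t"
      using mem unfolding extension_def by blast
    have "a \<otimes> t \<oplus> b \<otimes> s \<in> I"
      using ab by (auto intro!: ideal_add_closed[OF I] ideal_mult_closed'[OF I])
    thus ?thesis using ab Ic mult_U[of s t] frac_add[of a s b t] unfolding extension_def by blast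
  qed
  show "\<rho> \<otimes>\<^bsub>L\<^esub> \<alpha> \<in> extension I" if mem: "\<rho> \<in> carrier L" "\<alpha> \<in> extension I" for \<rho> \<alpha>
  proof -
    obtain a s r t where ab: "a \<in> I" "s \<in> U" "\<alpha> = frac R Q a s" "r \<in> carrier R" "t \<in> U" "\<rho> = frac R Q r t"
      using mem unfolding extension_def carrier_localization by blast
    have "r \<otimes> a \<in> I" using ideal_mult_closed[OF I] ab by blast
    thus ?thesis using ab Ic mult_U[of t s] frac_mult[of r t a s] unfolding extension_def by blast
  qed
qed

text \<open>The way back from the localization: membership in an extended ideal becomes membership
  of the numerator in a saturation.\<close>

lemma frac_mem_extension:
  assumes I: "ideal I R" and "a \<in> carrier R" "s \<in> U" "frac R Q a s \<in> extension I"
  shows "a \<in> saturation Q I"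
proof -
  obtain b t where bt: "b \<in> I" "t \<in> U" "frac R Q a s = frac R Q b t"
    using assms(4) unfolding extension_def by blast
  have bc: "b \<in> carrier R" using bt(1) ideal_subset_carrier[OF I] by blast
  obtain u where u: "u \<in> U" "u \<otimes> (a \<otimes> t) = u \<otimes> (b \<otimes> s)"
    using frac_eq_iff[OF assms(2,3) bc bt(2)] bt(3) by blast
  have "(u \<otimes> t) \<otimes> a = u \<otimes> (a \<otimes> t)" using u bt assms by (simp, algebra)
  also have "\<dots> \<in> I" unfolding u(2)
    using u(1) assms(3) ideal_mult_closed[OF I ideal_mult_closed'[OF I bt(1)]] by blast
  finally show ?thesis using mult_U[OF u(1) bt(2)] assms(2) unfolding saturation_def by blast
qed

definition contraction :: "('a \<times> 'a) set set \<Rightarrow> 'a set" where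
  "contraction P = {a \<in> carrier R. frac R Q a \<one> \<in> P}"

lemma frac_unit_notin:
  assumes P: "ideal P L" "P \<noteq> carrier L" and L: "cring L" and a: "a \<in> U" "s \<in> U"
  shows "frac R Q a s \<notin> P"
proof
  interpret L: cring L by (rule L)
  assume "frac R Q a s \<in> P"
  hence "frac R Q s a \<otimes>\<^bsub>L\<^esub> frac R Q a s \<in> P"
    using L.ideal_mult_closed[OF P(1)] frac_closed a by blast
  moreover have "frac R Q s a \<otimes>\<^bsub>L\<^esub> frac R Q a s = \<one>\<^bsub>L\<^esub>"
    using a mult_U[OF a] m_comm[of s a] frac_self[of "a \<otimes> s"] by (simp add: frac_mult)
  ultimately show False using P ideal.one_imp_carrier by metis
qed

lemma contraction_prime:
  assumes P: "primeideal P L" shows "primeideal (contraction P) R"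
proof -
  have Pi: "ideal P L" and L: "cring L" using P by (auto simp: primeideal_def)
  interpret L: cring L by (rule L)
  have id: "ideal (contraction P) R"
  proof (rule idealI_closed)
    show "contraction P \<subseteq> carrier R" unfolding contraction_def by auto
    show "\<zero> \<in> contraction P"
      using L.ideal_zero_closed[OF Pi] zero_localization unfolding contraction_def by auto
    show "a \<oplus> b \<in> contraction P" if "a \<in> contraction P" "b \<in> contraction P" for a b
      using that L.ideal_add_closed[OF Pi, of "frac R Q a \<one>" "frac R Q b \<one>"] one_U
      unfolding contraction_def by (simp add: frac_add)
    show "r \<otimes> a \<in> contraction P" if "r \<in> carrier R" "a \<in> contraction P" for r a
      using that L.ideal_mult_closed[OF Pi, of "frac R Q a \<one>" "frac R Q r \<one>"] one_U frac_closed[OF that(1) one_U]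
      unfolding contraction_def by (simp add: frac_mult)
  qed
  show ?thesis
  proof (rule primeidealI[OF id is_cring])
    have "\<one> \<notin> contraction P"
      using frac_unit_notin[OF Pi _ L one_U one_U] primeideal.I_notcarr[OF P] unfolding contraction_def by auto
    thus "carrier R \<noteq> contraction P" by auto
    show "a \<in> contraction P \<or> b \<in> contraction P"
      if "a \<in> carrier R" "b \<in> carrier R" "a \<otimes> b \<in> contraction P" for a b
      using that primeideal.I_prime[OF P frac_closed[OF that(1) one_U] frac_closed[OF that(2) one_U]] one_U
      unfolding contraction_def by (simp add: frac_mult)
  qed
qed

lemma contraction_subset:
  assumes P: "primeideal P L" shows "contraction P \<subseteq> Q"
proof
  fix a assume "a \<in> contraction P"
  thus "a \<in> Q" using frac_unit_notin[of P a \<one>] P primeideal.I_notcarr[OF P] one_U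
    unfolding contraction_def by (auto simp: primeideal_def)
qed

text \<open>Denominators are units, so a fraction that separates two primes of the localization has
  a numerator that separates their contractions.\<close>

lemma contraction_strict_mono:
  assumes P: "primeideal P L" and P': "primeideal P' L" and PP': "P \<subset> P'"
  shows "contraction P \<subset> contraction P'"
proof -
  have Pi: "ideal P L" "ideal P' L" and L: "cring L" using P P' by (auto simp: primeideal_def)
  interpret L: cring L by (rule L)
  obtain \<alpha> where \<alpha>: "\<alpha> \<in> P'" "\<alpha> \<notin> P" using PP' by blast
  then obtain a s where as: "a \<in> carrier R" "s \<in> U" "\<alpha> = frac R Q a s"
    using L.ideal_subset_carrier[OF Pi(2)] unfolding carrier_localization by blast
  have "frac R Q a \<one> \<in> P'"
    using L.ideal_mult_closed[OF Pi(2) \<alpha>(1), of "frac R Q s \<one>"] frac_cancel[OF as(1,2)] as one_U frac_closed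
    by auto
  moreover have "frac R Q a \<one> \<notin> P"
    using L.ideal_mult_closed'[OF Pi(1), of "frac R Q a \<one>" "frac R Q \<one> s"] frac_split[OF as(1,2)] as frac_closed \<alpha>
    by auto
  ultimately show ?thesis using as PP' unfolding contraction_def by blast
qed

text \<open>Restates regularity of the localization inside R, in the form that
  \<open>local_domain_if_regular\<close> consumes: a chain of length d ending at Q, and at most d
  elements that generate Q locally.\<close>

lemma regular_localization_chain:
  assumes reg: "regular_local_ring L"
  shows "\<exists>P d T. (\<forall>i\<le>d. primeideal (P i) R) \<and> (\<forall>i<d. P i \<subset> P (Suc i)) \<and> P d = Q \<and>
    finite T \<and> T \<subseteq> Q \<and> card T \<le> d \<and> Q \<subseteq> saturation Q (Idl T)"
proof -
  have L: "cring L" using reg unfolding regular_local_ring_def by blast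
  interpret L: cring L by (rule L)
  obtain A where A: "A \<subseteq> carrier L" "finite A" "maximalideal (Idl\<^bsub>L\<^esub> A) L" "enat (card A) = krull_dim L"
    using reg unfolding regular_local_ring_def by blast
  let ?N = "Idl\<^bsub>L\<^esub> A"
  define d where "d = card A"
  have Ni: "ideal ?N L" "?N \<noteq> carrier L" using A(3) by (auto simp: maximalideal_def maximalideal_axioms_def)
  have Qi: "ideal Q R" using prime by (simp add: primeideal_def)
  have Qc: "Q \<subseteq> carrier R" using ideal_subset_carrier[OF Qi] .
  define K where "K = {k. \<exists>P :: nat \<Rightarrow> ('a \<times> 'a) set set. (\<forall>i \<le> k. primeideal (P i) L) \<and> (\<forall>i < k. P i \<subset> P (Suc i))}"
  have "0 \<in> K" unfolding K_def using L.maximalideal_prime[OF A(3)] by (auto intro!: exI[of _ "\<lambda>_. ?N"])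
  moreover have "(SUP k\<in>K. enat k) = enat d" using A(4) unfolding krull_dim_def d_def K_def by simp
  ultimately have "d \<in> K" using SUP_enat_attained[of K d] by auto
  then obtain P where P: "\<forall>i \<le> d. primeideal (P i) L" "\<forall>i < d. P i \<subset> P (Suc i)"
    unfolding K_def by auto
  \<comment> \<open>The last member is replaced by Q. All contractions lie in Q, so the chain
    remains strict whether or not its last prime was the maximal ideal.\<close>
  define P' where "P' = (\<lambda>i. if i = d then Q else contraction (P i))"
  have P'1: "\<forall>i\<le>d. primeideal (P' i) R" unfolding P'_def using prime P contraction_prime by auto
  have P'2: "P' i \<subset> P' (Suc i)" if "i < d" for i
  proof -
    have "contraction (P i) \<subset> contraction (P (Suc i))" using P that contraction_strict_mono by simp
    moreover have "contraction (P (Suc i)) \<subseteq> Q" using P that contraction_subset by simp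
    ultimately show ?thesis using that unfolding P'_def by auto
  qed
  \<comment> \<open>A fraction whose numerator is outside Q is a unit, so the proper ideal
    \<open>?N\<close> lies in the extension of Q, which is proper too; maximality gives
    equality.\<close>
  have NQ: "?N = extension Q"
  proof -
    have "?N \<subseteq> extension Q"
    proof
      fix \<alpha> assume \<alpha>: "\<alpha> \<in> ?N"
      then obtain a s where as: "a \<in> carrier R" "s \<in> U" "\<alpha> = frac R Q a s"
        using L.ideal_subset_carrier[OF Ni(1)] unfolding carrier_localization by blast
      hence "a \<in> Q" using frac_unit_notin[OF Ni L, of a s] \<alpha> by auto
      thus "\<alpha> \<in> extension Q" using as unfolding extension_def by blast
    qed
    moreover have "extension Q \<noteq> carrier L"
    proof
      assume "extension Q = carrier L"
      hence "\<one> \<in> saturation Q Q" using frac_mem_extension[OF Qi _ one_U, of \<one>] frac_closed one_U by auto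
      thus False using saturation_prime[OF prime] one_U by auto
    qed
    moreover note maximalideal.I_maximal[OF A(3) extension_ideal[OF L Qi] _ L.ideal_subset_carrier[OF extension_ideal[OF L Qi]]]
    ultimately show ?thesis by metis
  qed
  \<comment> \<open>Denominators are units, so numerators of the generators generate locally as
    well. Distinct fractions may receive the same numerator, whence only an upper bound on
    \<open>card T\<close>.\<close>
  have "\<forall>\<alpha>\<in>A. \<exists>a. a \<in> carrier R \<and> (\<exists>s\<in>U. \<alpha> = frac R Q a s)"
  proof
    fix \<alpha> assume "\<alpha> \<in> A"
    hence "\<alpha> \<in> carrier L" using A(1) by (rule subsetD[rotated])
    thus "\<exists>a. a \<in> carrier R \<and> (\<exists>s\<in>U. \<alpha> = frac R Q a s)" unfolding carrier_localization by blast
  qed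
  from bchoice[OF this] obtain f where
    f: "\<And>\<alpha>. \<alpha> \<in> A \<Longrightarrow> f \<alpha> \<in> carrier R \<and> (\<exists>s\<in>U. \<alpha> = frac R Q (f \<alpha>) s)" by blast
  define T where "T = f ` A"
  have T: "finite T" "card T \<le> d" unfolding T_def d_def using A(2) card_image_le by auto
  have TQ: "T \<subseteq> Q"
  proof
    fix a assume "a \<in> T"
    then obtain \<alpha> where \<alpha>: "\<alpha> \<in> A" "a = f \<alpha>" unfolding T_def by blast
    then obtain s where s: "a \<in> carrier R" "s \<in> U" "\<alpha> = frac R Q a s" using f by blast
    have "\<alpha> \<in> extension Q" using L.genideal_self[OF A(1)] \<alpha>(1) NQ by blast
    hence "a \<in> saturation Q Q" using frac_mem_extension[OF Qi s(1,2)] s(3) by simp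
    thus "a \<in> Q" using saturation_prime[OF prime] by blast
  qed
  have TI: "ideal (Idl T) R" "T \<subseteq> Idl T" using TQ Qc genideal_ideal genideal_self by auto
  have "A \<subseteq> extension (Idl T)"
  proof
    fix \<alpha> assume \<alpha>: "\<alpha> \<in> A"
    hence "f \<alpha> \<in> Idl T" using TI(2) unfolding T_def by blast
    thus "\<alpha> \<in> extension (Idl T)" using f[OF \<alpha>] unfolding extension_def by blast
  qed
  hence NT: "?N \<subseteq> extension (Idl T)" using L.genideal_minimal[OF extension_ideal[OF L TI(1)]] by blast
  have "Q \<subseteq> saturation Q (Idl T)"
  proof
    fix q assume q: "q \<in> Q"
    hence "frac R Q q \<one> \<in> extension Q" unfolding extension_def using one_U by blast
    thus "q \<in> saturation Q (Idl T)" using frac_mem_extension[OF TI(1) _ one_U, of q] NQ NT q Qc by blast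
  qed
  thus ?thesis using P'1 P'2 T TQ by (intro exI[of _ P'] exI[of _ d] exI[of _ T]) (auto simp: P'_def)
qed

end

text \<open>A nonzero z has a proper annihilator, contained in some maximal ideal M. A nilpotent z
  lies in the bottom prime P 0 of the chain at M, which vanishes locally; so some s outside M kills
  z, although s belongs to the annihilator.\<close>

lemma regular_ring_reduced:
  fixes R (structure)
  assumes reg: "regular_ring R" and z: "z \<in> carrier R" "z [^] (k::nat) = \<zero>"
  shows "z = \<zero>"
proof (rule ccontr)
  assume nz: "z \<noteq> \<zero>"
  interpret noetherian_cring R
    using reg unfolding regular_ring_def noetherian_cring_def by blast
  let ?Ann = "{r \<in> carrier R. r \<otimes> z = \<zero>}"
  have Ann: "ideal ?Ann R" using colon_ideal[OF zeroideal z(1)] by simp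
  define C where "C = {I. ideal I R \<and> ?Ann \<subseteq> I \<and> \<one> \<notin> I}"
  have "?Ann \<in> C" using Ann nz z unfolding C_def by auto
  hence "\<exists>M\<in>C. \<forall>W\<in>C. M \<subseteq> W \<longrightarrow> W = M"
    by (intro exists_maximal_ideal_in) (auto simp: C_def)
  then obtain M where "M \<in> C" and max: "\<And>W. W \<in> C \<Longrightarrow> M \<subseteq> W \<Longrightarrow> W = M" by blast
  hence M: "ideal M R" "?Ann \<subseteq> M" "\<one> \<notin> M" unfolding C_def by auto
  have "maximalideal M R"
  proof (rule maximalidealI[OF M(1)])
    show "carrier R \<noteq> M" using M(3) by auto
    fix J assume J: "ideal J R" "M \<subseteq> J" "J \<subseteq> carrier R"
    show "J = M \<or> J = carrier R"
      using max[of J] J M(2) ideal.one_imp_carrier[OF J(1)] unfolding C_def by blast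
  qed
  hence prime: "primeideal M R" by (rule maximalideal_prime)
  interpret localization_at_prime R M
    by (intro localization_at_prime.intro is_cring localization_at_prime_axioms.intro prime)
  have "regular_local_ring (localization R M)" using reg prime unfolding regular_ring_def by simp
  from regular_localization_chain[OF this] obtain P d T where PT: "\<And>i. i\<le>d \<Longrightarrow> primeideal (P i) R" "\<And>i. i<d \<Longrightarrow> P i \<subset> P (Suc i)" "P d = M"
    "finite T" "T \<subseteq> M" "card T \<le> d" "M \<subseteq> saturation M (Idl T)"
    by blast
  have P0i: "ideal (P 0) R" using PT(1)[of 0] by (simp add: primeideal_def)
  have Tc: "T \<subseteq> carrier R" using PT(5) ideal_subset_carrier[OF M(1)] by blast
  have "Idl T \<subseteq> Idl ({\<zero>} \<union> T)"
    using Tc by (intro subset_Idl_subset) auto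
  hence "M \<subseteq> saturation M (Idl ({\<zero>} \<union> T))" using PT(7) saturation_mono by blast
  hence "P 0 \<subseteq> saturation M {\<zero>}"
    using local_domain_if_regular[of "{\<zero>}" P d T] PT zeroideal ideal_zero_closed[OF P0i] by auto
  moreover have "z \<in> P 0"
    using primeideal_pow_mem[OF PT(1)[of 0] z(1), of k] z(2) ideal_zero_closed[OF P0i] by simp
  ultimately show False using M(2) unfolding saturation_def by auto
qed

section \<open>The Frobenius and restricted monomials\<close>

definition exp_box :: "nat \<Rightarrow> nat \<Rightarrow> (nat \<Rightarrow> nat) set" where
  "exp_box p n = {..<n} \<rightarrow>\<^sub>E {..<p}"

lemma finite_exp_box: "finite (exp_box p n)"
  unfolding exp_box_def by (simp add: finite_PiE)

context cring
begin

lemma binomial: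
  assumes a: "a \<in> carrier R" and b: "b \<in> carrier R"
  shows "(a \<oplus> b) [^] (n::nat) = (\<Oplus>k\<in>{..n}. [(n choose k)] \<cdot>\<^bsub>R\<^esub> (a [^] k \<otimes> b [^] (n - k)))"
proof -
  define t where "t = (\<lambda>n k. [(n choose k)] \<cdot>\<^bsub>R\<^esub> (a [^] k \<otimes> b [^] (n - k)))"
  have tc: "t n k \<in> carrier R" for n k using a b unfolding t_def by simp
  have zero: "t n (Suc n) = \<zero>" for n unfolding t_def by (simp add: binomial_eq_0)
  have step: "t (Suc n) (Suc k) = a \<otimes> t n k \<oplus> b \<otimes> t n (Suc k)" if k: "k \<le> n" for n k
  proof -
    have at: "a \<otimes> t n k = [(n choose k)] \<cdot>\<^bsub>R\<^esub> (a [^] Suc k \<otimes> b [^] (n - k))"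
      unfolding t_def using a b by (simp add: add_pow_rdistr m_assoc m_lcomm m_comm)
    have bt: "b \<otimes> t n (Suc k) = [(n choose Suc k)] \<cdot>\<^bsub>R\<^esub> (a [^] Suc k \<otimes> b [^] (n - k))"
    proof (cases "k = n")
      case False
      hence "n - k = Suc (n - Suc k)" using k by simp
      thus ?thesis unfolding t_def using a b by (simp add: add_pow_rdistr m_assoc m_lcomm m_comm)
    qed (use a b in \<open>simp add: t_def binomial_eq_0\<close>)
    have "t (Suc n) (Suc k) = [((n choose k) + (n choose Suc k))] \<cdot>\<^bsub>R\<^esub> (a [^] Suc k \<otimes> b [^] (n - k))"
      unfolding t_def by simp
    thus ?thesis unfolding at bt using a b by (simp add: add.nat_pow_mult del: nat_pow_Suc)
  qed
  have "(a \<oplus> b) [^] n = (\<Oplus>k\<in>{..n}. t n k)"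
  proof (induction n)
    case 0 thus ?case using a b by (simp add: t_def)
  next
    case (Suc n)
    \<comment> \<open>The out-of-range term \<open>t n (Suc n)\<close> is zero, so the shifted sum
      may run over the same index set.\<close>
    have low: "(\<Oplus>k\<in>{..n}. t n (Suc k)) \<oplus> t n 0 = (\<Oplus>k\<in>{..n}. t n k)"
    proof -
      have "(\<Oplus>k\<in>{..Suc n}. t n k) = (\<Oplus>k\<in>{..n}. t n (Suc k)) \<oplus> t n 0"
        using tc by (intro finsum_Suc2) auto
      moreover have "(\<Oplus>k\<in>{..Suc n}. t n k) = (\<Oplus>k\<in>{..n}. t n k)"
        using tc zero by (subst finsum_Suc) auto
      ultimately show ?thesis by simp
    qed
    let ?A = "\<Oplus>k\<in>{..n}. t n k" and ?B = "\<Oplus>k\<in>{..n}. t n (Suc k)"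
    have AB: "?A \<in> carrier R" "?B \<in> carrier R" using tc by auto
    have t0: "t (Suc n) 0 = b \<otimes> t n 0" unfolding t_def using a b by (simp add: m_comm)
    have "(\<Oplus>k\<in>{..Suc n}. t (Suc n) k) = (\<Oplus>k\<in>{..n}. t (Suc n) (Suc k)) \<oplus> t (Suc n) 0"
      using tc by (intro finsum_Suc2) auto
    also have "(\<Oplus>k\<in>{..n}. t (Suc n) (Suc k)) = (\<Oplus>k\<in>{..n}. a \<otimes> t n k \<oplus> b \<otimes> t n (Suc k))"
      using tc a b step by (intro finsum_cong') auto
    also have "\<dots> = a \<otimes> ?A \<oplus> b \<otimes> ?B"
      using tc a b by (simp add: finsum_addf finsum_rdistr Pi_def)
    also have "(a \<otimes> ?A \<oplus> b \<otimes> ?B) \<oplus> t (Suc n) 0 = a \<otimes> ?A \<oplus> b \<otimes> (?B \<oplus> t n 0)"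
      unfolding t0 using AB tc[of n 0] a b by (simp add: r_distr a_assoc)
    also have "\<dots> = (a \<oplus> b) \<otimes> ?A" unfolding low using AB a b by (simp add: l_distr)
    also have "\<dots> = (a \<oplus> b) [^] Suc n" using Suc AB a b by (simp add: m_comm)
    finally show ?case by simp
  qed
  thus ?thesis unfolding t_def .
qed

lemma char_p_multiple:
  assumes "char_p p R" "p dvd m" "a \<in> carrier R" shows "[m] \<cdot>\<^bsub>R\<^esub> a = \<zero>"
proof -
  obtain k where k: "m = p * k" using assms(2) by blast
  have "[m] \<cdot>\<^bsub>R\<^esub> a = [k] \<cdot>\<^bsub>R\<^esub> ([p] \<cdot>\<^bsub>R\<^esub> (\<one> \<otimes> a))" unfolding k using assms(3) by (simp add: add.nat_pow_pow)
  also have "[p] \<cdot>\<^bsub>R\<^esub> (\<one> \<otimes> a) = ([p] \<cdot>\<^bsub>R\<^esub> \<one>) \<otimes> a" using assms(3) by (subst add_pow_ldistr) auto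
  finally show ?thesis using assms unfolding char_p_def by simp
qed

lemma frobenius_add:
  assumes p: "Factorial_Ring.prime p" and "char_p p R" and a: "a \<in> carrier R" and b: "b \<in> carrier R"
  shows "(a \<oplus> b) [^] (p::nat) = a [^] p \<oplus> b [^] p"
proof -
  have p0: "p \<noteq> 0" using p by auto
  let ?t = "\<lambda>k. [(p choose k)] \<cdot>\<^bsub>R\<^esub> (a [^] k \<otimes> b [^] (p - k))"
  have "(a \<oplus> b) [^] p = (\<Oplus>k\<in>{..p}. ?t k)" by (rule binomial[OF a b])
  also have "\<dots> = (\<Oplus>k\<in>{0, p}. ?t k)"
  proof (rule add.finprod_mono_neutral_cong_right)
    fix k assume "k \<in> {..p} - {0, p}"
    hence "p dvd (p choose k)" using p by (intro dvd_choose_prime) auto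
    thus "?t k = \<zero>" using char_p_multiple[OF assms(2)] a b by simp
  qed (use a b in auto)
  also have "\<dots> = a [^] p \<oplus> b [^] p" using p0 a b by (simp add: add.m_comm)
  finally show ?thesis .
qed

text \<open>Deduced from additivity applied to (a - b) + b, which avoids the sign (-1)^p and a
  separate case p = 2.\<close>

lemma frobenius_minus:
  assumes p: "Factorial_Ring.prime p" and "char_p p R" and a: "a \<in> carrier R" and b: "b \<in> carrier R"
  shows "(a \<ominus> b) [^] (p::nat) = a [^] p \<ominus> b [^] p"
proof -
  have "((a \<ominus> b) \<oplus> b) [^] p = (a \<ominus> b) [^] p \<oplus> b [^] p"
    using frobenius_add[OF p assms(2) minus_closed[OF a b] b] .
  moreover have "(a \<ominus> b) \<oplus> b = a" using a b by algebra
  ultimately have eq: "a [^] p = (a \<ominus> b) [^] p \<oplus> b [^] p" by simp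
  have c: "(a \<ominus> b) [^] p \<in> carrier R" "b [^] p \<in> carrier R" using a b by auto
  show ?thesis unfolding eq using c by algebra
qed

lemma frobenius_subring:
  assumes p: "Factorial_Ring.prime p" and "char_p p R"
  shows "subring (frob_image p R) R"
proof (rule subringI)
  have p0: "p \<noteq> 0" using p by auto
  show "frob_image p R \<subseteq> carrier R" unfolding frob_image_def by auto
  show "\<one> \<in> frob_image p R" unfolding frob_image_def by (auto intro!: image_eqI[of _ _ \<one>])
  show add: "h1 \<oplus> h2 \<in> frob_image p R" if h: "h1 \<in> frob_image p R" "h2 \<in> frob_image p R" for h1 h2
  proof -
    obtain a b where ab: "a \<in> carrier R" "h1 = a [^] p" "b \<in> carrier R" "h2 = b [^] p"
      using h unfolding frob_image_def by blast
    have "h1 \<oplus> h2 = (a \<oplus> b) [^] p" using frobenius_add[OF assms ab(1,3)] ab by simp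
    thus ?thesis using ab unfolding frob_image_def by blast
  qed
  show "h1 \<otimes> h2 \<in> frob_image p R" if h: "h1 \<in> frob_image p R" "h2 \<in> frob_image p R" for h1 h2
    using h unfolding frob_image_def by (auto simp: nat_pow_distrib[symmetric])
  show "\<ominus> h \<in> frob_image p R" if h: "h \<in> frob_image p R" for h
  proof -
    obtain a where a: "a \<in> carrier R" "h = a [^] p" using h unfolding frob_image_def by blast
    have z: "\<zero> [^] p = \<zero>" using p0 by (rule nat_pow_zero)
    have "(\<zero> \<ominus> a) [^] p = \<zero> \<ominus> a [^] p"
      using frobenius_minus[OF assms zero_closed a(1)] unfolding z .
    hence "\<ominus> h = (\<zero> \<ominus> a) [^] p" using a by (simp add: a_minus_def)
    thus ?thesis using a unfolding frob_image_def by blast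
  qed
qed

lemma monomial_closed:
  assumes "t \<in> {..<n} \<rightarrow> carrier R" shows "monomial R n t b \<in> carrier R"
  unfolding monomial_def using assms by (auto intro!: finprod_closed)

lemma monomial_zero:
  assumes "t \<in> {..<n} \<rightarrow> carrier R" "\<And>i. i < n \<Longrightarrow> b i = 0" shows "monomial R n t b = \<one>"
  unfolding monomial_def using assms by (intro finprod_one_eqI) auto

lemma monomial_cong:
  assumes "u \<in> {..<n} \<rightarrow> carrier R" "\<And>i. i < n \<Longrightarrow> t i = u i" "\<And>i. i < n \<Longrightarrow> b i = c i"
  shows "monomial R n t b = monomial R n u c"
  unfolding monomial_def using assms by (intro finprod_cong') (auto simp: Pi_def)

lemma monomial_split:
  assumes "t \<in> {..<n} \<rightarrow> carrier R" "j < n"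
  shows "monomial R n t b = t j [^] b j \<otimes> (\<Otimes>i\<in>{..<n} - {j}. t i [^] b i)"
proof -
  have "{..<n} = insert j ({..<n} - {j})" using assms by auto
  hence "monomial R n t b = (\<Otimes>i\<in>insert j ({..<n} - {j}). t i [^] b i)" unfolding monomial_def by simp
  also have "\<dots> = t j [^] b j \<otimes> (\<Otimes>i\<in>{..<n} - {j}. t i [^] b i)"
    using assms by (intro finprod_insert) auto
  finally show ?thesis .
qed

lemma monomial_upd:
  assumes t: "t \<in> {..<n} \<rightarrow> carrier R" and j: "j < n"
  shows "t j [^] k \<otimes> monomial R n t (b(j := l)) = monomial R n t (b(j := k + l))"
proof -
  let ?r = "\<Otimes>i\<in>{..<n} - {j}. t i [^] b i"
  have r: "?r \<in> carrier R" and tj: "t j \<in> carrier R" using t j by (auto intro!: finprod_closed)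
  have eq: "(\<Otimes>i\<in>{..<n} - {j}. t i [^] ((b(j := l)) i)) = ?r" for l
    using t by (intro finprod_cong') auto
  have "t j [^] k \<otimes> (t j [^] l \<otimes> ?r) = t j [^] (k + l) \<otimes> ?r"
    using r tj by (simp add: nat_pow_mult[symmetric] m_assoc)
  thus ?thesis unfolding monomial_split[OF t j] eq by simp
qed

definition box_sum :: "nat \<Rightarrow> nat \<Rightarrow> (nat \<Rightarrow> 'a) \<Rightarrow> ((nat \<Rightarrow> nat) \<Rightarrow> 'a) \<Rightarrow> 'a" where
  "box_sum p n t c = (\<Oplus>b\<in>exp_box p n. c b \<otimes> monomial R n t b)"

lemma box_sum_closed:
  assumes "t \<in> {..<n} \<rightarrow> carrier R" "c \<in> exp_box p n \<rightarrow> carrier R"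
  shows "box_sum p n t c \<in> carrier R"
  unfolding box_sum_def using assms monomial_closed by (auto intro!: finsum_closed)

lemma box_sum_cong:
  assumes "t \<in> {..<n} \<rightarrow> carrier R" "d \<in> exp_box p n \<rightarrow> carrier R" "\<And>b. b \<in> exp_box p n \<Longrightarrow> c b = d b"
  shows "box_sum p n t c = box_sum p n t d"
  unfolding box_sum_def using assms monomial_closed by (intro finsum_cong') (auto simp: Pi_def)

lemma box_sum_add:
  assumes t: "t \<in> {..<n} \<rightarrow> carrier R" and "c \<in> exp_box p n \<rightarrow> carrier R" "d \<in> exp_box p n \<rightarrow> carrier R"
  shows "box_sum p n t c \<oplus> box_sum p n t d = box_sum p n t (\<lambda>b. c b \<oplus> d b)"
proof -
  have "box_sum p n t (\<lambda>b. c b \<oplus> d b) = (\<Oplus>b\<in>exp_box p n. c b \<otimes> monomial R n t b \<oplus> d b \<otimes> monomial R n t b)"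
    unfolding box_sum_def using assms monomial_closed[OF t]
    by (intro finsum_cong') (auto simp: Pi_def l_distr)
  thus ?thesis unfolding box_sum_def using assms monomial_closed[OF t] by (subst (asm) finsum_addf) auto
qed

lemma box_sum_scale:
  assumes t: "t \<in> {..<n} \<rightarrow> carrier R" and c: "c \<in> exp_box p n \<rightarrow> carrier R" and r: "r \<in> carrier R"
  shows "r \<otimes> box_sum p n t c = box_sum p n t (\<lambda>b. r \<otimes> c b)"
proof -
  have "r \<otimes> box_sum p n t c = (\<Oplus>b\<in>exp_box p n. r \<otimes> (c b \<otimes> monomial R n t b))"
    unfolding box_sum_def using c r monomial_closed[OF t] finite_exp_box by (intro finsum_rdistr) auto
  also have "\<dots> = box_sum p n t (\<lambda>b. r \<otimes> c b)"
    unfolding box_sum_def using c r monomial_closed[OF t] by (intro finsum_cong') (auto simp: Pi_def m_assoc)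
  finally show ?thesis .
qed

lemma box_sum_const:
  assumes t: "t \<in> {..<n} \<rightarrow> carrier R" and r: "r \<in> carrier R" and p: "0 < p"
  shows "box_sum p n t (\<lambda>b. if b = (\<lambda>i\<in>{..<n}. 0) then r else \<zero>) = r"
proof -
  let ?z = "\<lambda>i\<in>{..<n}. 0::nat"
  have z: "?z \<in> exp_box p n" using p unfolding exp_box_def by auto
  have "box_sum p n t (\<lambda>b. if b = ?z then r else \<zero>) =
    (\<Oplus>b\<in>{?z}. r \<otimes> monomial R n t b)"
    unfolding box_sum_def
    using z r monomial_closed[OF t] finite_exp_box by (intro add.finprod_mono_neutral_cong_right) auto
  also have "\<dots> = r" using r t by (simp add: monomial_closed monomial_zero)
  finally show ?thesis .
qed

text \<open>
  Multiplication by \<open>t j\<close> permutes the restricted monomials cyclically in the \<open>j\<close>-th exponent, up to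
  the factor \<open>t j [^] p\<close> when the exponent wraps around.
\<close>

lemma box_sum_mult:
  assumes t: "t \<in> {..<n} \<rightarrow> carrier R" and C: "subring C R" and tp: "\<And>j. j < n \<Longrightarrow> t j [^] p \<in> C"
    and c: "c \<in> exp_box p n \<rightarrow> C" and j: "j < n" and p: "0 < p"
  shows "\<exists>d \<in> exp_box p n \<rightarrow> C. t j \<otimes> box_sum p n t c = box_sum p n t d"
proof -
  define \<sigma> where "\<sigma> = (\<lambda>b::nat \<Rightarrow> nat. b(j := if Suc (b j) < p then Suc (b j) else 0))"
  have \<sigma>: "\<sigma> b \<in> exp_box p n" if "b \<in> exp_box p n" for b
    using that j p unfolding \<sigma>_def exp_box_def by (auto simp: PiE_def extensional_def)
  have inj: "inj_on \<sigma> (exp_box p n)"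
  proof (rule inj_onI)
    fix b b' assume b: "b \<in> exp_box p n" "b' \<in> exp_box p n" and eq: "\<sigma> b = \<sigma> b'"
    have "b j < p" "b' j < p" using b j unfolding exp_box_def by auto
    moreover have "\<sigma> b j = \<sigma> b' j" using eq by simp
    ultimately have "b j = b' j" unfolding \<sigma>_def by (auto split: if_splits)
    moreover have "b i = b' i" if "i \<noteq> j" for i using fun_cong[OF eq, of i] that unfolding \<sigma>_def by simp
    ultimately show "b = b'" by (metis ext)
  qed
  have surj: "\<sigma> ` exp_box p n = exp_box p n"
    using \<sigma> inj finite_exp_box by (intro endo_inj_surj) auto
  have Cc: "C \<subseteq> carrier R" using subringE(1)[OF C] .
  define e where "e = (\<lambda>b. if Suc (b j) < p then c b else c b \<otimes> t j [^] p)"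
  have e: "e b \<in> C" if "b \<in> exp_box p n" for b
    using that c tp[OF j] subringE(6)[OF C] unfolding e_def by auto
  \<comment> \<open>Reindexing along the permutation: the coefficient at \<open>\<sigma> b\<close>
    is the one produced from b.\<close>
  define d where "d = (\<lambda>b. e (inv_into (exp_box p n) \<sigma> b))"
  have d: "d \<in> exp_box p n \<rightarrow> C" using e surj unfolding d_def by (metis (no_types, lifting) Pi_I inv_into_into)
  have tj: "t j \<in> carrier R" using t j by auto
  have key: "t j \<otimes> (c b \<otimes> monomial R n t b) = e b \<otimes> monomial R n t (\<sigma> b)" if b: "b \<in> exp_box p n" for b
  proof -
    have cb: "c b \<in> carrier R" using b c Cc by auto
    have bj: "b j < p" using b j unfolding exp_box_def by auto
    have m: "t j [^] k \<otimes> monomial R n t (b(j := l)) = monomial R n t (b(j := k + l))" for k l :: nat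
      using monomial_upd[OF t j] .
    have mc: "monomial R n t b' \<in> carrier R" for b' using monomial_closed[OF t] .
    have "t j \<otimes> monomial R n t b = monomial R n t (b(j := Suc (b j)))"
      using m[of 1 "b j"] tj by simp
    also have "c b \<otimes> \<dots> = e b \<otimes> monomial R n t (\<sigma> b)"
    proof (cases "Suc (b j) < p")
      case False
      hence "Suc (b j) = p" using bj by simp
      thus ?thesis using m[of p 0] cb tj mc unfolding e_def \<sigma>_def by (simp add: m_assoc)
    qed (simp add: e_def \<sigma>_def)
    finally show ?thesis using m_lcomm[OF tj cb mc[of b]] by simp
  qed
  have "t j \<otimes> box_sum p n t c = (\<Oplus>b\<in>exp_box p n. t j \<otimes> (c b \<otimes> monomial R n t b))"
    unfolding box_sum_def using c Cc tj monomial_closed[OF t] finite_exp_box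
    by (intro finsum_rdistr) (auto simp: Pi_def subset_iff)
  also have "\<dots> = (\<Oplus>b\<in>exp_box p n. d (\<sigma> b) \<otimes> monomial R n t (\<sigma> b))"
    using key e Cc monomial_closed[OF t] inj unfolding d_def
    by (intro finsum_cong') (auto simp: Pi_def subset_iff)
  also have "\<dots> = (\<Oplus>b\<in>\<sigma> ` exp_box p n. d b \<otimes> monomial R n t b)"
    using d Cc monomial_closed[OF t] inj surj
    by (intro finsum_reindex[symmetric]) (auto simp: Pi_def subset_iff)
  also have "\<dots> = box_sum p n t d" unfolding surj box_sum_def ..
  finally show ?thesis using d by blast
qed

end

context cring
begin

text \<open>The induction shows that multiplication by s preserves the span M of the restricted
  monomials, rather than that s lies in M: the former is stable under products. Applied to the unit,
  which lies in M, it gives s back.\<close>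

lemma box_span_generates:
  assumes t: "t \<in> {..<n} \<rightarrow> carrier R" and C: "subring C R" and tp: "\<And>j. j < n \<Longrightarrow> t j [^] p \<in> C"
    and p: "0 < p" and s: "s \<in> generate_ring R (C \<union> t ` {..<n})"
  shows "\<exists>c \<in> exp_box p n \<rightarrow> C. s = box_sum p n t c"
proof -
  have Cc: "C \<subseteq> carrier R" using subringE(1)[OF C] .
  define M where "M = box_sum p n t ` (exp_box p n \<rightarrow> C)"
  have gc: "h \<in> carrier R" if "h \<in> generate_ring R (C \<union> t ` {..<n})" for h
    using generate_ring_in_carrier[OF _ that] Cc t by auto
  have cc: "c \<in> exp_box p n \<rightarrow> carrier R" if "c \<in> exp_box p n \<rightarrow> C" for c using that Cc by auto
  have Mc: "M \<subseteq> carrier R" unfolding M_def using box_sum_closed[OF t] cc by blast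
  have scale: "r \<otimes> m \<in> M" if rm: "r \<in> C" "m \<in> M" for r m
  proof -
    obtain c where c: "c \<in> exp_box p n \<rightarrow> C" "m = box_sum p n t c" using rm unfolding M_def by blast
    have "r \<otimes> m = box_sum p n t (\<lambda>b. r \<otimes> c b)"
      using box_sum_scale[OF t cc[OF c(1)], of r] rm(1) Cc c(2) by auto
    moreover have "(\<lambda>b. r \<otimes> c b) \<in> exp_box p n \<rightarrow> C" using c(1) rm(1) subringE(6)[OF C] by auto
    ultimately show ?thesis unfolding M_def by blast
  qed
  have "\<forall>m\<in>M. s \<otimes> m \<in> M" using s
  proof (induction)
    case one thus ?case using Mc by auto
  next
    case (incl h)
    show ?case
    proof
      fix m assume m: "m \<in> M"
      then obtain c where c: "c \<in> exp_box p n \<rightarrow> C" "m = box_sum p n t c" unfolding M_def by blast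
      show "h \<otimes> m \<in> M"
      proof (cases "h \<in> C")
        case False
        then obtain j where "j < n" "h = t j" using incl by auto
        thus ?thesis using box_sum_mult[OF t C tp c(1) _ p] c(2) unfolding M_def by blast
      qed (use scale m in blast)
    qed
  next
    case (a_inv h)
    show ?case
    proof
      fix m assume m: "m \<in> M"
      have "\<ominus> \<one> \<in> C" using subringE(3,5)[OF C] by blast
      hence "(\<ominus> \<one>) \<otimes> (h \<otimes> m) \<in> M" using scale a_inv m by blast
      moreover have "(\<ominus> \<one>) \<otimes> (h \<otimes> m) = (\<ominus> h) \<otimes> m"
        using gc[OF a_inv(1)] m Mc by (auto simp: l_minus)
      ultimately show "(\<ominus> h) \<otimes> m \<in> M" by simp
    qed
  next
    case (eng_add h1 h2)
    show ?case
    proof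
      fix m assume m: "m \<in> M"
      then obtain c d where cd: "c \<in> exp_box p n \<rightarrow> C" "h1 \<otimes> m = box_sum p n t c"
        "d \<in> exp_box p n \<rightarrow> C" "h2 \<otimes> m = box_sum p n t d" using eng_add unfolding M_def by blast
      have "(h1 \<oplus> h2) \<otimes> m = box_sum p n t (\<lambda>b. c b \<oplus> d b)"
        using box_sum_add[OF t cc[OF cd(1)] cc[OF cd(3)]] cd gc eng_add m Mc by (auto simp: l_distr)
      moreover have "(\<lambda>b. c b \<oplus> d b) \<in> exp_box p n \<rightarrow> C" using cd subringE(7)[OF C] by auto
      ultimately show "(h1 \<oplus> h2) \<otimes> m \<in> M" unfolding M_def by blast
    qed
  next
    case (eng_mult h1 h2)
    show ?case
    proof
      fix m assume m: "m \<in> M"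
      hence "h1 \<otimes> (h2 \<otimes> m) \<in> M" using eng_mult by blast
      thus "(h1 \<otimes> h2) \<otimes> m \<in> M" using gc eng_mult(1,2) m Mc by (auto simp: m_assoc)
    qed
  qed
  moreover have "\<one> \<in> M"
  proof -
    have z1: "(\<lambda>b. if b = (\<lambda>i\<in>{..<n}. 0) then \<one> else \<zero>) \<in> exp_box p n \<rightarrow> C"
      using subringE(2,3)[OF C] by auto
    have z2: "\<one> = box_sum p n t (\<lambda>b. if b = (\<lambda>i\<in>{..<n}. 0) then \<one> else \<zero>)"
      using box_sum_const[OF t one_closed p] by simp
    show ?thesis unfolding M_def using z1 by (subst z2) (rule imageI)
  qed
  ultimately have "s \<otimes> \<one> \<in> M" by blast
  hence "s \<in> M" using gc[OF s] by simp
  thus ?thesis unfolding M_def by blast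
qed

lemma finsum_mem:
  assumes "N \<subseteq> carrier R" "\<zero> \<in> N" "\<And>a b. a \<in> N \<Longrightarrow> b \<in> N \<Longrightarrow> a \<oplus> b \<in> N" "\<And>i. i \<in> A \<Longrightarrow> f i \<in> N"
  shows "(\<Oplus>i\<in>A. f i) \<in> N"
  using assms(4)
proof (induction A rule: infinite_finite_induct)
  case (insert i A)
  have "(\<Oplus>i\<in>insert i A. f i) = f i \<oplus> (\<Oplus>i\<in>A. f i)"
    using insert assms(1) by (intro finsum_insert) auto
  thus ?case using insert assms(3) by simp
qed (use assms(2) in auto)

end

section \<open>Coordinates over the Frobenius image, and Frobenius powers of ideals\<close>

locale p_basis_ring = cring R for R (structure) +
  fixes p n :: nat and x :: "nat \<Rightarrow> 'a"
  assumes prime_p: "Factorial_Ring.prime p" and char_p: "char_p p R"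
    and frobenius_inj: "\<lbrakk>z \<in> carrier R; z [^] p = \<zero>\<rbrakk> \<Longrightarrow> z = \<zero>"
    and p_basis: "p_basis p R n x"
begin

lemma p_pos: "0 < p" using prime_p by (simp add: prime_gt_0_nat)

lemma x_closed: "x \<in> {..<n} \<rightarrow> carrier R"
  using p_basis unfolding p_basis_def p_generating_def by blast

lemmas frob_add = frobenius_add[OF prime_p char_p]
lemmas frob_minus = frobenius_minus[OF prime_p char_p]

text \<open>Coordinates are recorded as p-th roots of the coefficients in the Frobenius image.
  Injectivity of the Frobenius makes these roots unique, so an ideal of R can be imposed on them
  directly.\<close>

definition frob_sum :: "((nat \<Rightarrow> nat) \<Rightarrow> 'a) \<Rightarrow> 'a" where
  "frob_sum c = box_sum p n x (\<lambda>b. c b [^] p)"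

lemma frob_sum_closed: "c \<in> exp_box p n \<rightarrow> carrier R \<Longrightarrow> frob_sum c \<in> carrier R"
  unfolding frob_sum_def by (rule box_sum_closed[OF x_closed]) auto

lemma frob_sum_cong:
  assumes "d \<in> exp_box p n \<rightarrow> carrier R" "\<And>b. b \<in> exp_box p n \<Longrightarrow> c b = d b"
  shows "frob_sum c = frob_sum d"
  unfolding frob_sum_def using assms by (intro box_sum_cong[OF x_closed]) auto

lemma frob_sum_add:
  assumes "c \<in> exp_box p n \<rightarrow> carrier R" "d \<in> exp_box p n \<rightarrow> carrier R"
  shows "frob_sum c \<oplus> frob_sum d = frob_sum (\<lambda>b. c b \<oplus> d b)"
proof -
  have "frob_sum c \<oplus> frob_sum d = box_sum p n x (\<lambda>b. c b [^] p \<oplus> d b [^] p)"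
    unfolding frob_sum_def using assms by (intro box_sum_add[OF x_closed]) auto
  also have "\<dots> = frob_sum (\<lambda>b. c b \<oplus> d b)"
    unfolding frob_sum_def using assms by (intro box_sum_cong[OF x_closed]) (auto simp: Pi_def frob_add)
  finally show ?thesis .
qed

lemma frob_sum_scale:
  assumes "c \<in> exp_box p n \<rightarrow> carrier R" "r \<in> carrier R"
  shows "r [^] p \<otimes> frob_sum c = frob_sum (\<lambda>b. r \<otimes> c b)"
proof -
  have "r [^] p \<otimes> frob_sum c = box_sum p n x (\<lambda>b. r [^] p \<otimes> c b [^] p)"
    unfolding frob_sum_def using assms by (intro box_sum_scale[OF x_closed]) auto
  also have "\<dots> = frob_sum (\<lambda>b. r \<otimes> c b)"
    unfolding frob_sum_def using assms by (intro box_sum_cong[OF x_closed]) (auto simp: Pi_def nat_pow_distrib)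
  finally show ?thesis .
qed

lemma frob_sum_expand:
  assumes "s \<in> carrier R" shows "\<exists>c \<in> exp_box p n \<rightarrow> carrier R. s = frob_sum c"
proof -
  have "\<And>j. j < n \<Longrightarrow> x j [^] p \<in> frob_image p R" unfolding frob_image_def using x_closed by auto
  moreover have "s \<in> generate_ring R (frob_image p R \<union> x ` {..<n})"
    using p_basis assms unfolding p_basis_def p_generating_def by blast
  ultimately obtain c where c: "c \<in> exp_box p n \<rightarrow> frob_image p R" "s = box_sum p n x c"
    using box_span_generates[OF x_closed frobenius_subring[OF prime_p char_p] _ p_pos] by blast
  hence "\<forall>b\<in>exp_box p n. \<exists>r. r \<in> carrier R \<and> c b = r [^] p" unfolding frob_image_def by blast
  from bchoice[OF this] obtain d where d: "\<forall>b\<in>exp_box p n. d b \<in> carrier R \<and> c b = d b [^] p" by blast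
  hence "s = frob_sum d" unfolding frob_sum_def c(2) by (intro box_sum_cong[OF x_closed]) auto
  thus ?thesis using d by blast
qed

lemma frob_sum_eq_zeroD:
  assumes c: "c \<in> exp_box p n \<rightarrow> carrier R" and z: "frob_sum c = \<zero>" and b: "b \<in> exp_box p n"
  shows "c b = \<zero>"
proof -
  have "(\<lambda>b. c b [^] p) \<in> exp_box p n \<rightarrow> frob_image p R" unfolding frob_image_def using c by auto
  hence "c b [^] p = \<zero>"
    using p_basis z b unfolding p_basis_def frob_sum_def box_sum_def exp_box_def by auto
  thus ?thesis using frobenius_inj c b by auto
qed

lemma frob_sum_inj:
  assumes c: "c \<in> exp_box p n \<rightarrow> carrier R" and d: "d \<in> exp_box p n \<rightarrow> carrier R"
    and eq: "frob_sum c = frob_sum d" and b: "b \<in> exp_box p n"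
  shows "c b = d b"
proof -
  let ?e = "\<lambda>b. c b \<ominus> d b"
  have e: "?e \<in> exp_box p n \<rightarrow> carrier R" using c d by auto
  have "frob_sum (\<lambda>b. ?e b \<oplus> d b) = frob_sum c"
    using c d by (intro frob_sum_cong) (auto simp: Pi_def a_minus_def a_assoc l_neg)
  hence "frob_sum ?e \<oplus> frob_sum d = \<zero> \<oplus> frob_sum d"
    unfolding frob_sum_add[OF e d] eq using frob_sum_closed[OF d] by simp
  hence "frob_sum ?e = \<zero>" using frob_sum_closed[OF e] frob_sum_closed[OF d] by (simp del: l_zero)
  hence "?e b = \<zero>" using frob_sum_eq_zeroD[OF e _ b] by blast
  moreover have "c b \<in> carrier R" "d b \<in> carrier R" using c d b by auto
  ultimately show ?thesis using r_right_minus_eq by simp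
qed

text \<open>The Frobenius power usually written \<open>K^[p]\<close>.\<close>

definition frob_ideal :: "'a set \<Rightarrow> 'a set" where
  "frob_ideal K = Idl ((\<lambda>c. c [^] p) ` K)"

lemma frob_ideal_ideal: assumes "ideal K R" shows "ideal (frob_ideal K) R"
  unfolding frob_ideal_def using ideal_subset_carrier[OF assms] by (intro genideal_ideal) auto

lemma pow_mem_frob_ideal:
  assumes "ideal K R" "c \<in> K" shows "c [^] p \<in> frob_ideal K"
proof -
  have "(\<lambda>c. c [^] p) ` K \<subseteq> carrier R" using ideal_subset_carrier[OF assms(1)] by auto
  thus ?thesis unfolding frob_ideal_def using genideal_self assms(2) by blast
qed

lemma frob_ideal_subset:
  assumes "ideal K R" shows "frob_ideal K \<subseteq> K"
  unfolding frob_ideal_def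
proof (rule genideal_minimal[OF assms], clarify)
  fix c assume c: "c \<in> K"
  have "c [^] p = c [^] (p - 1) \<otimes> c" using p_pos by (cases p) auto
  thus "c [^] p \<in> K" using ideal_mult_closed[OF assms c] ideal_subset_carrier[OF assms] c by auto
qed

text \<open>The combinations with all coordinates in K form an ideal N that contains the p-th powers
  of K, hence the Frobenius power; uniqueness of coordinates does the rest. This is the sole source
  of the kernel of a tower step.\<close>

lemma frob_ideal_coeff:
  assumes K: "ideal K R" and c: "c \<in> exp_box p n \<rightarrow> carrier R" and mem: "frob_sum c \<in> frob_ideal K"
    and b: "b \<in> exp_box p n"
  shows "c b \<in> K"
proof -
  have Kc: "K \<subseteq> carrier R" using ideal_subset_carrier[OF K] .
  define N where "N = frob_sum ` (exp_box p n \<rightarrow> K)"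
  have cc: "d \<in> exp_box p n \<rightarrow> carrier R" if "d \<in> exp_box p n \<rightarrow> K" for d using that Kc by auto
  have Nc: "N \<subseteq> carrier R" unfolding N_def using frob_sum_closed cc by blast
  have add: "a \<oplus> a' \<in> N" if aa: "a \<in> N" "a' \<in> N" for a a'
  proof -
    obtain d d' where d: "d \<in> exp_box p n \<rightarrow> K" "a = frob_sum d" "d' \<in> exp_box p n \<rightarrow> K" "a' = frob_sum d'"
      using aa unfolding N_def by blast
    have "(\<lambda>b. d b \<oplus> d' b) \<in> exp_box p n \<rightarrow> K" using d ideal_add_closed[OF K] by auto
    thus ?thesis using frob_sum_add[OF cc[OF d(1)] cc[OF d(3)]] d unfolding N_def by blast
  qed
  \<comment> \<open>Expanding r in coordinates and pulling k under the p-th power multiplies every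
    coordinate by k.\<close>
  have pw: "r \<otimes> k [^] p \<in> N" if rk: "r \<in> carrier R" "k \<in> K" for r k
  proof -
    obtain d where d: "d \<in> exp_box p n \<rightarrow> carrier R" "r = frob_sum d" using frob_sum_expand[OF rk(1)] by blast
    have "r \<otimes> k [^] p = frob_sum (\<lambda>b. k \<otimes> d b)"
      using frob_sum_scale[OF d(1), of k] rk Kc m_comm[of r "k [^] p"] d(2) by auto
    moreover have "(\<lambda>b. k \<otimes> d b) \<in> exp_box p n \<rightarrow> K" using d rk(2) ideal_mult_closed'[OF K] by auto
    ultimately show ?thesis unfolding N_def by blast
  qed
  have zero: "\<zero> \<in> N"
    using pw[of \<zero> \<zero>] ideal_zero_closed[OF K] p_pos by simp
  have "ideal N R"
  proof (rule idealI_closed[OF Nc zero add])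
    fix r a assume r: "r \<in> carrier R" and "a \<in> N"
    then obtain d where d: "d \<in> exp_box p n \<rightarrow> K" "a = frob_sum d" unfolding N_def by blast
    have "r \<otimes> a = (\<Oplus>b\<in>exp_box p n. r \<otimes> (d b [^] p \<otimes> monomial R n x b))"
      unfolding d(2) frob_sum_def box_sum_def
      using r cc[OF d(1)] monomial_closed[OF x_closed] finite_exp_box by (intro finsum_rdistr) auto
    also have "\<dots> \<in> N"
    proof (rule finsum_mem[OF Nc zero add])
      fix b assume b: "b \<in> exp_box p n"
      have "d b \<in> K" using d b by auto
      \<comment> \<open>Moving the monomial over to r turns each term into a multiple of the p-th
        power of an element of K, which \<open>pw\<close> covers.\<close>
      hence "(r \<otimes> monomial R n x b) \<otimes> d b [^] p \<in> N" using pw r monomial_closed[OF x_closed] by simp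
      moreover have "(r \<otimes> monomial R n x b) \<otimes> d b [^] p = r \<otimes> (d b [^] p \<otimes> monomial R n x b)"
        using r \<open>d b \<in> K\<close> Kc monomial_closed[OF x_closed, of b] m_comm[of "monomial R n x b" "d b [^] p"]
        by (auto simp: m_assoc)
      ultimately show "r \<otimes> (d b [^] p \<otimes> monomial R n x b) \<in> N" by simp
    qed
    finally show "r \<otimes> a \<in> N" .
  qed
  moreover have "(\<lambda>c. c [^] p) ` K \<subseteq> N"
  proof clarify
    fix k assume k: "k \<in> K"
    hence "k [^] p \<in> carrier R" using Kc by auto
    thus "k [^] p \<in> N" using pw[OF one_closed k] by simp
  qed
  ultimately have "frob_ideal K \<subseteq> N" unfolding frob_ideal_def by (rule genideal_minimal)
  then obtain d where d: "d \<in> exp_box p n \<rightarrow> K" "frob_sum c = frob_sum d" using mem unfolding N_def by blast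
  thus ?thesis using frob_sum_inj[OF c cc[OF d(1)] d(2) b] b by auto
qed

end

section \<open>Polynomial rings\<close>

text \<open>Distributivity and changes of index set in the convolution sums need a finite index set,
  as \<open>finsum\<close> over an infinite set is zero by convention.\<close>

lemma finite_submultisets: "finite {k. k \<subseteq># m}"
proof (induction m)
  case (add a m)
  have "{k. k \<subseteq># add_mset a m} \<subseteq> {k. k \<subseteq># m} \<union> add_mset a ` {k. k \<subseteq># m}"
  proof
    fix k assume k: "k \<in> {k. k \<subseteq># add_mset a m}"
    show "k \<in> {k. k \<subseteq># m} \<union> add_mset a ` {k. k \<subseteq># m}"
    proof (cases "a \<in># k")
      case True
      then obtain l where "k = add_mset a l" using multi_member_split by metis
      thus ?thesis using k by auto
    next
      case False
      have "count k b \<le> count m b" for b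
      proof (cases "b = a")
        case True thus ?thesis using False by (simp add: not_in_iff)
      next
        case neq: False
        have "count k b \<le> count (add_mset a m) b" using k by (intro mset_subset_eq_count) simp
        thus ?thesis using neq by simp
      qed
      hence "k \<subseteq># m" by (simp add: subseteq_mset_def)
      thus ?thesis by simp
    qed
  qed
  thus ?case using add finite_subset by blast
qed simp

section \<open>Convolution and the ring axioms for polynomials\<close>

context cring
begin

definition conv :: "('c multiset \<Rightarrow> 'a) \<Rightarrow> ('c multiset \<Rightarrow> 'a) \<Rightarrow> 'c multiset \<Rightarrow> 'a" where
  "conv f g m = (\<Oplus>k\<in>{k. k \<subseteq># m}. f k \<otimes> g (m - k))"

lemma conv_coeff: "carrier_coeff f \<Longrightarrow> carrier_coeff g \<Longrightarrow> carrier_coeff (conv f g)"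
  unfolding carrier_coeff_def conv_def by (auto intro!: finsum_closed)

lemma const_coeff: "r \<in> carrier R \<Longrightarrow> carrier_coeff (indexed_const r)"
  unfolding carrier_coeff_def indexed_const_def by auto

lemma conv_const:
  assumes "r \<in> carrier R" "carrier_coeff g"
  shows "conv (indexed_const r) g = (\<lambda>m. r \<otimes> g m)"
proof
  fix m :: "'c multiset"
  have "conv (indexed_const r) g m = (\<Oplus>k\<in>{{#} :: 'c multiset}. r \<otimes> g m)"
    unfolding conv_def
  proof (rule add.finprod_mono_neutral_cong_right)
    show "finite {k. k \<subseteq># m}" by (rule finite_submultisets)
  qed (use assms carrier_coeffE[OF assms(2)] in \<open>auto simp: indexed_const_def\<close>)
  thus "conv (indexed_const r) g m = r \<otimes> g m" using assms carrier_coeffE[OF assms(2)] by simp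
qed

lemma conv_padd_left:
  assumes "carrier_coeff f" "carrier_coeff g" "carrier_coeff h"
  shows "conv (indexed_padd f g) h = indexed_padd (conv f h) (conv g h)"
proof
  fix m
  note c = assms[THEN carrier_coeffE]
  have "conv (indexed_padd f g) h m = (\<Oplus>k\<in>{k. k \<subseteq># m}. f k \<otimes> h (m - k) \<oplus> g k \<otimes> h (m - k))"
    unfolding conv_def indexed_padd_def using c by (intro finsum_cong') (auto simp: l_distr)
  also have "\<dots> = conv f h m \<oplus> conv g h m"
    unfolding conv_def using c by (intro finsum_addf) auto
  finally show "conv (indexed_padd f g) h m = indexed_padd (conv f h) (conv g h) m"
    unfolding indexed_padd_def .
qed

text \<open>The complement k \<mapsto> m - k is an involution on the submultisets of m and exchanges
  the two factors.\<close>

lemma conv_comm: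
  assumes "carrier_coeff f" "carrier_coeff g" shows "conv f g = conv g f"
proof
  fix m :: "'c multiset"
  have inv: "m - (m - k) = k" if "k \<subseteq># m" for k
    using that by (auto simp: mset_subset_eq_exists_conv)
  have im: "(-) m ` {k. k \<subseteq># m} = {k. k \<subseteq># m}"
  proof
    show "{k. k \<subseteq># m} \<subseteq> (-) m ` {k. k \<subseteq># m}"
    proof
      fix k assume "k \<in> {k. k \<subseteq># m}"
      hence "k = m - (m - k)" using inv[of k] by simp
      moreover have "m - k \<in> {k. k \<subseteq># m}" by simp
      ultimately show "k \<in> (-) m ` {k. k \<subseteq># m}" by (rule image_eqI)
    qed
    show "(-) m ` {k. k \<subseteq># m} \<subseteq> {k. k \<subseteq># m}" by (simp add: image_subset_iff)
  qed
  have inj: "inj_on ((-) m) {k. k \<subseteq># m}"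
  proof (rule inj_onI)
    fix k l assume "k \<in> {k. k \<subseteq># m}" "l \<in> {k. k \<subseteq># m}" and eq: "m - k = m - l"
    hence "k = m - (m - k)" "m - (m - l) = l" using inv[of k, symmetric] inv[of l] by blast+
    thus "k = l" unfolding eq by (rule trans)
  qed
  have "conv f g m = (\<Oplus>k\<in>(-) m ` {k. k \<subseteq># m}. f k \<otimes> g (m - k))" unfolding im conv_def ..
  also have "\<dots> = (\<Oplus>k\<in>{k. k \<subseteq># m}. f (m - k) \<otimes> g (m - (m - k)))"
    using assms[THEN carrier_coeffE] inj by (intro finsum_reindex) auto
  also have "\<dots> = conv g f m"
    unfolding conv_def
  proof (rule finsum_cong')
    fix k assume "k \<in> {k. k \<subseteq># m}"
    hence "m - (m - k) = k" using inv by simp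
    thus "f (m - k) \<otimes> g (m - (m - k)) = g k \<otimes> f (m - k)"
      using assms[THEN carrier_coeffE] m_comm by simp
  qed (use assms[THEN carrier_coeffE] in auto)
  finally show "conv f g m = conv g f m" .
qed

text \<open>Only submultisets containing i contribute, and removing one i matches them with the
  submultisets of the smaller monomial. Together with \<open>conv_const\<close> and
  \<open>conv_padd_left\<close> this covers every constructor of \<open>indexed_pset\<close>, so
  later facts on products follow by induction on the left factor.\<close>

lemma conv_pmult:
  assumes "carrier_coeff f" "carrier_coeff g"
  shows "conv (indexed_pmult f i) g = indexed_pmult (conv f g) i"
proof
  fix m :: "'c multiset"
  note c = assms[THEN carrier_coeffE]
  show "conv (indexed_pmult f i) g m = indexed_pmult (conv f g) i m"
  proof (cases "i \<in># m")
    case False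
    hence "conv (indexed_pmult f i) g m = (\<Oplus>k\<in>{k. k \<subseteq># m}. \<zero>)"
      unfolding conv_def indexed_pmult_def using c by (intro finsum_cong') (auto dest: mset_subset_eqD)
    thus ?thesis using False unfolding indexed_pmult_def by simp
  next
    case True
    then obtain l where l: "m = add_mset i l" using multi_member_split by metis
    have "conv (indexed_pmult f i) g m = (\<Oplus>k\<in>add_mset i ` {k. k \<subseteq># l}. indexed_pmult f i k \<otimes> g (m - k))"
      unfolding conv_def
    proof (rule add.finprod_mono_neutral_cong_right)
      show "finite {k. k \<subseteq># m}" by (rule finite_submultisets)
      show "add_mset i ` {k. k \<subseteq># l} \<subseteq> {k. k \<subseteq># m}" unfolding l by auto
      fix k assume k: "k \<in> {k. k \<subseteq># m} - add_mset i ` {k. k \<subseteq># l}"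
      have "i \<notin># k"
      proof
        assume "i \<in># k"
        then obtain k' where "k = add_mset i k'" using multi_member_split by metis
        thus False using k unfolding l by auto
      qed
      thus "indexed_pmult f i k \<otimes> g (m - k) = \<zero>" using c unfolding indexed_pmult_def by simp
    qed (use c in \<open>auto simp: indexed_pmult_def\<close>)
    also have "\<dots> = (\<Oplus>k\<in>{k. k \<subseteq># l}. indexed_pmult f i (add_mset i k) \<otimes> g (m - add_mset i k))"
      using c by (intro finsum_reindex) (auto simp: indexed_pmult_def inj_on_def)
    also have "\<dots> = conv f g l"
      unfolding conv_def l indexed_pmult_def using c by (intro finsum_cong') auto
    finally show ?thesis unfolding l indexed_pmult_def by simp
  qed
qed

abbreviation poly_set :: "nat \<Rightarrow> (nat multiset \<Rightarrow> 'a) set" where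
  "poly_set n \<equiv> indexed_pset {..<n} (carrier R)"

lemma poly_set_coeff: "f \<in> poly_set n \<Longrightarrow> carrier_coeff f"
  using indexed_pset_in_carrier by blast

lemma poly_set_finite_support: "f \<in> poly_set n \<Longrightarrow> finite {m. f m \<noteq> \<zero>}"
proof (induction rule: indexed_pset.induct)
  case (indexed_const k)
  have "{m. indexed_const k m \<noteq> \<zero>} \<subseteq> {{#}}" unfolding indexed_const_def by auto
  thus ?case using finite_subset by blast
next
  case (indexed_padd f g)
  have "{m. indexed_padd f g m \<noteq> \<zero>} \<subseteq> {m. f m \<noteq> \<zero>} \<union> {m. g m \<noteq> \<zero>}" unfolding indexed_padd_def by auto
  thus ?case using indexed_padd finite_subset by blast
next
  case (indexed_pmult f i)
  have "{m. indexed_pmult f i m \<noteq> \<zero>} \<subseteq> add_mset i ` {m. f m \<noteq> \<zero>}"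
    unfolding indexed_pmult_def by (auto split: if_splits dest!: multi_member_split)
  thus ?case using indexed_pmult finite_subset by blast
qed

lemma poly_set_scale:
  assumes "f \<in> poly_set n" "r \<in> carrier R" shows "(\<lambda>m. r \<otimes> f m) \<in> poly_set n"
  using assms(1)
proof (induction rule: indexed_pset.induct)
  case (indexed_const k)
  have eq: "(\<lambda>m :: nat multiset. r \<otimes> indexed_const k m) = indexed_const (r \<otimes> k)"
    unfolding indexed_const_def using assms by auto
  show ?case unfolding eq using indexed_const assms by (intro indexed_pset.indexed_const) simp
next
  case (indexed_padd f g)
  have "(\<lambda>m. r \<otimes> indexed_padd f g m) = indexed_padd (\<lambda>m. r \<otimes> f m) (\<lambda>m. r \<otimes> g m)"
    unfolding indexed_padd_def using assms indexed_padd(1,2)[THEN poly_set_coeff, THEN carrier_coeffE]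
    by (auto simp: r_distr)
  thus ?case using indexed_padd indexed_pset.indexed_padd by metis
next
  case (indexed_pmult f i)
  have "(\<lambda>m. r \<otimes> indexed_pmult f i m) = indexed_pmult (\<lambda>m. r \<otimes> f m) i"
    unfolding indexed_pmult_def using assms by auto
  thus ?case using indexed_pmult indexed_pset.indexed_pmult by metis
qed

lemma poly_set_conv:
  assumes f: "f \<in> poly_set n" and g: "g \<in> poly_set n" shows "conv f g \<in> poly_set n"
  using f
proof (induction rule: indexed_pset.induct)
  case (indexed_const k)
  thus ?case using conv_const[OF _ poly_set_coeff[OF g]] poly_set_scale[OF g] by simp
next
  case (indexed_padd f1 f2)
  thus ?case using conv_padd_left poly_set_coeff g indexed_pset.indexed_padd by metis
next
  case (indexed_pmult f i)
  thus ?case using conv_pmult poly_set_coeff g indexed_pset.indexed_pmult by metis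
qed

text \<open>Induction on the left factor avoids a double sum over splittings of a monomial into
  three pieces.\<close>

lemma conv_assoc:
  assumes f: "f \<in> poly_set n" and g: "g \<in> poly_set n" and h: "h \<in> poly_set n"
  shows "conv (conv f g) h = conv f (conv g h)"
  using f
proof (induction rule: indexed_pset.induct)
  case (indexed_const r)
  note c = g[THEN poly_set_coeff] h[THEN poly_set_coeff]
  note cm = c[THEN carrier_coeffE]
  have "conv (\<lambda>m. r \<otimes> g m) h m = r \<otimes> conv g h m" for m
  proof -
    have "r \<otimes> conv g h m = (\<Oplus>k\<in>{k. k \<subseteq># m}. r \<otimes> (g k \<otimes> h (m - k)))"
      unfolding conv_def using indexed_const cm finite_submultisets by (intro finsum_rdistr) auto
    also have "\<dots> = conv (\<lambda>m. r \<otimes> g m) h m"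
      unfolding conv_def using indexed_const cm by (intro finsum_cong') (auto simp: m_assoc)
    finally show ?thesis by simp
  qed
  thus ?case using indexed_const conv_const[OF indexed_const c(1)] conv_const[OF indexed_const conv_coeff[OF c]]
    by auto
next
  case (indexed_padd f1 f2)
  note c = indexed_padd(1,2)[THEN poly_set_coeff] g[THEN poly_set_coeff] h[THEN poly_set_coeff]
  show ?case using indexed_padd c by (simp add: conv_padd_left conv_coeff)
next
  case (indexed_pmult f i)
  note c = indexed_pmult(1)[THEN poly_set_coeff] g[THEN poly_set_coeff] h[THEN poly_set_coeff]
  show ?case using indexed_pmult c by (simp add: conv_pmult conv_coeff)
qed

lemma mpoly_ring_simps:
  "carrier (mpoly_ring n R) = poly_set n"
  "f \<otimes>\<^bsub>mpoly_ring n R\<^esub> g = conv f g"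
  "f \<oplus>\<^bsub>mpoly_ring n R\<^esub> g = indexed_padd f g"
  "\<one>\<^bsub>mpoly_ring n R\<^esub> = indexed_const \<one>"
  "\<zero>\<^bsub>mpoly_ring n R\<^esub> = indexed_const \<zero>"
  unfolding mpoly_ring_def conv_def by auto

theorem mpoly_ring_cring: "cring (mpoly_ring n R)" (is "cring ?P")
proof (rule cringI)
  show "abelian_group ?P"
  proof (rule abelian_groupI)
    fix f assume "f \<in> carrier ?P"
    hence f: "f \<in> poly_set n" by (simp add: mpoly_ring_simps)
    note c = carrier_coeffE[OF poly_set_coeff[OF f]]
    have "indexed_padd (\<lambda>m. \<ominus> \<one> \<otimes> f m) f = indexed_const \<zero>"
      unfolding indexed_padd_def indexed_const_def using c by (auto simp: l_minus l_neg)
    thus "\<exists>g\<in>carrier ?P. g \<oplus>\<^bsub>?P\<^esub> f = \<zero>\<^bsub>?P\<^esub>"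
      unfolding mpoly_ring_simps using poly_set_scale[OF f, of "\<ominus> \<one>"] by auto
    show "\<zero>\<^bsub>?P\<^esub> \<oplus>\<^bsub>?P\<^esub> f = f"
      unfolding mpoly_ring_simps indexed_padd_def indexed_const_def using c by auto
  next
    fix f g assume "f \<in> carrier ?P" "g \<in> carrier ?P"
    hence "f m \<in> carrier R" "g m \<in> carrier R" for m
      unfolding mpoly_ring_simps by (auto intro: carrier_coeffE[OF poly_set_coeff])
    thus "f \<oplus>\<^bsub>?P\<^esub> g = g \<oplus>\<^bsub>?P\<^esub> f"
      unfolding mpoly_ring_simps indexed_padd_def by (intro ext a_comm)
  next
    fix f g h assume "f \<in> carrier ?P" "g \<in> carrier ?P" "h \<in> carrier ?P"
    hence "f m \<in> carrier R" "g m \<in> carrier R" "h m \<in> carrier R" for m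
      unfolding mpoly_ring_simps by (auto intro: carrier_coeffE[OF poly_set_coeff])
    thus "f \<oplus>\<^bsub>?P\<^esub> g \<oplus>\<^bsub>?P\<^esub> h = f \<oplus>\<^bsub>?P\<^esub> (g \<oplus>\<^bsub>?P\<^esub> h)"
      unfolding mpoly_ring_simps indexed_padd_def by (intro ext a_assoc)
  qed (auto simp: mpoly_ring_simps intro: indexed_pset.intros)
next
  show "comm_monoid ?P"
  proof (rule comm_monoidI)
    fix f assume "f \<in> carrier ?P"
    hence f: "f \<in> poly_set n" by (simp add: mpoly_ring_simps)
    show "\<one>\<^bsub>?P\<^esub> \<otimes>\<^bsub>?P\<^esub> f = f"
      unfolding mpoly_ring_simps conv_const[OF one_closed poly_set_coeff[OF f]]
      using carrier_coeffE[OF poly_set_coeff[OF f]] by simp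
  qed (auto simp: mpoly_ring_simps intro: indexed_pset.intros poly_set_conv conv_assoc
      conv_comm[OF poly_set_coeff poly_set_coeff])
next
  fix f g h assume "f \<in> carrier ?P" "g \<in> carrier ?P" "h \<in> carrier ?P"
  thus "(f \<oplus>\<^bsub>?P\<^esub> g) \<otimes>\<^bsub>?P\<^esub> h =
    f \<otimes>\<^bsub>?P\<^esub> h \<oplus>\<^bsub>?P\<^esub> g \<otimes>\<^bsub>?P\<^esub> h"
    unfolding mpoly_ring_simps by (intro conv_padd_left poly_set_coeff)
qed

lemma indexed_const_hom: "indexed_const \<in> ring_hom R (mpoly_ring n R)"
proof (rule ring_hom_memI)
  fix r s assume rs: "r \<in> carrier R" "s \<in> carrier R"
  show "indexed_const (r \<otimes> s) = indexed_const r \<otimes>\<^bsub>mpoly_ring n R\<^esub> indexed_const s"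
    unfolding mpoly_ring_simps conv_const[OF rs(1) const_coeff[OF rs(2)]]
    using rs by (intro ext) (simp add: indexed_const_def)
qed (auto simp: mpoly_ring_simps indexed_padd_const intro: indexed_pset.intros)

lemma indexed_var_mult:
  assumes "f \<in> poly_set n"
  shows "indexed_var i \<otimes>\<^bsub>mpoly_ring n R\<^esub> f = indexed_pmult f i"
  unfolding mpoly_ring_simps indexed_var_def
  using conv_pmult[OF const_coeff[OF one_closed] poly_set_coeff[OF assms], of i]
    conv_const[OF one_closed poly_set_coeff[OF assms]] carrier_coeffE[OF poly_set_coeff[OF assms]] by simp

lemma indexed_var_closed: "i < n \<Longrightarrow> indexed_var i \<in> poly_set n"
  unfolding indexed_var_def by (auto intro: indexed_pset.intros)

lemma mpoly_ring_generated:
  assumes "f \<in> poly_set n"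
  shows "f \<in> generate_ring (mpoly_ring n R) (indexed_const ` carrier R \<union> indexed_var ` {..<n})"
  using assms
proof (induction rule: indexed_pset.induct)
  case (indexed_const k)
  thus ?case by (intro generate_ring.incl) auto
next
  case (indexed_padd f g)
  thus ?case using generate_ring.eng_add[of f "mpoly_ring n R"] unfolding mpoly_ring_simps by blast
next
  case (indexed_pmult f i)
  have "indexed_var i \<in> generate_ring (mpoly_ring n R) (indexed_const ` carrier R \<union> indexed_var ` {..<n})"
    using indexed_pmult(2) by (intro generate_ring.incl) auto
  from generate_ring.eng_mult[OF this indexed_pmult(3)]
  show ?case unfolding indexed_var_mult[OF indexed_pmult(1)] .
qed

end

section \<open>Evaluation of polynomials along a ring homomorphism\<close>

locale mpoly_eval = ring_hom_cring R S h for R (structure) and S (structure) and h +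
  fixes n :: nat and t :: "nat \<Rightarrow> 'c"
  assumes t_closed: "t \<in> {..<n} \<rightarrow> carrier S"
begin

definition eval :: "(nat multiset \<Rightarrow> 'a) \<Rightarrow> 'c" where
  "eval f = (\<Oplus>\<^bsub>S\<^esub>m\<in>{m. f m \<noteq> \<zero>}. h (f m) \<otimes>\<^bsub>S\<^esub> monomial S n t (count m))"

lemmas t_monomial_closed = S.monomial_closed[OF t_closed]

lemma monomial_add_mset:
  assumes "i < n"
  shows "monomial S n t (count (add_mset i m)) = t i \<otimes>\<^bsub>S\<^esub> monomial S n t (count m)"
proof -
  have "t i [^]\<^bsub>S\<^esub> (1::nat) \<otimes>\<^bsub>S\<^esub> monomial S n t ((count m)(i := count m i)) =
    monomial S n t ((count m)(i := 1 + count m i))"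
    by (rule S.monomial_upd[OF t_closed assms])
  moreover have "(count m)(i := 1 + count m i) = count (add_mset i m)" by auto
  ultimately show ?thesis using assms t_closed by (auto simp: Pi_def)
qed

lemma eval_closed:
  assumes "f \<in> R.poly_set n" shows "eval f \<in> carrier S"
  unfolding eval_def using R.carrier_coeffE[OF R.poly_set_coeff[OF assms]] t_monomial_closed
  by (auto intro!: S.finsum_closed)

text \<open>Cancellation can shrink the support of a sum, so evaluations are compared over a common
  finite set that contains all the supports.\<close>

lemma eval_superset:
  assumes "R.carrier_coeff f" "finite F" "{m. f m \<noteq> \<zero>} \<subseteq> F"
  shows "eval f = (\<Oplus>\<^bsub>S\<^esub>m\<in>F. h (f m) \<otimes>\<^bsub>S\<^esub> monomial S n t (count m))"
  unfolding eval_def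
proof (rule S.add.finprod_mono_neutral_cong_left)
  fix m assume "m \<in> F - {m. f m \<noteq> \<zero>}"
  thus "h (f m) \<otimes>\<^bsub>S\<^esub> monomial S n t (count m) = \<zero>\<^bsub>S\<^esub>" using t_monomial_closed by simp
qed (use assms R.carrier_coeffE[OF assms(1)] t_monomial_closed in auto)

lemma eval_const:
  assumes "r \<in> carrier R" shows "eval (R.indexed_const r) = h r"
proof -
  have "eval (R.indexed_const r) =
    (\<Oplus>\<^bsub>S\<^esub>m\<in>{{#}}. h (R.indexed_const r m) \<otimes>\<^bsub>S\<^esub> monomial S n t (count m))"
    by (rule eval_superset[OF R.const_coeff[OF assms]]) (auto simp: R.indexed_const_def)
  also have "\<dots> = h r"
    using assms t_closed t_monomial_closed by (simp add: R.indexed_const_def S.monomial_zero)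
  finally show ?thesis .
qed

lemma eval_padd:
  assumes f: "f \<in> R.poly_set n" and g: "g \<in> R.poly_set n"
  shows "eval (R.indexed_padd f g) = eval f \<oplus>\<^bsub>S\<^esub> eval g"
proof -
  note c = f[THEN R.poly_set_coeff] g[THEN R.poly_set_coeff]
  note cm = c[THEN R.carrier_coeffE]
  let ?F = "{m. f m \<noteq> \<zero>} \<union> {m. g m \<noteq> \<zero>}"
  have F: "finite ?F" using f g R.poly_set_finite_support by blast
  have "eval (R.indexed_padd f g) =
    (\<Oplus>\<^bsub>S\<^esub>m\<in>?F. h (R.indexed_padd f g m) \<otimes>\<^bsub>S\<^esub> monomial S n t (count m))"
    by (rule eval_superset[OF R.indexed_padd_in_carrier[OF c] F]) (auto simp: R.indexed_padd_def)
  also have "\<dots> = (\<Oplus>\<^bsub>S\<^esub>m\<in>?F. h (f m) \<otimes>\<^bsub>S\<^esub> monomial S n t (count m) \<oplus>\<^bsub>S\<^esub>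
      h (g m) \<otimes>\<^bsub>S\<^esub> monomial S n t (count m))"
    using cm t_monomial_closed by (intro S.finsum_cong') (auto simp: R.indexed_padd_def S.l_distr)
  also have "\<dots> = (\<Oplus>\<^bsub>S\<^esub>m\<in>?F. h (f m) \<otimes>\<^bsub>S\<^esub> monomial S n t (count m)) \<oplus>\<^bsub>S\<^esub>
      (\<Oplus>\<^bsub>S\<^esub>m\<in>?F. h (g m) \<otimes>\<^bsub>S\<^esub> monomial S n t (count m))"
    using cm t_monomial_closed by (intro S.finsum_addf) auto
  also have "\<dots> = eval f \<oplus>\<^bsub>S\<^esub> eval g"
    using eval_superset[OF c(1) F] eval_superset[OF c(2) F] by auto
  finally show ?thesis .
qed

lemma eval_pmult:
  assumes f: "f \<in> R.poly_set n" and i: "i < n"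
  shows "eval (R.indexed_pmult f i) = t i \<otimes>\<^bsub>S\<^esub> eval f"
proof -
  note c = R.poly_set_coeff[OF f]
  note cm = R.carrier_coeffE[OF c]
  let ?F = "{m. f m \<noteq> \<zero>}"
  have F: "finite ?F" using R.poly_set_finite_support[OF f] .
  have ti: "t i \<in> carrier S" using t_closed i by auto
  have "eval (R.indexed_pmult f i) =
    (\<Oplus>\<^bsub>S\<^esub>m\<in>add_mset i ` ?F. h (R.indexed_pmult f i m) \<otimes>\<^bsub>S\<^esub> monomial S n t (count m))"
  proof (rule eval_superset[OF R.indexed_pmult_in_carrier[OF c]])
    show "{m. R.indexed_pmult f i m \<noteq> \<zero>} \<subseteq> add_mset i ` ?F"
      unfolding R.indexed_pmult_def by (auto split: if_splits dest!: multi_member_split)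
  qed (use F in simp)
  also have "\<dots> = (\<Oplus>\<^bsub>S\<^esub>m\<in>?F. h (R.indexed_pmult f i (add_mset i m)) \<otimes>\<^bsub>S\<^esub> monomial S n t (count (add_mset i m)))"
    using cm t_monomial_closed by (intro S.finsum_reindex) (auto simp: R.indexed_pmult_def inj_on_def)
  also have "\<dots> = (\<Oplus>\<^bsub>S\<^esub>m\<in>?F. t i \<otimes>\<^bsub>S\<^esub> (h (f m) \<otimes>\<^bsub>S\<^esub> monomial S n t (count m)))"
  proof (rule S.finsum_cong')
    fix m
    have "h (R.indexed_pmult f i (add_mset i m)) = h (f m)" unfolding R.indexed_pmult_def by simp
    thus "h (R.indexed_pmult f i (add_mset i m)) \<otimes>\<^bsub>S\<^esub> monomial S n t (count (add_mset i m)) =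
      t i \<otimes>\<^bsub>S\<^esub> (h (f m) \<otimes>\<^bsub>S\<^esub> monomial S n t (count m))"
      unfolding monomial_add_mset[OF i] using S.m_lcomm ti cm t_monomial_closed by simp
  qed (use cm ti t_monomial_closed in auto)
  also have "\<dots> = t i \<otimes>\<^bsub>S\<^esub> eval f"
    unfolding eval_def using cm ti t_monomial_closed F by (intro S.finsum_rdistr[symmetric]) auto
  finally show ?thesis .
qed

lemma eval_scale:
  assumes f: "f \<in> R.poly_set n" and r: "r \<in> carrier R"
  shows "eval (\<lambda>m. r \<otimes> f m) = h r \<otimes>\<^bsub>S\<^esub> eval f"
  using f
proof (induction rule: R.indexed_pset.induct)
  case (indexed_const k)
  have eq: "(\<lambda>m :: nat multiset. r \<otimes> R.indexed_const k m) = R.indexed_const (r \<otimes> k)"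
    unfolding R.indexed_const_def using r by auto
  show ?case unfolding eq using indexed_const r by (simp add: eval_const)
next
  case (indexed_padd f g)
  have eq: "(\<lambda>m. r \<otimes> R.indexed_padd f g m) = R.indexed_padd (\<lambda>m. r \<otimes> f m) (\<lambda>m. r \<otimes> g m)"
    unfolding R.indexed_padd_def using r indexed_padd(1,2)[THEN R.poly_set_coeff, THEN R.carrier_coeffE]
    by (auto simp: R.r_distr)
  show ?case unfolding eq using indexed_padd r
    by (simp add: eval_padd R.poly_set_scale S.r_distr eval_closed)
next
  case (indexed_pmult f i)
  have eq: "(\<lambda>m. r \<otimes> R.indexed_pmult f i m) = R.indexed_pmult (\<lambda>m. r \<otimes> f m) i"
    unfolding R.indexed_pmult_def using r by auto
  have ti: "t i \<in> carrier S" using t_closed indexed_pmult(2) by auto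
  show ?case unfolding eq using indexed_pmult r ti S.m_lcomm[of "t i" "h r" "eval f"]
    by (simp add: eval_pmult R.poly_set_scale eval_closed)
qed

lemma eval_conv:
  assumes f: "f \<in> R.poly_set n" and g: "g \<in> R.poly_set n"
  shows "eval (R.conv f g) = eval f \<otimes>\<^bsub>S\<^esub> eval g"
  using f
proof (induction rule: R.indexed_pset.induct)
  case (indexed_const k)
  thus ?case using R.conv_const[OF _ R.poly_set_coeff[OF g]] eval_scale[OF g] eval_const by simp
next
  case (indexed_padd f1 f2)
  have "R.conv (R.indexed_padd f1 f2) g = R.indexed_padd (R.conv f1 g) (R.conv f2 g)"
    using indexed_padd(1,2) g by (intro R.conv_padd_left R.poly_set_coeff)
  thus ?case using indexed_padd g
    by (simp add: eval_padd R.poly_set_conv S.l_distr eval_closed)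
next
  case (indexed_pmult f i)
  have "R.conv (R.indexed_pmult f i) g = R.indexed_pmult (R.conv f g) i"
    using indexed_pmult(1) g by (intro R.conv_pmult R.poly_set_coeff)
  moreover have "t i \<in> carrier S" using t_closed indexed_pmult(2) by auto
  ultimately show ?case using indexed_pmult g
    by (simp add: eval_pmult R.poly_set_conv S.m_assoc eval_closed)
qed

theorem eval_hom: "eval \<in> ring_hom (mpoly_ring n R) S"
  by (rule ring_hom_memI) (simp_all add: R.mpoly_ring_simps eval_closed eval_conv eval_padd eval_const)

lemma eval_var:
  assumes "i < n" shows "eval (R.indexed_var i) = t i"
proof -
  have "R.indexed_const \<one> \<in> R.poly_set n" by (intro R.indexed_pset.intros) simp
  moreover have "t i \<in> carrier S" using t_closed assms by auto
  ultimately show ?thesis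
    unfolding R.indexed_var_def using assms by (simp add: eval_pmult eval_const)
qed

end

section \<open>One step of the tower\<close>

context ring_hom_cring
begin

lemma hom_monomial:
  assumes "t \<in> {..<n} \<rightarrow> carrier R"
  shows "h (monomial R n t b) = monomial S n (\<lambda>j. h (t j)) b"
proof -
  have "h (monomial R n t b) = (\<Otimes>\<^bsub>S\<^esub>i\<in>{..<n}. (h \<circ> (\<lambda>i. t i [^] b i)) i)"
    unfolding monomial_def using assms by (intro hom_finprod) auto
  also have "\<dots> = monomial S n (\<lambda>j. h (t j)) b"
    unfolding monomial_def using assms by (intro S.finprod_cong') (auto simp: hom_pow Pi_def)
  finally show ?thesis .
qed

lemma hom_box_sum:
  assumes t: "t \<in> {..<n} \<rightarrow> carrier R" and c: "c \<in> exp_box p n \<rightarrow> carrier R"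
  shows "h (R.box_sum p n t c) = S.box_sum p n (\<lambda>j. h (t j)) (\<lambda>b. h (c b))"
proof -
  have "h (R.box_sum p n t c) = (\<Oplus>\<^bsub>S\<^esub>b\<in>exp_box p n. (h \<circ> (\<lambda>b. c b \<otimes> monomial R n t b)) b)"
    unfolding R.box_sum_def using c R.monomial_closed[OF t] by (intro hom_finsum) auto
  also have "\<dots> = S.box_sum p n (\<lambda>j. h (t j)) (\<lambda>b. h (c b))"
    unfolding S.box_sum_def hom_monomial[OF t, symmetric]
    using c R.monomial_closed[OF t] by (intro S.finsum_cong') (auto simp: Pi_def)
  finally show ?thesis .
qed

lemma hom_minus: "a \<in> carrier R \<Longrightarrow> b \<in> carrier R \<Longrightarrow> h (a \<ominus> b) = h a \<ominus>\<^bsub>S\<^esub> h b"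
  by (simp add: R.minus_eq S.minus_eq)

lemma hom_eq_iff:
  assumes "a \<in> carrier R" "b \<in> carrier R"
  shows "h a = h b \<longleftrightarrow> a \<ominus> b \<in> a_kernel R S h"
  unfolding a_kernel_def' using assms by (simp add: hom_minus)

lemma kernel_ideal: "ideal (a_kernel R S h) R"
  by (rule ring_hom_ring.kernel_is_ideal[OF ring_hom_ringI2[OF R.ring_axioms S.ring_axioms homh]])

lemma hom_image_subring: "subring (h ` carrier R) S"
proof (rule S.subringI)
  show "\<one>\<^bsub>S\<^esub> \<in> h ` carrier R" by (intro image_eqI[of _ _ "\<one>"]) auto
next
  fix a assume "a \<in> h ` carrier R"
  then obtain r where "r \<in> carrier R" "a = h r" by blast
  thus "\<ominus>\<^bsub>S\<^esub> a \<in> h ` carrier R" by (intro image_eqI[of _ _ "\<ominus> r"]) auto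
next
  fix a b assume "a \<in> h ` carrier R" "b \<in> h ` carrier R"
  then obtain r s where rs: "r \<in> carrier R" "a = h r" "s \<in> carrier R" "b = h s" by blast
  thus "a \<otimes>\<^bsub>S\<^esub> b \<in> h ` carrier R" by (intro image_eqI[of _ _ "r \<otimes> s"]) auto
  show "a \<oplus>\<^bsub>S\<^esub> b \<in> h ` carrier R" using rs by (intro image_eqI[of _ _ "r \<oplus> s"]) auto
qed auto

lemma hom_generate_ring:
  assumes "H \<subseteq> carrier R" "f \<in> generate_ring R H" shows "h f \<in> generate_ring S (h ` H)"
  using assms(2)
proof (induction)
  case one thus ?case by (simp add: generate_ring.one)
next
  case (incl f) thus ?case by (simp add: generate_ring.incl)
next
  case (a_inv f) thus ?case using R.generate_ring_in_carrier[OF assms(1)] by (simp add: generate_ring.a_inv)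
next
  case (eng_add f g) thus ?case using R.generate_ring_in_carrier[OF assms(1)] by (simp add: generate_ring.eng_add)
next
  case (eng_mult f g) thus ?case using R.generate_ring_in_carrier[OF assms(1)] by (simp add: generate_ring.eng_mult)
qed

end

text \<open>The stage \<open>A\<close> is presented as R/K by a surjection from the fixed ring R.
  Since every stage is a quotient of this same ring, the p-basis of R serves for all of
  them.\<close>

locale frobenius_step = p_basis_ring R p n x + A: cring A
  for R (structure) and p n x and A (structure) +
  fixes \<alpha> and a :: "nat \<Rightarrow> 'c"
  assumes \<alpha>_hom: "\<alpha> \<in> ring_hom R A" and \<alpha>_surj: "\<alpha> ` carrier R = carrier A"
    and a_eq: "\<And>j. j < n \<Longrightarrow> a j = \<alpha> (x j)"
begin

sublocale alpha: ring_hom_cring R A \<alpha>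
  by unfold_locales (rule \<alpha>_hom)

abbreviation "K \<equiv> a_kernel R A \<alpha>"
abbreviation "K' \<equiv> frob_ideal K"
abbreviation "T \<equiv> R Quot K'"
abbreviation "P \<equiv> mpoly_ring n A"
abbreviation "I \<equiv> root_ideal p n A a"

definition proj :: "'a \<Rightarrow> 'a set" where "proj s = K' +>\<^bsub>R\<^esub> s"

lemma K'_ideal: "ideal K' R" using frob_ideal_ideal[OF alpha.kernel_ideal] .

sublocale proj: ring_hom_cring R T proj
proof -
  have "proj = (+>\<^bsub>R\<^esub>) K'" unfolding proj_def by auto
  thus "ring_hom_cring R T proj" using ideal.rcos_ring_hom_cring[OF K'_ideal is_cring] by simp
qed

lemma proj_eq_iff: "r \<in> carrier R \<Longrightarrow> s \<in> carrier R \<Longrightarrow> proj r = proj s \<longleftrightarrow> r \<ominus> s \<in> K'"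
  unfolding proj_def using quotient_eq_iff_same_a_r_cos[OF K'_ideal] by blast

lemma proj_surj: "proj ` carrier R = carrier T"
  unfolding proj_def FactRing_def A_RCOSETS_def' by auto

definition lift :: "'c \<Rightarrow> 'a" where "lift = inv_into (carrier R) \<alpha>"

lemma lift: "r \<in> carrier A \<Longrightarrow> lift r \<in> carrier R" "r \<in> carrier A \<Longrightarrow> \<alpha> (lift r) = r"
  unfolding lift_def \<alpha>_surj[symmetric] by (auto intro: inv_into_into f_inv_into_f)

definition frob :: "'c \<Rightarrow> 'a set" where "frob r = proj (lift r [^] p)"

text \<open>Independence of the lift: two lifts differ by an element of K, and the p-th power of the
  difference lies in \<open>K'\<close>. Hence taking p-th powers is well defined from R/K to R/K',
  not merely to R/K.\<close>

lemma frob_alpha: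
  assumes "s \<in> carrier R" shows "frob (\<alpha> s) = proj (s [^] p)"
proof -
  have c: "lift (\<alpha> s) \<in> carrier R" "\<alpha> (lift (\<alpha> s)) = \<alpha> s" using lift assms by auto
  hence "lift (\<alpha> s) \<ominus> s \<in> K" using alpha.hom_eq_iff assms by blast
  hence "(lift (\<alpha> s) \<ominus> s) [^] p \<in> K'" by (rule pow_mem_frob_ideal[OF alpha.kernel_ideal])
  thus ?thesis unfolding frob_def using frob_minus[OF c(1) assms] c(1) assms
      proj_eq_iff[of "lift (\<alpha> s) [^] p" "s [^] p"] by simp
qed

lemma frob_hom: "frob \<in> ring_hom A T"
proof (rule ring_hom_memI)
  show "frob r \<in> carrier T" if "r \<in> carrier A" for r unfolding frob_def using lift[OF that] by simp
  show "frob \<one>\<^bsub>A\<^esub> = \<one>\<^bsub>T\<^esub>" using frob_alpha[OF one_closed] by (simp add: alpha.hom_one del: alpha.homh)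
next
  fix r s assume "r \<in> carrier A" "s \<in> carrier A"
  then obtain u v where uv: "u \<in> carrier R" "v \<in> carrier R" "r = \<alpha> u" "s = \<alpha> v"
    unfolding \<alpha>_surj[symmetric] by blast
  have f: "frob r = proj (u [^] p)" "frob s = proj (v [^] p)" using uv by (simp_all only: frob_alpha)
  have "frob (r \<otimes>\<^bsub>A\<^esub> s) = proj ((u \<otimes> v) [^] p)" "frob (r \<oplus>\<^bsub>A\<^esub> s) = proj ((u \<oplus> v) [^] p)"
    unfolding uv(3,4) alpha.hom_mult[OF uv(1,2), symmetric] alpha.hom_add[OF uv(1,2), symmetric]
    using uv(1,2) by (simp_all only: frob_alpha m_closed a_closed)
  thus "frob (r \<otimes>\<^bsub>A\<^esub> s) = frob r \<otimes>\<^bsub>T\<^esub> frob s" "frob (r \<oplus>\<^bsub>A\<^esub> s) = frob r \<oplus>\<^bsub>T\<^esub> frob s"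
    unfolding f using uv(1,2) by (simp_all add: nat_pow_distrib frob_add)
qed

sublocale eps: mpoly_eval A T frob n "\<lambda>j. proj (x j)"
proof (rule mpoly_eval.intro)
  show "ring_hom_cring A T frob" by unfold_locales (rule frob_hom)
  show "mpoly_eval_axioms T n (\<lambda>j. proj (x j))" by unfold_locales (use x_closed in auto)
qed

sublocale P: cring P by (rule A.mpoly_ring_cring)

sublocale eval: ring_hom_cring P T eps.eval
  by unfold_locales (rule eps.eval_hom)

sublocale const: ring_hom_cring A P A.indexed_const
  by unfold_locales (rule A.indexed_const_hom)

lemma var_closed: "A.indexed_var \<in> {..<n} \<rightarrow> carrier P"
  using A.indexed_var_closed by (auto simp: A.mpoly_ring_simps)

lemma a_mem: "a \<in> {..<n} \<rightarrow> carrier A"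
  using a_eq x_closed by (auto simp: Pi_def)

abbreviation "root_gens \<equiv> (\<lambda>j. A.indexed_var j [^]\<^bsub>P\<^esub> p \<ominus>\<^bsub>P\<^esub> A.indexed_const (a j)) ` {..<n}"

lemma root_gens_closed: "root_gens \<subseteq> carrier P"
  using var_closed a_mem by (auto simp: Pi_def)

lemma I_ideal: "ideal I P"
  unfolding root_ideal_def using P.genideal_ideal[OF root_gens_closed] .

text \<open>Both X_j^p and the constant \<open>a j\<close> evaluate to the class of x_j^p.\<close>

lemma I_subset_kernel: "I \<subseteq> a_kernel P T eps.eval"
  unfolding root_ideal_def
proof (rule P.genideal_minimal[OF eval.kernel_ideal], clarify)
  fix j assume "j < n"
  hence c: "A.indexed_var j \<in> carrier P" "a j \<in> carrier A" "x j \<in> carrier R"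
    using var_closed a_mem x_closed by (auto simp: Pi_def)
  have eq: "eps.eval (A.indexed_var j [^]\<^bsub>P\<^esub> p) = eps.eval (A.indexed_const (a j))"
    using \<open>j < n\<close> c frob_alpha[OF c(3)] a_eq[OF \<open>j < n\<close>]
    by (simp add: eval.hom_pow eps.eval_var eps.eval_const proj.hom_pow)
  show "A.indexed_var j [^]\<^bsub>P\<^esub> p \<ominus>\<^bsub>P\<^esub> A.indexed_const (a j) \<in> a_kernel P T eps.eval"
    using eval.hom_eq_iff[OF P.nat_pow_closed[OF c(1)] const.hom_closed[OF c(2)]] eq by blast
qed

text \<open>Normal forms modulo \<open>I\<close>, of degree below p in each variable. The
  coefficients are given through lifts to R, so that they can be compared with the coordinates of
  \<open>frob_sum c\<close>.\<close>

definition lift_sum :: "((nat \<Rightarrow> nat) \<Rightarrow> 'a) \<Rightarrow> nat multiset \<Rightarrow> 'c" where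
  "lift_sum c = P.box_sum p n A.indexed_var (\<lambda>b. A.indexed_const (\<alpha> (c b)))"

lemma lift_sum_closed: "c \<in> exp_box p n \<rightarrow> carrier R \<Longrightarrow> lift_sum c \<in> carrier P"
  unfolding lift_sum_def by (rule P.box_sum_closed[OF var_closed]) auto

lemma eval_lift_sum:
  assumes c: "c \<in> exp_box p n \<rightarrow> carrier R" shows "eps.eval (lift_sum c) = proj (frob_sum c)"
proof -
  have "eps.eval (lift_sum c) = proj.S.box_sum p n (\<lambda>j. eps.eval (A.indexed_var j)) (\<lambda>b. eps.eval (A.indexed_const (\<alpha> (c b))))"
    unfolding lift_sum_def using c by (intro eval.hom_box_sum[OF var_closed]) auto
  also have "\<dots> = proj.S.box_sum p n (\<lambda>j. proj (x j)) (\<lambda>b. proj (c b [^] p))"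
    unfolding proj.S.box_sum_def
  proof (rule proj.S.finsum_cong')
    fix b assume b: "b \<in> exp_box p n"
    have "monomial T n (\<lambda>j. eps.eval (A.indexed_var j)) b = monomial T n (\<lambda>j. proj (x j)) b"
      using x_closed by (intro proj.S.monomial_cong) (auto simp: eps.eval_var)
    moreover have "eps.eval (A.indexed_const (\<alpha> (c b))) = proj (c b [^] p)"
    proof -
      have "c b \<in> carrier R" using b c by auto
      thus ?thesis by (simp only: eps.eval_const alpha.hom_closed frob_alpha)
    qed
    ultimately show "eps.eval (A.indexed_const (\<alpha> (c b))) \<otimes>\<^bsub>T\<^esub> monomial T n (\<lambda>j. eps.eval (A.indexed_var j)) b =
       proj (c b [^] p) \<otimes>\<^bsub>T\<^esub> monomial T n (\<lambda>j. proj (x j)) b" by simp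
  qed (use c x_closed in \<open>auto intro!: proj.S.monomial_closed proj.S.m_closed\<close>)
  also have "\<dots> = proj (frob_sum c)"
    unfolding frob_sum_def using c by (intro proj.hom_box_sum[OF x_closed, symmetric]) auto
  finally show ?thesis .
qed

lemma eval_surj: "s \<in> carrier R \<Longrightarrow> \<exists>f\<in>carrier P. eps.eval f = proj s"
  using frob_sum_expand lift_sum_closed eval_lift_sum by metis

text \<open>In the quotient by \<open>I\<close> the p-th powers of the variables are classes of
  constants, so \<open>box_span_generates\<close> applies with the constants as coefficient
  ring.\<close>

lemma reduce_mod_root_ideal:
  assumes f: "f \<in> carrier P"
  shows "\<exists>c \<in> exp_box p n \<rightarrow> carrier R. f \<ominus>\<^bsub>P\<^esub> lift_sum c \<in> I"
proof -
  let ?Q = "P Quot I"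
  interpret q: ring_hom_cring P ?Q "(+>\<^bsub>P\<^esub>) I"
    using ideal.rcos_ring_hom_cring[OF I_ideal P.is_cring] .
  have q_eq: "I +>\<^bsub>P\<^esub> f = I +>\<^bsub>P\<^esub> g \<longleftrightarrow> f \<ominus>\<^bsub>P\<^esub> g \<in> I" if "f \<in> carrier P" "g \<in> carrier P" for f g
    using P.quotient_eq_iff_same_a_r_cos[OF I_ideal] that by blast
  interpret qc: ring_hom_cring A ?Q "\<lambda>r. I +>\<^bsub>P\<^esub> A.indexed_const r"
  proof unfold_locales
    show "(\<lambda>r. I +>\<^bsub>P\<^esub> A.indexed_const r) \<in> ring_hom A ?Q"
      using ring_hom_trans[OF A.indexed_const_hom q.homh] by (simp add: comp_def)
  qed
  let ?C = "(\<lambda>r. I +>\<^bsub>P\<^esub> A.indexed_const r) ` carrier A" and ?t = "\<lambda>j. I +>\<^bsub>P\<^esub> A.indexed_var j"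
  have t: "?t \<in> {..<n} \<rightarrow> carrier ?Q" using var_closed by auto
  have tp: "?t j [^]\<^bsub>?Q\<^esub> p \<in> ?C" if j: "j < n" for j
  proof -
    have c: "A.indexed_var j \<in> carrier P" "a j \<in> carrier A" using var_closed a_mem j by auto
    have "A.indexed_var j [^]\<^bsub>P\<^esub> p \<ominus>\<^bsub>P\<^esub> A.indexed_const (a j) \<in> I"
      unfolding root_ideal_def using P.genideal_self[OF root_gens_closed] j by blast
    hence "I +>\<^bsub>P\<^esub> A.indexed_var j [^]\<^bsub>P\<^esub> p = I +>\<^bsub>P\<^esub> A.indexed_const (a j)"
      using q_eq[OF P.nat_pow_closed[OF c(1)] const.hom_closed[OF c(2)]] by blast
    hence "?t j [^]\<^bsub>?Q\<^esub> p = I +>\<^bsub>P\<^esub> A.indexed_const (a j)"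
      unfolding q.hom_pow[OF c(1)] .
    thus ?thesis using c(2) by (rule image_eqI)
  qed
  have gens: "A.indexed_const ` carrier A \<union> A.indexed_var ` {..<n} \<subseteq> carrier P" using var_closed by auto
  have "f \<in> generate_ring P (A.indexed_const ` carrier A \<union> A.indexed_var ` {..<n})"
    using A.mpoly_ring_generated[of f n] f by (simp add: A.mpoly_ring_simps)
  from q.hom_generate_ring[OF gens this]
  have "I +>\<^bsub>P\<^esub> f \<in> generate_ring ?Q (?C \<union> ?t ` {..<n})" by (simp add: image_Un image_image)
  from q.S.box_span_generates[OF t qc.hom_image_subring tp p_pos this]
  obtain c where c: "c \<in> exp_box p n \<rightarrow> ?C" "I +>\<^bsub>P\<^esub> f = q.S.box_sum p n ?t c" by blast
  have "\<forall>b\<in>exp_box p n. \<exists>r. r \<in> carrier R \<and> c b = I +>\<^bsub>P\<^esub> A.indexed_const (\<alpha> r)"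
    using c(1) unfolding \<alpha>_surj[symmetric] by (fastforce simp: Pi_def)
  from bchoice[OF this] obtain d where d: "\<forall>b\<in>exp_box p n. d b \<in> carrier R \<and> c b = I +>\<^bsub>P\<^esub> A.indexed_const (\<alpha> (d b))"
    by blast
  have dc: "d \<in> exp_box p n \<rightarrow> carrier R" using d by blast
  have "I +>\<^bsub>P\<^esub> lift_sum d = q.S.box_sum p n ?t (\<lambda>b. I +>\<^bsub>P\<^esub> A.indexed_const (\<alpha> (d b)))"
    unfolding lift_sum_def using dc by (intro q.hom_box_sum[OF var_closed]) auto
  also have "\<dots> = I +>\<^bsub>P\<^esub> f"
    unfolding c(2) using d dc by (intro q.S.box_sum_cong[OF t, symmetric]) auto
  finally show ?thesis using q_eq[OF f lift_sum_closed[OF dc]] dc by auto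
qed

text \<open>Reduce f to a normal form. If it evaluates to zero, \<open>frob_sum c\<close> lies in
  \<open>K'\<close>, so all its coordinates lie in K. Their images under \<open>\<alpha>\<close> are
  the coefficients of the normal form, which is therefore zero.\<close>

lemma kernel_eval:
  assumes f: "f \<in> carrier P" and z: "eps.eval f = \<zero>\<^bsub>T\<^esub>" shows "f \<in> I"
proof -
  obtain c where c: "c \<in> exp_box p n \<rightarrow> carrier R" "f \<ominus>\<^bsub>P\<^esub> lift_sum c \<in> I"
    using reduce_mod_root_ideal[OF f] by blast
  hence "eps.eval f = eps.eval (lift_sum c)"
    using I_subset_kernel eval.hom_eq_iff[OF f lift_sum_closed] by blast
  hence "proj (frob_sum c) = proj \<zero>" using z eval_lift_sum[OF c(1)] by simp
  hence "frob_sum c \<in> K'" using proj_eq_iff[OF frob_sum_closed[OF c(1)] zero_closed] frob_sum_closed[OF c(1)]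
    by (simp add: minus_eq)
  hence coeff: "c b \<in> K" if "b \<in> exp_box p n" for b
    using frob_ideal_coeff[OF alpha.kernel_ideal c(1)] that by blast
  have "lift_sum c = \<zero>\<^bsub>P\<^esub>"
    unfolding lift_sum_def P.box_sum_def
  proof (rule P.add.finprod_one_eqI)
    fix b assume "b \<in> exp_box p n"
    hence "\<alpha> (c b) = \<zero>\<^bsub>A\<^esub>" using coeff unfolding a_kernel_def' by blast
    thus "A.indexed_const (\<alpha> (c b)) \<otimes>\<^bsub>P\<^esub> monomial P n A.indexed_var b = \<zero>\<^bsub>P\<^esub>"
      using P.monomial_closed[OF var_closed] by simp
  qed
  thus ?thesis using c(2) f by (simp add: P.minus_eq)
qed

lemma eval_eq_iff:
  assumes "f \<in> carrier P" "g \<in> carrier P"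
  shows "eps.eval f = eps.eval g \<longleftrightarrow> I +>\<^bsub>P\<^esub> f = I +>\<^bsub>P\<^esub> g"
proof -
  have "a_kernel P T eps.eval = I" using kernel_eval I_subset_kernel unfolding a_kernel_def' by blast
  thus ?thesis using eval.hom_eq_iff[OF assms] P.quotient_eq_iff_same_a_r_cos[OF I_ideal assms] by simp
qed

text \<open>Identifies \<phi> with the projection R/K' \<rightarrow> R/K: the formula for \<phi> on
  A and the evaluation in R/K' are images of one and the same element of R, and \<open>K'\<close> is
  contained in K.\<close>

lemma frob_eval_eq:
  assumes f: "f \<in> carrier P" and s: "s \<in> carrier R" and eq: "eps.eval f = proj s"
  shows "frob_eval p n A a f = \<alpha> s"
proof -
  have fm: "f m \<in> carrier A" for m
    using f A.carrier_coeffE[OF A.poly_set_coeff] by (auto simp: A.mpoly_ring_simps)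
  let ?F = "{m. f m \<noteq> \<zero>\<^bsub>A\<^esub>}"
  let ?g = "\<lambda>m. lift (f m) [^] p \<otimes> monomial R n x (count m)"
  have g: "?g \<in> ?F \<rightarrow> carrier R" using lift(1)[OF fm] monomial_closed[OF x_closed] by auto
  \<comment> \<open>A common lift to R of the value in A and of the evaluation in R/K', built from
    chosen lifts of the coefficients.\<close>
  define e where "e = (\<Oplus>m\<in>?F. ?g m)"
  have e: "e \<in> carrier R" unfolding e_def using g by (rule finsum_closed)
  have "proj e = (\<Oplus>\<^bsub>T\<^esub>m\<in>?F. (proj \<circ> ?g) m)" unfolding e_def by (rule proj.hom_finsum[OF g])
  also have "\<dots> = eps.eval f"
    unfolding eps.eval_def using eps.t_monomial_closed fm lift(1)[OF fm] monomial_closed[OF x_closed]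
    by (intro proj.S.finsum_cong') (auto simp: frob_def proj.hom_monomial[OF x_closed])
  finally have "e \<ominus> s \<in> K'" using eq proj_eq_iff[OF e s] by simp
  hence "e \<ominus> s \<in> K" using frob_ideal_subset[OF alpha.kernel_ideal] by blast
  hence "\<alpha> s = \<alpha> e" using alpha.hom_eq_iff[OF e s] by simp
  also have "\<dots> = (\<Oplus>\<^bsub>A\<^esub>m\<in>?F. (\<alpha> \<circ> ?g) m)" unfolding e_def by (rule alpha.hom_finsum[OF g])
  also have "\<dots> = frob_eval p n A a f"
    unfolding frob_eval_def
  proof (rule A.finsum_cong')
    fix m
    have "\<alpha> (monomial R n x (count m)) = monomial A n a (count m)"
      unfolding alpha.hom_monomial[OF x_closed] using a_mem a_eq by (intro A.monomial_cong) auto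
    thus "(\<alpha> \<circ> ?g) m = f m [^]\<^bsub>A\<^esub> p \<otimes>\<^bsub>A\<^esub> monomial A n a (count m)"
      using lift[OF fm] monomial_closed[OF x_closed] by (simp add: alpha.hom_pow)
  qed (use fm A.monomial_closed[OF a_mem] in auto)
  finally show ?thesis by simp
qed

end

section \<open>Powers and Frobenius powers of ideals\<close>

context cring
begin

lemma ideal_power_0: "ideal_power R J 0 = carrier R"
  by (simp add: nat_pow_def ideals_set_def)

lemma ideal_power_Suc: "ideal_power R J (Suc k) = ideal_power R J k \<cdot> J"
  by (simp add: nat_pow_def ideals_set_def)

lemma ideal_power_ideal:
  assumes "ideal J R" shows "ideal (ideal_power R J k) R"
proof (induction k)
  case 0 show ?case unfolding ideal_power_0 by (rule oneideal)
next
  case (Suc k) show ?case unfolding ideal_power_Suc by (rule ideal_prod_is_ideal[OF Suc assms])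
qed

lemma ideal_power_Suc_subset:
  assumes "ideal J R" shows "ideal_power R J (Suc k) \<subseteq> ideal_power R J k"
proof
  note I = ideal_power_ideal[OF assms, of k]
  fix c assume "c \<in> ideal_power R J (Suc k)"
  thus "c \<in> ideal_power R J k" unfolding ideal_power_Suc
  proof (induction)
    case (prod i j)
    thus ?case using ideal_mult_closed'[OF I] ideal_subset_carrier[OF assms] by blast
  next
    case (sum s1 s2)
    thus ?case using ideal_add_closed[OF I] by blast
  qed
qed

lemma ideal_power_antimono:
  assumes "ideal J R" "k \<le> l" shows "ideal_power R J l \<subseteq> ideal_power R J k"
  using assms(2) by (induction rule: dec_induct) (use ideal_power_Suc_subset[OF assms(1)] in auto)

end

text \<open>Replaces the pigeonhole argument on generators of J. The colon ideals (L : J^k)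
  stabilize at some m; were the limit proper, an element a outside it with maximal colon ideal would
  be multiplied into it by J, and so would lie in the next colon ideal.\<close>

lemma (in noetherian_cring) ideal_power_subset_if_radical:
  assumes J: "ideal J R" and L: "ideal L R" and pow: "\<And>c. c \<in> J \<Longrightarrow> c [^] (q::nat) \<in> L"
  shows "\<exists>N. ideal_power R J N \<subseteq> L"
proof -
  let ?I = "ideal_power R J"
  have Ic: "?I k \<subseteq> carrier R" for k using ideal_subset_carrier[OF ideal_power_ideal[OF J]] .
  have Jc: "J \<subseteq> carrier R" using ideal_subset_carrier[OF J] .
  have Lc: "L \<subseteq> carrier R" using ideal_subset_carrier[OF L] .
  \<comment> \<open>The colon ideal (L : J^k), increasing in k.\<close>
  define W where "W = (\<lambda>k. {a \<in> carrier R. \<forall>c\<in>?I k. a \<otimes> c \<in> L})"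
  have W: "ideal (W k) R" for k
  proof (rule idealI_closed)
    show "\<zero> \<in> W k" unfolding W_def using Ic[of k] ideal_zero_closed[OF L] by auto
  next
    fix a b assume ab: "a \<in> W k" "b \<in> W k"
    have "(a \<oplus> b) \<otimes> c \<in> L" if "c \<in> ?I k" for c
    proof -
      have "(a \<oplus> b) \<otimes> c = a \<otimes> c \<oplus> b \<otimes> c" using ab that Ic[of k] unfolding W_def by (auto intro!: l_distr)
      thus ?thesis using ab that ideal_add_closed[OF L] unfolding W_def by auto
    qed
    thus "a \<oplus> b \<in> W k" using ab unfolding W_def by auto
  next
    fix r a assume ra: "r \<in> carrier R" "a \<in> W k"
    have "(r \<otimes> a) \<otimes> c \<in> L" if "c \<in> ?I k" for c
    proof -
      have "(r \<otimes> a) \<otimes> c = r \<otimes> (a \<otimes> c)" using ra that Ic[of k] unfolding W_def by (auto intro!: m_assoc)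
      thus ?thesis using ra that ideal_mult_closed[OF L] unfolding W_def by auto
    qed
    thus "r \<otimes> a \<in> W k" using ra unfolding W_def by auto
  qed (auto simp: W_def)
  have mono: "W k \<subseteq> W (Suc k)" for k using ideal_power_Suc_subset[OF J, of k] unfolding W_def by auto
  have "\<exists>M\<in>range W. \<forall>V\<in>range W. M \<subseteq> V \<longrightarrow> V = M"
    by (rule exists_maximal_ideal_in) (use W in auto)
  then obtain m where "\<forall>V\<in>range W. W m \<subseteq> V \<longrightarrow> V = W m" by (elim bexE rangeE) simp
  hence m: "W (Suc m) = W m" using mono[of m] by simp
  have "W m = carrier R"
  proof (rule ccontr)
    assume "W m \<noteq> carrier R"
    define C where "C = (\<lambda>a. {r \<in> carrier R. r \<otimes> a \<in> W m})"
    have C: "ideal (C a) R" if "a \<in> carrier R" for a unfolding C_def by (rule colon_ideal[OF W that])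
    have "carrier R - W m \<noteq> {}" using \<open>W m \<noteq> carrier R\<close> ideal_subset_carrier[OF W[of m]] by blast
    hence "\<exists>D\<in>C ` (carrier R - W m). \<forall>E\<in>C ` (carrier R - W m). D \<subseteq> E \<longrightarrow> E = D"
      by (intro exists_maximal_ideal_in) (use C in auto)
    then obtain a where a: "a \<in> carrier R" "a \<notin> W m"
      and max: "\<And>b. b \<in> carrier R \<Longrightarrow> b \<notin> W m \<Longrightarrow> C a \<subseteq> C b \<Longrightarrow> C b = C a" by auto
    have Ja: "c \<otimes> a \<in> W m" if c: "c \<in> J" for c
    proof (rule ccontr)
      assume neg: "c \<otimes> a \<notin> W m"
      have cc: "c \<in> carrier R" using c Jc by auto
      \<comment> \<open>By maximality the colon ideal of a does not grow when a is multiplied by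
        powers of c, so no such product enters W m. But the q-th power of c lies in L, which W m
        contains.\<close>
      have "c [^] i \<otimes> a \<notin> W m \<and> C (c [^] i \<otimes> a) = C a" for i :: nat
      proof (induction i)
        case 0 thus ?case using a by simp
      next
        case (Suc i)
        let ?b = "c [^] i \<otimes> a"
        have b: "?b \<in> carrier R" using cc a by simp
        have eq: "c [^] Suc i \<otimes> a = c \<otimes> ?b" using cc a by (simp add: m_assoc m_lcomm)
        have "c \<notin> C a" using neg unfolding C_def by simp
        hence "c \<notin> C ?b" using Suc by simp
        hence notin: "c \<otimes> ?b \<notin> W m" using cc unfolding C_def by simp
        have "C ?b \<subseteq> C (c \<otimes> ?b)"
        proof
          fix r assume r: "r \<in> C ?b"
          hence rc: "r \<in> carrier R" "r \<otimes> ?b \<in> W m" unfolding C_def by auto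
          have "r \<otimes> (c \<otimes> ?b) = c \<otimes> (r \<otimes> ?b)" using rc(1) cc b by (rule m_lcomm)
          thus "r \<in> C (c \<otimes> ?b)" using ideal_mult_closed[OF W rc(2) cc] rc(1) unfolding C_def by simp
        qed
        hence "C (c \<otimes> ?b) = C a" using max[of "c \<otimes> ?b"] Suc notin cc b by simp
        thus ?case using notin unfolding eq by simp
      qed
      moreover have "c [^] q \<otimes> a \<in> W m"
      proof -
        have "L \<subseteq> W m" unfolding W_def using Lc Ic[of m] ideal_mult_closed'[OF L] by auto
        thus ?thesis using pow[OF c] ideal_mult_closed'[OF W _ a(1)] by blast
      qed
      ultimately show False by blast
    qed
    \<comment> \<open>J a lies in (L : J^m), so a multiplies J^(m+1) into L and belongs to W (m+1),
      which equals W m.\<close>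
    have "a \<otimes> c \<in> L" if "c \<in> ?I (Suc m)" for c
      using that unfolding ideal_power_Suc
    proof (induction)
      case (prod i j)
      have ij: "i \<in> carrier R" "j \<in> carrier R" using prod Ic[of m] Jc by auto
      have "a \<otimes> (i \<otimes> j) = (j \<otimes> a) \<otimes> i" using ij a(1) by algebra
      thus ?case using Ja[OF prod(2)] prod(1) unfolding W_def by auto
    next
      case (sum s t)
      have "s \<in> carrier R" "t \<in> carrier R"
        using sum(1,2) Ic[of "Suc m"] unfolding ideal_power_Suc by auto
      thus ?case using sum a ideal_add_closed[OF L] by (simp add: r_distr)
    qed
    hence "a \<in> W (Suc m)" using a(1) unfolding W_def by auto
    thus False using m a(2) by simp
  qed
  hence "\<one> \<in> W m" by simp
  hence "\<forall>c\<in>?I m. \<one> \<otimes> c \<in> L" unfolding W_def by simp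
  hence "?I m \<subseteq> L" using Ic[of m] l_one by (metis subsetD subsetI)
  thus ?thesis by blast
qed

context p_basis_ring
begin

abbreviation frob_ideal_iter :: "'a set \<Rightarrow> nat \<Rightarrow> 'a set" where
  "frob_ideal_iter J k \<equiv> (frob_ideal ^^ k) J"

lemma frob_ideal_iter_ideal: "ideal J R \<Longrightarrow> ideal (frob_ideal_iter J k) R"
  by (induction k) (auto intro: frob_ideal_ideal)

text \<open>The intersection with J strengthens the induction: c^p = c c^(p-1) with c in J^k, and as
  p is at least 2 the second factor supplies the extra factor from J. Membership in J^k alone would
  not provide it at k = 0, where J^0 is the whole ring.\<close>

lemma frob_ideal_iter_subset_power:
  assumes J: "ideal J R" shows "frob_ideal_iter J k \<subseteq> ideal_power R J k \<inter> J"
proof (induction k)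
  case 0 thus ?case using ideal_subset_carrier[OF J] unfolding ideal_power_0 by simp
next
  case (Suc k)
  let ?N = "ideal_power R J (Suc k) \<inter> J"
  have "ideal ?N R" using i_intersect[OF ideal_power_ideal[OF J] J] .
  moreover have "(\<lambda>c. c [^] p) ` frob_ideal_iter J k \<subseteq> ?N"
  proof clarify
    fix c assume "c \<in> frob_ideal_iter J k"
    hence c: "c \<in> ideal_power R J k" "c \<in> J" using Suc by auto
    have cc: "c \<in> carrier R" using c ideal_subset_carrier[OF J] by auto
    obtain i where i: "p = Suc (Suc i)"
      using le_Suc_ex[OF prime_ge_2_nat[OF prime_p]] by (auto simp: numeral_2_eq_2)
    have "c [^] Suc i = c [^] i \<otimes> c" by simp
    hence cJ: "c [^] Suc i \<in> J" using ideal_mult_closed[OF J c(2)] cc by simp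
    have "c [^] p = c \<otimes> c [^] Suc i" unfolding i using cc by (simp add: m_comm)
    moreover have "c \<otimes> c [^] Suc i \<in> ideal_power R J (Suc k)"
      unfolding ideal_power_Suc using ideal_prod.prod[OF c(1) cJ] .
    moreover have "c \<otimes> c [^] Suc i \<in> J" using ideal_mult_closed[OF J cJ cc] .
    ultimately show "c [^] p \<in> ?N" by simp
  qed
  ultimately have "frob_ideal (frob_ideal_iter J k) \<subseteq> ?N"
    unfolding frob_ideal_def by (rule genideal_minimal)
  thus ?case by simp
qed

lemma pow_mem_frob_ideal_iter:
  assumes J: "ideal J R" and c: "c \<in> J" shows "c [^] (p ^ k) \<in> frob_ideal_iter J k"
proof (induction k)
  case (Suc k)
  have "c [^] (p ^ Suc k) = (c [^] (p ^ k)) [^] p"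
    using c ideal_subset_carrier[OF J] by (auto simp: nat_pow_pow mult.commute)
  thus ?case using pow_mem_frob_ideal[OF frob_ideal_iter_ideal[OF J] Suc] by simp
qed (use c ideal_subset_carrier[OF J] in auto)

text \<open>The exponent p^k works uniformly for all elements of J, as the radical criterion
  demands. N is made at least k so that a representative modulo J^N also serves modulo J^k.\<close>

lemma ideal_power_subset_frob_ideal_iter:
  assumes "noetherian_ring R" and J: "ideal J R"
  shows "\<exists>N\<ge>k. ideal_power R J N \<subseteq> frob_ideal_iter J k"
proof -
  interpret noetherian_cring R using assms(1) is_cring by (simp add: noetherian_cring_def)
  obtain N where "ideal_power R J N \<subseteq> frob_ideal_iter J k"
    using ideal_power_subset_if_radical[OF J frob_ideal_iter_ideal[OF J] pow_mem_frob_ideal_iter[OF J]] by blast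
  hence "ideal_power R J (max k N) \<subseteq> frob_ideal_iter J k"
    using ideal_power_antimono[OF J, of N "max k N"] by auto
  thus ?thesis by (intro exI[of _ "max k N"]) auto
qed

end

section \<open>The tower\<close>

lemma (in cring) inj_imp_image_ring_is_cring:
  assumes "inj_on f (carrier R)" shows "cring (image_ring f R)"
  using ring_iso_imp_img_cring[OF inj_imp_image_ring_iso[OF assms]]
  by (simp add: image_ring_def image_group_def monoid.defs)

lemma (in ring) mem_rcos_iff:
  assumes "ideal I R" "a \<in> carrier R"
  shows "b \<in> I +> a \<longleftrightarrow> b \<in> carrier R \<and> I +> b = I +> a"
proof
  assume b: "b \<in> I +> a"
  then obtain i where i: "i \<in> I" "b = i \<oplus> a" unfolding a_r_coset_def' by blast
  have ic: "i \<in> carrier R" using ideal.Icarr[OF assms(1) i(1)] .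
  have "b \<ominus> a = i" unfolding i(2) using ic assms(2) by algebra
  thus "b \<in> carrier R \<and> I +> b = I +> a"
    using quotient_eq_iff_same_a_r_cos[OF assms(1) _ assms(2), of b] i ic assms(2) by auto
next
  assume b: "b \<in> carrier R \<and> I +> b = I +> a"
  have "b = \<zero> \<oplus> b" using b by simp
  hence "b \<in> I +> b"
    unfolding a_r_coset_def' using additive_subgroup.zero_closed[OF ideal.axioms(1)[OF assms(1)]] by blast
  thus "b \<in> I +> a" using b by simp
qed

section \<open>The next stage as a quotient of the base ring\<close>

context frobenius_step
begin

definition lift_poly :: "'a \<Rightarrow> nat multiset \<Rightarrow> 'c" where
  "lift_poly s = (SOME f. f \<in> carrier P \<and> eps.eval f = proj s)"

text \<open>Inverts \<open>eps.eval\<close> modulo \<open>I\<close> along \<open>proj\<close>: the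
  surjection from R onto the next stage before encoding.\<close>

definition next_map :: "'a \<Rightarrow> (nat multiset \<Rightarrow> 'c) set" where
  "next_map s = I +>\<^bsub>P\<^esub> lift_poly s"

lemma lift_poly: "s \<in> carrier R \<Longrightarrow> lift_poly s \<in> carrier P \<and> eps.eval (lift_poly s) = proj s"
  unfolding lift_poly_def by (rule someI_ex[OF eval_surj[unfolded Bex_def]])

lemma next_map_eq:
  assumes "s \<in> carrier R" "f \<in> carrier P" "eps.eval f = proj s" shows "next_map s = I +>\<^bsub>P\<^esub> f"
  unfolding next_map_def using eval_eq_iff[of "lift_poly s" f] lift_poly assms by simp

lemma quotient_map_ring_hom_cring: "ring_hom_cring P (P Quot I) ((+>\<^bsub>P\<^esub>) I)"
  using ideal.rcos_ring_hom_cring[OF I_ideal P.is_cring] .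

lemma next_map_hom: "next_map \<in> ring_hom R (P Quot I)"
proof (rule ring_hom_memI)
  interpret q: ring_hom_cring P "P Quot I" "(+>\<^bsub>P\<^esub>) I" by (rule quotient_map_ring_hom_cring)
  fix s assume s: "s \<in> carrier R"
  show "next_map s \<in> carrier (P Quot I)" unfolding next_map_def using lift_poly[OF s] by simp
  fix t assume t: "t \<in> carrier R"
  note ls = lift_poly[OF s] and lt = lift_poly[OF t]
  have "next_map (s \<otimes> t) = I +>\<^bsub>P\<^esub> (lift_poly s \<otimes>\<^bsub>P\<^esub> lift_poly t)"
    by (rule next_map_eq) (use s t ls lt in simp_all)
  thus "next_map (s \<otimes> t) = next_map s \<otimes>\<^bsub>P Quot I\<^esub> next_map t"
    unfolding next_map_def using q.hom_mult ls lt by simp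
  have "next_map (s \<oplus> t) = I +>\<^bsub>P\<^esub> (lift_poly s \<oplus>\<^bsub>P\<^esub> lift_poly t)"
    by (rule next_map_eq) (use s t ls lt in simp_all)
  thus "next_map (s \<oplus> t) = next_map s \<oplus>\<^bsub>P Quot I\<^esub> next_map t"
    unfolding next_map_def using q.hom_add ls lt by simp
next
  interpret q: ring_hom_cring P "P Quot I" "(+>\<^bsub>P\<^esub>) I" by (rule quotient_map_ring_hom_cring)
  have "next_map \<one> = I +>\<^bsub>P\<^esub> \<one>\<^bsub>P\<^esub>" by (rule next_map_eq) simp_all
  thus "next_map \<one> = \<one>\<^bsub>P Quot I\<^esub>" by simp
qed

lemma next_map_surj: "next_map ` carrier R = carrier (P Quot I)"
proof
  show "next_map ` carrier R \<subseteq> carrier (P Quot I)" using next_map_hom by (auto simp: ring_hom_def)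
  show "carrier (P Quot I) \<subseteq> next_map ` carrier R"
  proof
    fix c assume "c \<in> carrier (P Quot I)"
    then obtain f where f: "f \<in> carrier P" "c = I +>\<^bsub>P\<^esub> f"
      unfolding FactRing_def A_RCOSETS_def' by auto
    have "eps.eval f \<in> carrier T" using f(1) by (rule eval.hom_closed)
    then obtain s where s: "s \<in> carrier R" "eps.eval f = proj s" unfolding proj_surj[symmetric] by blast
    hence "c = next_map s" using next_map_eq[OF s(1) f(1) s(2)] f(2) by simp
    thus "c \<in> next_map ` carrier R" using s(1) by (rule image_eqI)
  qed
qed

lemma next_map_eq_iff:
  assumes "s \<in> carrier R" "t \<in> carrier R"
  shows "next_map s = next_map t \<longleftrightarrow> s \<ominus> t \<in> K'"
  unfolding next_map_def using lift_poly[OF assms(1)] lift_poly[OF assms(2)]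
    eval_eq_iff[of "lift_poly s" "lift_poly t"] proj_eq_iff[OF assms] by simp

lemma next_map_var: "j < n \<Longrightarrow> next_map (x j) = I +>\<^bsub>P\<^esub> A.indexed_var j"
  using x_closed var_closed by (intro next_map_eq) (auto simp: eps.eval_var)

text \<open>Holds for every representative of the coset, since \<open>encode\<close> selects one
  arbitrarily.\<close>

lemma frob_eval_next_map:
  assumes s: "s \<in> carrier R" and f: "f \<in> next_map s" shows "frob_eval p n A a f = \<alpha> s"
proof -
  have "f \<in> carrier P" "I +>\<^bsub>P\<^esub> f = next_map s"
    using f P.mem_rcos_iff[OF I_ideal, of "lift_poly s"] lift_poly[OF s] unfolding next_map_def by auto
  moreover have "eps.eval f = eps.eval (lift_poly s)"
    using eval_eq_iff calculation lift_poly[OF s] unfolding next_map_def by blast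
  ultimately show ?thesis using frob_eval_eq[OF _ s] lift_poly[OF s] by simp
qed

lemma quotient_rcosE:
  assumes "c \<in> carrier (P Quot I)"
  obtains f where "f \<in> carrier P" "c = I +>\<^bsub>P\<^esub> f"
  using assms unfolding FactRing_def A_RCOSETS_def' by auto

lemma some_mem_coset:
  assumes "c \<in> carrier (P Quot I)" shows "(SOME f. f \<in> c) \<in> c"
proof -
  obtain f where "f \<in> carrier P" "c = I +>\<^bsub>P\<^esub> f" using quotient_rcosE[OF assms] by blast
  hence "f \<in> c" using P.mem_rcos_iff[OF I_ideal, of f f] by simp
  thus ?thesis by (rule someI[where P = "\<lambda>f. f \<in> c"])
qed

text \<open>A representative determines its coset, which is what makes \<open>encode\<close>
  injective.\<close>

lemma coset_eqI:
  assumes "c \<in> carrier (P Quot I)" "d \<in> carrier (P Quot I)" "f \<in> c" "f \<in> d" shows "c = d"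
proof -
  obtain g where g: "g \<in> carrier P" "c = I +>\<^bsub>P\<^esub> g" using quotient_rcosE[OF assms(1)] by blast
  obtain h where h: "h \<in> carrier P" "d = I +>\<^bsub>P\<^esub> h" using quotient_rcosE[OF assms(2)] by blast
  have "I +>\<^bsub>P\<^esub> f = c" "I +>\<^bsub>P\<^esub> f = d"
    using assms(3,4) P.mem_rcos_iff[OF I_ideal g(1)] P.mem_rcos_iff[OF I_ideal h(1)] g(2) h(2) by auto
  thus ?thesis by simp
qed

lemma quotient_cring: "cring (P Quot I)"
  using ideal.quotient_is_cring[OF I_ideal P.is_cring] .

end

text \<open>The iterable form of one step: after encoding, \<open>A\<close> and \<open>B\<close>
  have the same type and \<open>B\<close> again satisfies \<open>frobenius_step\<close>. The last
  conjunct will say that \<phi> is compatible with the maps from R.\<close>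

lemma frobenius_step_encode:
  fixes A :: "'d tower ring"
  assumes step: "frobenius_step R p n x A \<alpha> a"
    and B: "B = image_ring encode (root_adjunction p n A a)"
    and b: "b = (\<lambda>j. encode (root_ideal p n A a +>\<^bsub>mpoly_ring n A\<^esub> ring.indexed_var A j))"
  shows "\<exists>\<beta>. frobenius_step R p n x B \<beta> b \<and>
    a_kernel R B \<beta> = p_basis_ring.frob_ideal R p (a_kernel R A \<alpha>) \<and>
    (\<forall>s\<in>carrier R. \<exists>f. \<beta> s = Adj f \<and> frob_eval p n A a f = \<alpha> s)"
proof -
  interpret frobenius_step R p n x A \<alpha> a by (rule step)
  interpret Q: cring "P Quot I" by (rule quotient_cring)
  have inj: "inj_on encode (carrier (P Quot I))"
  proof (rule inj_onI)
    fix c d assume cd: "c \<in> carrier (P Quot I)" "d \<in> carrier (P Quot I)" "encode c = encode d"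
    hence "(SOME f. f \<in> c) = (SOME f. f \<in> d)" unfolding encode_def by simp
    thus "c = d" using coset_eqI[OF cd(1,2)] some_mem_coset[OF cd(1)] some_mem_coset[OF cd(2)] by simp
  qed
  have Bdef: "B = image_ring encode (P Quot I)" unfolding B root_adjunction_def ..
  have enc: "encode \<in> ring_iso (P Quot I) B" unfolding Bdef by (rule inj_imp_image_ring_iso[OF inj])
  define \<beta> where "\<beta> = encode \<circ> next_map"
  have hom: "\<beta> \<in> ring_hom R B"
    unfolding \<beta>_def by (rule ring_hom_trans[OF next_map_hom]) (use enc in \<open>simp add: ring_iso_def\<close>)
  have cB: "cring B" unfolding Bdef by (rule Q.inj_imp_image_ring_is_cring[OF inj])
  interpret beta: ring_hom_cring R B \<beta>
    by (intro ring_hom_cring.intro is_cring cB ring_hom_cring_axioms.intro hom)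
  have "\<beta> ` carrier R = carrier B"
    unfolding \<beta>_def image_comp[symmetric] next_map_surj unfolding Bdef image_ring_carrier ..
  moreover have "b j = \<beta> (x j)" if "j < n" for j
    unfolding b \<beta>_def using next_map_var[OF that] by simp
  ultimately have "frobenius_step R p n x B \<beta> b"
    by (intro frobenius_step.intro frobenius_step_axioms.intro p_basis_ring_axioms cB hom) auto
  moreover have "a_kernel R B \<beta> = K'"
  proof -
    have iff: "\<beta> s = \<zero>\<^bsub>B\<^esub> \<longleftrightarrow> s \<in> K'" if s: "s \<in> carrier R" for s
    proof -
      have "\<beta> s = \<zero>\<^bsub>B\<^esub> \<longleftrightarrow> \<beta> s = \<beta> \<zero>\<^bsub>R\<^esub>" by simp
      also have "\<dots> \<longleftrightarrow> next_map s = next_map \<zero>\<^bsub>R\<^esub>"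
      proof -
        have "next_map s \<in> carrier (P Quot I)" "next_map \<zero>\<^bsub>R\<^esub> \<in> carrier (P Quot I)"
          using next_map_surj s by auto
        thus ?thesis unfolding \<beta>_def comp_def using inj_on_eq_iff[OF inj] by blast
      qed
      also have "\<dots> \<longleftrightarrow> s \<in> K'" using next_map_eq_iff[OF s zero_closed] s by (simp add: minus_eq)
      finally show ?thesis .
    qed
    show ?thesis
    proof (rule Set.set_eqI)
      fix s
      have "s \<in> K' \<Longrightarrow> s \<in> carrier R" using ideal_subset_carrier[OF K'_ideal] by (rule subsetD)
      thus "s \<in> a_kernel R B \<beta> \<longleftrightarrow> s \<in> K'" using iff[of s] unfolding a_kernel_def'[of R B \<beta>] by auto
    qed
  qed
  moreover have "\<exists>f. \<beta> s = Adj f \<and> frob_eval p n A a f = \<alpha> s" if s: "s \<in> carrier R" for s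
  proof (intro exI conjI)
    show "\<beta> s = Adj (SOME f. f \<in> next_map s)" unfolding \<beta>_def encode_def by simp
    have "next_map s \<in> carrier (P Quot I)" using next_map_surj s by blast
    thus "frob_eval p n A a (SOME f. f \<in> next_map s) = \<alpha> s"
      by (intro frob_eval_next_map[OF s] some_mem_coset)
  qed
  ultimately show ?thesis by blast
qed

lemma gabber_tower_maps:
  assumes step0: "frobenius_step S p n x R \<pi> y"
  shows "\<exists>\<alpha>. \<alpha> 0 = Base \<circ> \<pi> \<and> (\<forall>k.
    frobenius_step S p n x (gabber_ring p n R y k) (\<alpha> k) (gabber_tuple p n R y k) \<and>
    a_kernel S (gabber_ring p n R y k) (\<alpha> k) = (p_basis_ring.frob_ideal S p ^^ k) (a_kernel S R \<pi>) \<and>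
    (\<forall>s\<in>carrier S. gabber_phi p n R y k (\<alpha> (Suc k) s) = \<alpha> k s))"
proof -
  interpret frobenius_step S p n x R \<pi> y by (rule step0)
  let ?A = "gabber_ring p n R y" and ?a = "gabber_tuple p n R y"
  \<comment> \<open>The clause for k = 0 pins down the first map, since dependent choice returns
    only some map that satisfies \<open>Q 0\<close>.\<close>
  define Q where "Q = (\<lambda>k \<alpha>. frobenius_step S p n x (?A k) \<alpha> (?a k) \<and>
    a_kernel S (?A k) \<alpha> = (frob_ideal ^^ k) (a_kernel S R \<pi>) \<and> (k = 0 \<longrightarrow> \<alpha> = Base \<circ> \<pi>))"
  have inj: "inj_on Base (carrier R)" by (auto intro: inj_onI)
  have iso: "Base \<in> ring_iso R (?A 0)" using inj_imp_image_ring_iso[OF inj] by simp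
  have "frobenius_step S p n x (?A 0) (Base \<circ> \<pi>) (?a 0)"
  proof (intro frobenius_step.intro frobenius_step_axioms.intro p_basis_ring_axioms)
    show "cring (?A 0)" using A.inj_imp_image_ring_is_cring[OF inj] by simp
    show "Base \<circ> \<pi> \<in> ring_hom S (?A 0)"
      by (rule ring_hom_trans[OF \<alpha>_hom]) (use iso in \<open>simp add: ring_iso_def\<close>)
    show "(Base \<circ> \<pi>) ` carrier S = carrier (?A 0)"
      unfolding image_comp[symmetric] \<alpha>_surj by (simp add: image_ring_carrier)
    show "?a 0 j = (Base \<circ> \<pi>) (x j)" if "j < n" for j using a_eq[OF that] by simp
  qed
  moreover have "a_kernel S (?A 0) (Base \<circ> \<pi>) = a_kernel S R \<pi>"
    unfolding a_kernel_def' by (simp add: image_ring_zero)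
  ultimately have base: "Q 0 (Base \<circ> \<pi>)" unfolding Q_def by simp
  have "\<exists>\<alpha>. \<forall>k. Q k (\<alpha> k) \<and> (\<forall>s\<in>carrier S. gabber_phi p n R y k (\<alpha> (Suc k) s) = \<alpha> k s)"
  proof (rule dependent_nat_choice)
    show "\<exists>\<alpha>. Q 0 \<alpha>" using base by blast
  next
    fix \<alpha> k assume Q: "Q k \<alpha>"
    have "?A (Suc k) = image_ring encode (root_adjunction p n (?A k) (?a k))"
      "?a (Suc k) = (\<lambda>j. encode (root_ideal p n (?A k) (?a k) +>\<^bsub>mpoly_ring n (?A k)\<^esub> ring.indexed_var (?A k) j))"
      by (simp_all add: Let_def)
    from frobenius_step_encode[OF _ this] Q obtain \<beta> where \<beta>:
      "frobenius_step S p n x (?A (Suc k)) \<beta> (?a (Suc k))"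
      "a_kernel S (?A (Suc k)) \<beta> = frob_ideal (a_kernel S (?A k) \<alpha>)"
      "\<And>s. s \<in> carrier S \<Longrightarrow> \<exists>f. \<beta> s = Adj f \<and> frob_eval p n (?A k) (?a k) f = \<alpha> s"
      unfolding Q_def by blast
    have "Q (Suc k) \<beta>" unfolding Q_def using \<beta>(1,2) Q by (simp add: Q_def)
    moreover have "gabber_phi p n R y k (\<beta> s) = \<alpha> s" if "s \<in> carrier S" for s
      using \<beta>(3)[OF that] unfolding gabber_phi_def by auto
    ultimately show "\<exists>\<beta>. Q (Suc k) \<beta> \<and> (\<forall>s\<in>carrier S. gabber_phi p n R y k (\<beta> s) = \<alpha> s)" by blast
  qed
  then obtain \<alpha> where \<alpha>: "\<And>k. Q k (\<alpha> k)"
    "\<And>k s. s \<in> carrier S \<Longrightarrow> gabber_phi p n R y k (\<alpha> (Suc k) s) = \<alpha> k s" by blast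
  show ?thesis
  proof (intro exI[of _ \<alpha>] conjI allI ballI)
    show "\<alpha> 0 = Base \<circ> \<pi>" using \<alpha>(1)[of 0] unfolding Q_def by simp
  qed (use \<alpha> in \<open>auto simp: Q_def\<close>)
qed

section \<open>The limit and the completion\<close>

lemma ring_homs_agree:
  assumes f: "ring_hom_cring R S f" and g: "ring_hom_cring R S g" and H: "H \<subseteq> carrier R"
    and eq: "\<And>h. h \<in> H \<Longrightarrow> f h = g h" and s: "s \<in> generate_ring R H"
  shows "f s = g s"
proof -
  interpret f: ring_hom_cring R S f by (rule f)
  interpret g: ring_hom_cring R S g by (rule g)
  note gc = f.R.generate_ring_in_carrier[OF H]
  show ?thesis using s
  proof (induction)
    case (a_inv h) thus ?case using gc[OF a_inv(1)] by (simp only: f.hom_a_inv g.hom_a_inv)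
  next
    case (eng_add h k) thus ?case using gc[OF eng_add(1)] gc[OF eng_add(2)] by (simp only: f.hom_add g.hom_add)
  next
    case (eng_mult h k) thus ?case using gc[OF eng_mult(1)] gc[OF eng_mult(2)] by (simp only: f.hom_mult g.hom_mult)
  qed (use eq in simp_all)
qed

lemma p_generating_image:
  assumes h: "ring_hom_cring S R h" and surj: "h ` carrier S = carrier R"
    and gen: "p_generating p S n x" and y: "\<And>i. i < n \<Longrightarrow> y i = h (x i)"
  shows "p_generating p R n y"
proof -
  interpret h: ring_hom_cring S R h by (rule h)
  let ?H = "frob_image p S \<union> x ` {..<n}" and ?H' = "frob_image p R \<union> y ` {..<n}"
  have x: "x \<in> {..<n} \<rightarrow> carrier S" and genS: "generate_ring S ?H = carrier S"
    using gen unfolding p_generating_def by auto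
  have yc: "y \<in> {..<n} \<rightarrow> carrier R" using x y by (auto simp: Pi_def)
  have H: "?H \<subseteq> carrier S" using x unfolding frob_image_def by auto
  have H': "?H' \<subseteq> carrier R" using yc unfolding frob_image_def by auto
  have "h ` ?H \<subseteq> ?H'" using y unfolding frob_image_def by (auto simp: h.hom_pow)
  hence "generate_ring R (h ` ?H) \<subseteq> generate_ring R ?H'" by (intro h.S.mono_generate_ring H')
  hence "carrier R \<subseteq> generate_ring R ?H'"
    unfolding surj[symmetric] genS[symmetric] using h.hom_generate_ring[OF H] by blast
  moreover have "generate_ring R ?H' \<subseteq> carrier R" by (rule h.S.generate_ring_incl[OF H'])
  ultimately show ?thesis unfolding p_generating_def using yc by blast
qed

lemma inv_limit_simps:
  "carrier (inv_limit A t) = {s. (\<forall>i. s i \<in> carrier (A i)) \<and> (\<forall>i. t i (s (Suc i)) = s i)}"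
  "r \<otimes>\<^bsub>inv_limit A t\<^esub> s = (\<lambda>i. r i \<otimes>\<^bsub>A i\<^esub> s i)"
  "r \<oplus>\<^bsub>inv_limit A t\<^esub> s = (\<lambda>i. r i \<oplus>\<^bsub>A i\<^esub> s i)"
  "\<one>\<^bsub>inv_limit A t\<^esub> = (\<lambda>i. \<one>\<^bsub>A i\<^esub>)"
  unfolding inv_limit_def by auto

lemma inv_limit_component_hom:
  assumes "f \<in> ring_hom S (inv_limit A t)" shows "(\<lambda>s. f s k) \<in> ring_hom S (A k)"
  using assms unfolding ring_hom_def by (auto simp: inv_limit_simps Pi_def)

section \<open>The map into the limit and its uniqueness\<close>

locale gabber_completion = frobenius_step S p n x R \<pi> y
  for S (structure) and p n x and R :: "('b, 'k) ring_scheme" (structure) and \<pi> y +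
  assumes noetherian: "noetherian_ring S"
begin

abbreviation "stage k \<equiv> gabber_ring p n R y k"
abbreviation "phi \<equiv> gabber_phi p n R y"
abbreviation "G \<equiv> gabber p n R y"
abbreviation "J_iter \<equiv> frob_ideal_iter K"

definition tower_map :: "nat \<Rightarrow> 'a \<Rightarrow> 'b tower" where
  "tower_map = (SOME \<alpha>. \<alpha> 0 = Base \<circ> \<pi> \<and> (\<forall>k.
    frobenius_step S p n x (stage k) (\<alpha> k) (gabber_tuple p n R y k) \<and>
    a_kernel S (stage k) (\<alpha> k) = J_iter k \<and>
    (\<forall>s\<in>carrier S. phi k (\<alpha> (Suc k) s) = \<alpha> k s)))"

lemma
  shows tower_map_0: "tower_map 0 = Base \<circ> \<pi>"
    and tower_map_step: "frobenius_step S p n x (stage k) (tower_map k) (gabber_tuple p n R y k)"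
    and tower_map_kernel: "a_kernel S (stage k) (tower_map k) = J_iter k"
    and tower_map_phi: "s \<in> carrier S \<Longrightarrow> phi k (tower_map (Suc k) s) = tower_map k s"
  using someI_ex[OF gabber_tower_maps[OF frobenius_step_axioms]] unfolding tower_map_def[symmetric] by auto

lemma tower_map_hom: "ring_hom_cring S (stage k) (tower_map k)"
  using tower_map_step[of k]
  by (intro ring_hom_cring.intro is_cring ring_hom_cring_axioms.intro)
    (auto simp: frobenius_step_def frobenius_step_axioms_def)

lemma tower_map_surj: "tower_map k ` carrier S = carrier (stage k)"
  using tower_map_step[of k] by (auto simp: frobenius_step_def frobenius_step_axioms_def)

lemma tower_map_x: "j < n \<Longrightarrow> gabber_tuple p n R y k j = tower_map k (x j)"
  using tower_map_step[of k] by (auto simp: frobenius_step_def frobenius_step_axioms_def)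

lemma tower_map_eq_iff:
  "s \<in> carrier S \<Longrightarrow> t \<in> carrier S \<Longrightarrow> tower_map k s = tower_map k t \<longleftrightarrow> s \<ominus> t \<in> J_iter k"
  using ring_hom_cring.hom_eq_iff[OF tower_map_hom, of s t k] unfolding tower_map_kernel .

lemmas gabber_simps = inv_limit_simps[of stage phi, folded gabber_def]

definition completion_map :: "'a \<Rightarrow> nat \<Rightarrow> 'b tower" where
  "completion_map s = (\<lambda>k. tower_map k s)"

lemma completion_map_hom: "completion_map \<in> ring_hom S G"
proof -
  note T = ring_hom_cring.homh[OF tower_map_hom]
  show ?thesis
  proof (rule ring_hom_memI)
    fix s assume s: "s \<in> carrier S"
    show "completion_map s \<in> carrier G"
      unfolding gabber_simps completion_map_def using ring_hom_closed[OF T s] tower_map_phi[OF s] by simp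
    fix t assume t: "t \<in> carrier S"
    show "completion_map (s \<otimes> t) = completion_map s \<otimes>\<^bsub>G\<^esub> completion_map t"
      unfolding gabber_simps completion_map_def using ring_hom_mult[OF T s t] by simp
    show "completion_map (s \<oplus> t) = completion_map s \<oplus>\<^bsub>G\<^esub> completion_map t"
      unfolding gabber_simps completion_map_def using ring_hom_add[OF T s t] by simp
  next
    show "completion_map \<one> = \<one>\<^bsub>G\<^esub>"
      unfolding gabber_simps completion_map_def using ring_hom_one[OF T] by simp
  qed
qed

lemma gabber_basis_eq: "j < n \<Longrightarrow> gabber_basis p n R y j = completion_map (x j)"
  unfolding gabber_basis_def completion_map_def using tower_map_x by simp

lemma gabber_basis_closed: "j < n \<Longrightarrow> gabber_basis p n R y j \<in> carrier G"
  using gabber_basis_eq x_closed ring_hom_closed[OF completion_map_hom] by auto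

lemma Base_iso: "Base \<in> ring_iso R (stage 0)"
  using inj_imp_image_ring_iso[of Base R] by (auto intro: inj_onI)

lemma stage_0_Base: "u \<in> carrier (stage 0) \<Longrightarrow> the_base u \<in> carrier R \<and> u = Base (the_base u)"
  by (auto simp: image_ring_carrier)

lemma gabber_proj_hom: "gabber_proj \<in> ring_hom G R"
proof (rule ring_hom_memI)
  note B = ring_iso_memE[OF Base_iso]
  have c: "s 0 \<in> carrier (stage 0)" if "s \<in> carrier G" for s using that unfolding gabber_simps by blast
  fix s assume s: "s \<in> carrier G"
  note s0 = stage_0_Base[OF c[OF s]]
  show "gabber_proj s \<in> carrier R" unfolding gabber_proj_def using s0 by blast
  fix t assume t: "t \<in> carrier G"
  note t0 = stage_0_Base[OF c[OF t]]
  have "s 0 \<otimes>\<^bsub>stage 0\<^esub> t 0 = Base (gabber_proj s \<otimes>\<^bsub>R\<^esub> gabber_proj t)"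
    using B(2)[of "the_base (s 0)" "the_base (t 0)"] s0 t0 unfolding gabber_proj_def by metis
  thus "gabber_proj (s \<otimes>\<^bsub>G\<^esub> t) = gabber_proj s \<otimes>\<^bsub>R\<^esub> gabber_proj t"
    unfolding gabber_simps gabber_proj_def[of "\<lambda>i. s i \<otimes>\<^bsub>stage i\<^esub> t i"] by (simp only: tower.sel)
  have "s 0 \<oplus>\<^bsub>stage 0\<^esub> t 0 = Base (gabber_proj s \<oplus>\<^bsub>R\<^esub> gabber_proj t)"
    using B(3)[of "the_base (s 0)" "the_base (t 0)"] s0 t0 unfolding gabber_proj_def by metis
  thus "gabber_proj (s \<oplus>\<^bsub>G\<^esub> t) = gabber_proj s \<oplus>\<^bsub>R\<^esub> gabber_proj t"
    unfolding gabber_simps gabber_proj_def[of "\<lambda>i. s i \<oplus>\<^bsub>stage i\<^esub> t i"] by (simp only: tower.sel)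
next
  show "gabber_proj \<one>\<^bsub>G\<^esub> = \<one>\<^bsub>R\<^esub>"
    unfolding gabber_simps gabber_proj_def ring_iso_memE(4)[OF Base_iso, symmetric] by simp
qed

lemma gabber_proj_completion_map: "gabber_proj (completion_map s) = \<pi> s"
  unfolding gabber_proj_def completion_map_def tower_map_0 by simp

text \<open>Stage by stage, both maps agree on the generators x_j by assumption and on p-th powers
  by agreement one stage lower; these generate S.\<close>

lemma completion_map_unique:
  assumes f: "f \<in> ring_hom S G" and fx: "\<And>j. j < n \<Longrightarrow> f (x j) = gabber_basis p n R y j"
    and proj: "\<And>s. s \<in> carrier S \<Longrightarrow> gabber_proj (f s) = \<pi> s"
    and s: "s \<in> carrier S"
  shows "f s = completion_map s"
proof -
  have fG: "f s \<in> carrier G" if "s \<in> carrier S" for s using ring_hom_closed[OF f that] .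
  have "\<forall>s\<in>carrier S. f s k = tower_map k s" for k
  proof (induction k)
    case 0
    show ?case
    proof
      fix s assume s: "s \<in> carrier S"
      \<comment> \<open>Stage 0 is a copy of R under \<open>Base\<close>, so
        \<open>gabber_proj\<close> determines this component.\<close>
      have "f s 0 \<in> carrier (stage 0)" using fG[OF s] unfolding gabber_simps by blast
      hence "f s 0 = Base (the_base (f s 0))" using stage_0_Base by blast
      also have "\<dots> = tower_map 0 s"
        using proj[OF s] unfolding tower_map_0 gabber_proj_def by simp
      finally show "f s 0 = tower_map 0 s" .
    qed
  next
    case (Suc k)
    let ?g = "\<lambda>s. f s (Suc k)" and ?t = "tower_map (Suc k)"
    interpret t: ring_hom_cring S "stage (Suc k)" ?t by (rule tower_map_hom)
    have "?g \<in> ring_hom S (stage (Suc k))"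
      using inv_limit_component_hom[of f S stage phi "Suc k"] f unfolding gabber_def .
    then interpret g: ring_hom_cring S "stage (Suc k)" ?g
      by (intro ring_hom_cring.intro is_cring t.S.is_cring ring_hom_cring_axioms.intro)
    have pow: "?g (c [^] p) = ?t (c [^] p)" if c: "c \<in> carrier S" for c
    proof -
      have "?g c \<in> carrier (stage (Suc k))" by (rule g.hom_closed[OF c])
      then obtain d where d: "d \<in> carrier S" "?g c = ?t d"
        unfolding tower_map_surj[symmetric] by blast
      \<comment> \<open>A preimage d of f(c) at stage k+1 agrees with c at stage k, so d - c lies in
        J_k. Its p-th power lies in J_(k+1), and the images of d^p and c^p coincide.\<close>
      have "tower_map k d = phi k (?g c)" unfolding d(2) using tower_map_phi[OF d(1)] by simp
      also have "\<dots> = f c k" using fG[OF c] unfolding gabber_simps by blast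
      also have "\<dots> = tower_map k c" using Suc c by blast
      finally have "d \<ominus> c \<in> J_iter k" using tower_map_eq_iff[OF d(1) c] by blast
      hence "(d \<ominus> c) [^] p \<in> J_iter (Suc k)"
        using pow_mem_frob_ideal[OF frob_ideal_iter_ideal[OF alpha.kernel_ideal]] by simp
      hence "?t (d [^] p) = ?t (c [^] p)"
        unfolding frob_minus[OF d(1) c]
        using tower_map_eq_iff[OF nat_pow_closed[OF d(1)] nat_pow_closed[OF c]] by blast
      moreover have "?g (c [^] p) = ?t (d [^] p)"
        unfolding g.hom_pow[OF c] t.hom_pow[OF d(1)] d(2) ..
      ultimately show ?thesis by simp
    qed
    have H: "frob_image p S \<union> x ` {..<n} \<subseteq> carrier S" using x_closed unfolding frob_image_def by auto
    have gen: "generate_ring S (frob_image p S \<union> x ` {..<n}) = carrier S"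
      using p_basis unfolding p_basis_def p_generating_def by blast
    have agree: "?g h = ?t h" if h: "h \<in> frob_image p S \<union> x ` {..<n}" for h
      using h
    proof
      assume "h \<in> frob_image p S" thus ?thesis using pow unfolding frob_image_def by blast
    next
      assume "h \<in> x ` {..<n}"
      then obtain j where "j < n" "h = x j" by blast
      thus ?thesis using fx gabber_basis_eq unfolding completion_map_def by simp
    qed
    show ?case
      using ring_homs_agree[OF g.ring_hom_cring_axioms t.ring_hom_cring_axioms H agree] unfolding gen by blast
  qed
  thus ?thesis unfolding completion_map_def using s by (intro ext) blast
qed

end

context ring
begin

lemma set_add_rcos:
  assumes I: "ideal I R" and I': "ideal I' R" and sub: "I' \<subseteq> I" and s: "s \<in> carrier R"
  shows "I <+>\<^bsub>R\<^esub> (I' +>\<^bsub>R\<^esub> s) = I +>\<^bsub>R\<^esub> s"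
proof
  have Ic: "\<And>i. i \<in> I \<Longrightarrow> i \<in> carrier R" using ideal.Icarr[OF I] .
  have z: "\<zero> \<in> I'" using additive_subgroup.zero_closed[OF ideal.axioms(1)[OF I']] .
  show "I <+>\<^bsub>R\<^esub> (I' +>\<^bsub>R\<^esub> s) \<subseteq> I +>\<^bsub>R\<^esub> s"
  proof
    fix c assume "c \<in> I <+>\<^bsub>R\<^esub> (I' +>\<^bsub>R\<^esub> s)"
    then obtain i i' where i: "i \<in> I" "i' \<in> I'" "c = i \<oplus> (i' \<oplus> s)"
      unfolding set_add_def' a_r_coset_def' by blast
    have "c = (i \<oplus> i') \<oplus> s" unfolding i(3) using Ic i sub s by (auto simp: a_assoc)
    moreover have "i \<oplus> i' \<in> I" using additive_subgroup.a_closed[OF ideal.axioms(1)[OF I]] i sub by blast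
    ultimately show "c \<in> I +>\<^bsub>R\<^esub> s" unfolding a_r_coset_def' by blast
  qed
  show "I +>\<^bsub>R\<^esub> s \<subseteq> I <+>\<^bsub>R\<^esub> (I' +>\<^bsub>R\<^esub> s)"
  proof
    fix c assume "c \<in> I +>\<^bsub>R\<^esub> s"
    then obtain i where i: "i \<in> I" "c = i \<oplus> s" unfolding a_r_coset_def' by blast
    have "\<zero> \<oplus> s \<in> I' +>\<^bsub>R\<^esub> s" unfolding a_r_coset_def' using z by blast
    hence "s \<in> I' +>\<^bsub>R\<^esub> s" using s by simp
    thus "c \<in> I <+>\<^bsub>R\<^esub> (I' +>\<^bsub>R\<^esub> s)" unfolding set_add_def' i(2) using i(1) by blast
  qed
qed

lemma quotient_carrier_iff: "c \<in> carrier (R Quot I) \<longleftrightarrow> (\<exists>s\<in>carrier R. c = I +>\<^bsub>R\<^esub> s)"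
  unfolding FactRing_def A_RCOSETS_def' by auto

end

section \<open>Comparison with the adic completion\<close>

context gabber_completion
begin

abbreviation "J_pow \<equiv> ideal_power S K"
abbreviation "S_hat \<equiv> adic_completion S K"

lemma J_pow_ideal: "ideal (J_pow k) S" by (rule ideal_power_ideal[OF alpha.kernel_ideal])

lemma J_pow_rcos_eq_iff:
  "s \<in> carrier S \<Longrightarrow> t \<in> carrier S \<Longrightarrow> J_pow k +> s = J_pow k +> t \<longleftrightarrow> s \<ominus> t \<in> J_pow k"
  using quotient_eq_iff_same_a_r_cos[OF J_pow_ideal] by blast

lemma J_iter_subset_J_pow: "J_iter k \<subseteq> J_pow k"
  using frob_ideal_iter_subset_power[OF alpha.kernel_ideal] by blast

definition depth :: "nat \<Rightarrow> nat" where
  "depth k = (SOME N. k \<le> N \<and> J_pow N \<subseteq> J_iter k)"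

lemma depth: "k \<le> depth k" "J_pow (depth k) \<subseteq> J_iter k"
  using someI_ex[OF ideal_power_subset_frob_ideal_iter[OF noetherian alpha.kernel_ideal, of k]]
  unfolding depth_def by auto

lemmas adic_simps = inv_limit_simps[of "\<lambda>k. S Quot J_pow k" "\<lambda>k c. J_pow k <+>\<^bsub>S\<^esub> c", folded adic_completion_def]

definition rep :: "(nat \<Rightarrow> 'b tower) \<Rightarrow> nat \<Rightarrow> 'a" where
  "rep g k = (SOME s. s \<in> carrier S \<and> tower_map k s = g k)"

lemma rep:
  assumes "g \<in> carrier G" shows "rep g k \<in> carrier S" "tower_map k (rep g k) = g k"
proof -
  have "g k \<in> carrier (stage k)" using assms unfolding gabber_simps by blast
  then obtain s where "g k = tower_map k s" "s \<in> carrier S" unfolding tower_map_surj[symmetric] by (rule imageE)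
  hence "\<exists>s. s \<in> carrier S \<and> tower_map k s = g k" by (intro exI[of _ s]) simp
  from someI_ex[OF this] show "rep g k \<in> carrier S" "tower_map k (rep g k) = g k" unfolding rep_def by auto
qed

definition to_adic :: "(nat \<Rightarrow> 'b tower) \<Rightarrow> nat \<Rightarrow> 'a set" where
  "to_adic g = (\<lambda>k. J_pow k +> rep g k)"

text \<open>Independence of the representative: those of one element of stage k differ by J_k, which
  lies in J^k.\<close>

lemma to_adic_eq:
  assumes g: "g \<in> carrier G" and s: "s \<in> carrier S" "tower_map k s = g k"
  shows "to_adic g k = J_pow k +> s"
proof -
  have "rep g k \<ominus> s \<in> J_iter k" using tower_map_eq_iff[OF rep(1)[OF g, of k] s(1), of k] rep(2)[OF g, of k] s(2) by simp
  hence "rep g k \<ominus> s \<in> J_pow k" using J_iter_subset_J_pow by (rule subsetD[rotated])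
  thus ?thesis unfolding to_adic_def using J_pow_rcos_eq_iff[OF rep(1)[OF g, of k] s(1), of k] by simp
qed

text \<open>A representative at a high level serves at all lower levels, because \<phi> is the
  canonical projection on images of elements of S.\<close>

lemma gabber_component:
  assumes g: "g \<in> carrier G" and s: "s \<in> carrier S" "tower_map l s = g l" and kl: "k \<le> l"
  shows "tower_map k s = g k"
  using kl
proof (induction rule: inc_induct)
  case (step i)
  have "tower_map i s = phi i (g (Suc i))" using tower_map_phi[OF s(1), of i] step.IH by simp
  also have "\<dots> = g i" using g unfolding gabber_simps by blast
  finally show ?case .
qed (rule s(2))

text \<open>Compatibility with \<phi> is checked on representatives in S, where products and sums
  can be formed before mapping to the stages.\<close>

lemma
  assumes g: "g \<in> carrier G" and h: "h \<in> carrier G"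
  shows gabber_mult_closed: "g \<otimes>\<^bsub>G\<^esub> h \<in> carrier G" and gabber_add_closed: "g \<oplus>\<^bsub>G\<^esub> h \<in> carrier G"
proof -
  note T = ring_hom_cring.homh[OF tower_map_hom]
  note rg = rep[OF g] and rh = rep[OF h]
  have t: "phi k (g (Suc k) \<otimes>\<^bsub>stage (Suc k)\<^esub> h (Suc k)) = g k \<otimes>\<^bsub>stage k\<^esub> h k"
    "phi k (g (Suc k) \<oplus>\<^bsub>stage (Suc k)\<^esub> h (Suc k)) = g k \<oplus>\<^bsub>stage k\<^esub> h k" for k
  proof -
    let ?u = "rep g (Suc k)" and ?v = "rep h (Suc k)"
    have k: "tower_map k ?u = g k" "tower_map k ?v = h k"
      using gabber_component[OF g rg(1) rg(2), of k "Suc k"] gabber_component[OF h rh(1) rh(2), of k "Suc k"] by auto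
    show "phi k (g (Suc k) \<otimes>\<^bsub>stage (Suc k)\<^esub> h (Suc k)) = g k \<otimes>\<^bsub>stage k\<^esub> h k"
      using tower_map_phi[of "?u \<otimes> ?v" k] rg rh k
      by (simp only: ring_hom_mult[OF T rg(1) rh(1)] m_closed)
    show "phi k (g (Suc k) \<oplus>\<^bsub>stage (Suc k)\<^esub> h (Suc k)) = g k \<oplus>\<^bsub>stage k\<^esub> h k"
      using tower_map_phi[of "?u \<oplus> ?v" k] rg rh k
      by (simp only: ring_hom_add[OF T rg(1) rh(1)] add.m_closed)
  qed
  have c: "g k \<otimes>\<^bsub>stage k\<^esub> h k \<in> carrier (stage k)" "g k \<oplus>\<^bsub>stage k\<^esub> h k \<in> carrier (stage k)" for k
  proof -
    interpret k: ring_hom_cring S "stage k" "tower_map k" by (rule tower_map_hom)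
    show "g k \<otimes>\<^bsub>stage k\<^esub> h k \<in> carrier (stage k)" "g k \<oplus>\<^bsub>stage k\<^esub> h k \<in> carrier (stage k)"
      using g h unfolding gabber_simps by auto
  qed
  show "g \<otimes>\<^bsub>G\<^esub> h \<in> carrier G" "g \<oplus>\<^bsub>G\<^esub> h \<in> carrier G" unfolding gabber_simps using t c by auto
qed

lemma to_adic_closed:
  assumes g: "g \<in> carrier G" shows "to_adic g \<in> carrier S_hat"
proof -
  have "to_adic g k \<in> carrier (S Quot J_pow k)" for k
    unfolding to_adic_def quotient_carrier_iff using rep(1)[OF g] by blast
  moreover have "J_pow k <+>\<^bsub>S\<^esub> to_adic g (Suc k) = to_adic g k" for k
  proof -
    note r = rep[OF g, of "Suc k"]
    have "J_pow k <+>\<^bsub>S\<^esub> to_adic g (Suc k) = J_pow k +> rep g (Suc k)"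
      unfolding to_adic_def
      by (rule set_add_rcos[OF J_pow_ideal J_pow_ideal ideal_power_Suc_subset[OF alpha.kernel_ideal] r(1)])
    also have "\<dots> = to_adic g k"
      using to_adic_eq[OF g r(1) gabber_component[OF g r, of k]] by simp
    finally show ?thesis .
  qed
  ultimately show ?thesis unfolding adic_simps by blast
qed

lemma to_adic_hom: "to_adic \<in> ring_hom G S_hat"
proof (rule ring_hom_memI)
  note Q = ideal.rcos_ring_hom[OF J_pow_ideal]
  note T = ring_hom_cring.homh[OF tower_map_hom]
  fix g assume g: "g \<in> carrier G"
  show "to_adic g \<in> carrier S_hat" by (rule to_adic_closed[OF g])
  fix h assume h: "h \<in> carrier G"
  note rg = rep[OF g] and rh = rep[OF h]
  note closed = gabber_mult_closed[OF g h] gabber_add_closed[OF g h]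
  show "to_adic (g \<otimes>\<^bsub>G\<^esub> h) = to_adic g \<otimes>\<^bsub>S_hat\<^esub> to_adic h"
  proof
    fix k
    have "tower_map k (rep g k \<otimes> rep h k) = (g \<otimes>\<^bsub>G\<^esub> h) k"
      unfolding gabber_simps ring_hom_mult[OF T rg(1) rh(1)] rg(2) rh(2) ..
    from to_adic_eq[OF closed(1) m_closed[OF rg(1) rh(1)] this]
    show "to_adic (g \<otimes>\<^bsub>G\<^esub> h) k = (to_adic g \<otimes>\<^bsub>S_hat\<^esub> to_adic h) k"
      unfolding adic_simps to_adic_def[of g] to_adic_def[of h] using ring_hom_mult[OF Q rg(1) rh(1)] by simp
  qed
  show "to_adic (g \<oplus>\<^bsub>G\<^esub> h) = to_adic g \<oplus>\<^bsub>S_hat\<^esub> to_adic h"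
  proof
    fix k
    have "tower_map k (rep g k \<oplus> rep h k) = (g \<oplus>\<^bsub>G\<^esub> h) k"
      unfolding gabber_simps ring_hom_add[OF T rg(1) rh(1)] rg(2) rh(2) ..
    from to_adic_eq[OF closed(2) add.m_closed[OF rg(1) rh(1)] this]
    show "to_adic (g \<oplus>\<^bsub>G\<^esub> h) k = (to_adic g \<oplus>\<^bsub>S_hat\<^esub> to_adic h) k"
      unfolding adic_simps to_adic_def[of g] to_adic_def[of h] using ring_hom_add[OF Q rg(1) rh(1)] by simp
  qed
next
  note Q = ideal.rcos_ring_hom[OF J_pow_ideal]
  show "to_adic \<one>\<^bsub>G\<^esub> = \<one>\<^bsub>S_hat\<^esub>"
  proof
    fix k
    have "\<one>\<^bsub>G\<^esub> \<in> carrier G"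
      using ring_hom_closed[OF completion_map_hom one_closed] ring_hom_one[OF completion_map_hom] by simp
    moreover have "tower_map k \<one> = \<one>\<^bsub>G\<^esub> k"
      unfolding gabber_simps by (rule ring_hom_one[OF ring_hom_cring.homh[OF tower_map_hom]])
    ultimately have "to_adic \<one>\<^bsub>G\<^esub> k = J_pow k +> \<one>" by (intro to_adic_eq) simp_all
    thus "to_adic \<one>\<^bsub>G\<^esub> k = \<one>\<^bsub>S_hat\<^esub> k"
      unfolding adic_simps using ring_hom_one[OF Q] by simp
  qed
qed

text \<open>The coset modulo J^(depth k) already determines component k of the tower
  sequence.\<close>

lemma to_adic_inj: "inj_on to_adic (carrier G)"
proof (rule inj_onI)
  fix g h assume g: "g \<in> carrier G" and h: "h \<in> carrier G" and eq: "to_adic g = to_adic h"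
  show "g = h"
  proof
    fix k
    let ?N = "depth k"
    have "J_pow ?N +> rep g ?N = J_pow ?N +> rep h ?N"
      using fun_cong[OF eq, of ?N] unfolding to_adic_def .
    hence "rep g ?N \<ominus> rep h ?N \<in> J_iter k"
      using J_pow_rcos_eq_iff[OF rep(1)[OF g, of ?N] rep(1)[OF h, of ?N], of ?N] subsetD[OF depth(2)] by simp
    hence "tower_map k (rep g ?N) = tower_map k (rep h ?N)"
      using tower_map_eq_iff[OF rep(1)[OF g, of ?N] rep(1)[OF h, of ?N], of k] by simp
    thus "g k = h k" using gabber_component[OF g rep[OF g] depth(1)] gabber_component[OF h rep[OF h] depth(1)] by simp
  qed
qed

text \<open>Component k of the preimage is read off from a representative of the given sequence at
  level \<open>depth k\<close>, where J^(depth k) lies in J_k.\<close>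

lemma to_adic_surj:
  assumes c: "c \<in> carrier S_hat" shows "\<exists>g\<in>carrier G. to_adic g = c"
proof -
  have cq: "\<forall>k. \<exists>s. s \<in> carrier S \<and> c k = J_pow k +> s" and ct: "\<And>k. J_pow k <+>\<^bsub>S\<^esub> c (Suc k) = c k"
    using c unfolding adic_simps quotient_carrier_iff by blast+
  from choice[OF cq] obtain w where w: "\<And>k. w k \<in> carrier S" "\<And>k. c k = J_pow k +> w k" by blast
  have coset: "J_pow k +> w l = c k" if "k \<le> l" for k l
    using that
  proof (induction rule: inc_induct)
    case (step i)
    have "J_pow i +> w l = J_pow i <+>\<^bsub>S\<^esub> (J_pow (Suc i) +> w l)"
      by (rule set_add_rcos[OF J_pow_ideal J_pow_ideal ideal_power_Suc_subset[OF alpha.kernel_ideal] w(1), symmetric])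
    also have "\<dots> = c i" unfolding step.IH by (rule ct)
    finally show ?case .
  qed (simp add: w(2))
  define g where "g = (\<lambda>k. tower_map k (w (depth k)))"
  have g_eq: "tower_map k (w l) = g k" if l: "depth k \<le> l" for k l
  proof -
    have "J_pow (depth k) +> w l = J_pow (depth k) +> w (depth k)" using coset[OF l] coset[of "depth k" "depth k"] by simp
    hence "w l \<ominus> w (depth k) \<in> J_iter k"
      using J_pow_rcos_eq_iff[OF w(1)[of l] w(1)[of "depth k"], of "depth k"] subsetD[OF depth(2)] by simp
    thus ?thesis unfolding g_def using tower_map_eq_iff[OF w(1)[of l] w(1)[of "depth k"], of k] by simp
  qed
  have gG: "g \<in> carrier G"
  proof -
    have "g k \<in> carrier (stage k)" for k unfolding g_def tower_map_surj[symmetric] using w(1) by blast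
    moreover have "phi k (g (Suc k)) = g k" for k
    proof -
      \<comment> \<open>\<open>depth\<close> comes from an arbitrary choice and may fail to be
        monotone; the maximum gives one representative valid for both components.\<close>
      let ?l = "max (depth k) (depth (Suc k))"
      have "phi k (g (Suc k)) = phi k (tower_map (Suc k) (w ?l))" using g_eq[of "Suc k" ?l] by simp
      also have "\<dots> = tower_map k (w ?l)" by (rule tower_map_phi[OF w(1)])
      also have "\<dots> = g k" by (rule g_eq) simp
      finally show ?thesis .
    qed
    ultimately show ?thesis unfolding gabber_simps by blast
  qed
  have "to_adic g = c"
  proof
    fix k
    have "to_adic g k = J_pow k +> w (depth k)" by (rule to_adic_eq[OF gG w(1)]) (simp add: g_def)
    thus "to_adic g k = c k" using coset[OF depth(1)] by simp
  qed
  thus ?thesis using gG by blast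
qed

lemma to_adic_iso: "to_adic \<in> ring_iso G S_hat"
proof -
  have "to_adic ` carrier G = carrier S_hat"
    using to_adic_closed to_adic_surj by (auto simp: image_iff)
  thus ?thesis unfolding ring_iso_def bij_betw_def using to_adic_hom to_adic_inj by blast
qed

lemma to_adic_completion_map:
  assumes "s \<in> carrier S" shows "to_adic (completion_map s) = to_adic_completion S K s"
proof
  fix k
  show "to_adic (completion_map s) k = to_adic_completion S K s k"
    unfolding to_adic_completion_def
    by (rule to_adic_eq[OF ring_hom_closed[OF completion_map_hom assms] assms]) (simp add: completion_map_def)
qed

end

theorem proposition3p2p3:
  fixes p n :: nat
    and S :: "('a, 'm) ring_scheme" and R :: "('b, 'k) ring_scheme"
    and x :: "nat \<Rightarrow> 'a" and y :: "nat \<Rightarrow> 'b"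
    and \<pi> :: "'a \<Rightarrow> 'b" and J :: "'a set"
  assumes "Factorial_Ring.prime p"
    and "char_p p S" and "regular_ring S" and "p_basis p S n x"
    and "cring R" and "\<pi> \<in> ring_hom S R" and "\<pi> ` carrier S = carrier R"
    and "J = a_kernel S R \<pi>"
    and "\<And>i. i < n \<Longrightarrow> y i = \<pi> (x i)"
  defines "G \<equiv> gabber p n R y"
    and "y_inf \<equiv> gabber_basis p n R y"
  defines "factorization \<equiv> (\<lambda>F. F \<in> pair_maps S n x G n y_inf \<and>
      pair_comp S n (idx_pair_map G n gabber_proj) F = idx_pair_map S n \<pi>)"
  shows "p_generating p R n y \<and>
    idx_pair_map G n gabber_proj \<in> pair_maps G n y_inf R n y \<and>
    (\<exists>!F. factorization F) \<and>
    (\<forall>\<pi>_inf \<sigma>. factorization (\<pi>_inf, \<sigma>) \<longrightarrow>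
       (\<exists>\<psi> \<in> ring_iso G (adic_completion S J).
          \<forall>s \<in> carrier S. \<psi> (\<pi>_inf s) = to_adic_completion S J s)) \<and>
    G \<simeq> adic_completion S J"
proof -
  have S: "cring S" "noetherian_ring S" using assms(3) unfolding regular_ring_def by auto
  interpret gabber_completion S p n x R \<pi> y
  proof (intro gabber_completion.intro frobenius_step.intro p_basis_ring.intro p_basis_ring_axioms.intro
      frobenius_step_axioms.intro gabber_completion_axioms.intro)
    show "z = \<zero>\<^bsub>S\<^esub>" if "z \<in> carrier S" "z [^]\<^bsub>S\<^esub> p = \<zero>\<^bsub>S\<^esub>" for z
      using regular_ring_reduced[OF assms(3) that] .
  qed (use S assms in auto)
  have JK: "J = a_kernel S R \<pi>" by (rule assms(8))
  have 1: "p_generating p R n y"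
    using p_generating_image[OF alpha.ring_hom_cring_axioms \<alpha>_surj, of p n x y] p_basis a_eq
    unfolding p_basis_def by blast
  have 2: "idx_pair_map G n gabber_proj \<in> pair_maps G n y_inf R n y"
  proof -
    have "restrict gabber_proj (carrier G) \<in> ring_hom G R"
    proof -
      \<comment> \<open>The restriction to \<open>carrier G\<close> respects the operations only
        because their values stay in the carrier.\<close>
      have "\<one>\<^bsub>G\<^esub> \<in> carrier G"
        using ring_hom_closed[OF completion_map_hom one_closed] ring_hom_one[OF completion_map_hom]
        unfolding G_def by simp
      moreover have "g \<otimes>\<^bsub>G\<^esub> h \<in> carrier G" "g \<oplus>\<^bsub>G\<^esub> h \<in> carrier G" if "g \<in> carrier G" "h \<in> carrier G" for g h
        using gabber_mult_closed gabber_add_closed that unfolding G_def by auto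
      ultimately show ?thesis using gabber_proj_hom unfolding G_def ring_hom_def by auto
    qed
    moreover have "restrict gabber_proj (carrier G) (y_inf i) = y i" if "i < n" for i
      using gabber_basis_closed[OF that] gabber_basis_eq[OF that] gabber_proj_completion_map a_eq[OF that]
      unfolding G_def y_inf_def by simp
    ultimately show ?thesis unfolding pair_maps_def idx_pair_map_def by simp
  qed
  \<comment> \<open>An explicit description of every factorization, from which existence, uniqueness
    and the comparison with the completion all follow.\<close>
  have fact_iff: "factorization (f, \<sigma>) \<longleftrightarrow> f = restrict completion_map (carrier S) \<and> \<sigma> = restrict (\<lambda>i. i) {..<n}" for f \<sigma>
  proof
    assume F: "factorization (f, \<sigma>)"
    hence f: "f \<in> ring_hom S G" "f \<in> extensional (carrier S)" and \<sigma>: "\<sigma> \<in> {..<n} \<rightarrow>\<^sub>E {..<n}"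
      and fx: "\<And>i. i < n \<Longrightarrow> f (x i) = y_inf (\<sigma> i)"
      and c1: "compose (carrier S) (restrict gabber_proj (carrier G)) f = restrict \<pi> (carrier S)"
      and c2: "compose {..<n} (restrict (\<lambda>i. i) {..<n}) \<sigma> = restrict (\<lambda>i. i) {..<n}"
      unfolding factorization_def pair_maps_def pair_comp_def idx_pair_map_def by auto
    \<comment> \<open>The projection matches the tuples index by index, so its index map is the
      identity and the composition determines \<open>\<sigma>\<close>, even if the tuple y has
      repeated entries.\<close>
    have \<sigma>i: "\<sigma> i = i" if "i < n" for i
    proof -
      have "\<sigma> i < n" using \<sigma> that by auto
      thus ?thesis using fun_cong[OF c2, of i] that by (simp add: compose_def)
    qed
    have "\<sigma> = restrict (\<lambda>i. i) {..<n}"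
      by (rule extensionalityI[where A = "{..<n}"]) (use \<sigma> \<sigma>i in \<open>auto simp: PiE_def\<close>)
    moreover have "gabber_proj (f s) = \<pi> s" if "s \<in> carrier S" for s
      using fun_cong[OF c1, of s] that ring_hom_closed[OF f(1) that] by (simp add: compose_def)
    hence "f s = completion_map s" if "s \<in> carrier S" for s
      using completion_map_unique[of f s] f(1) fx \<sigma>i that unfolding G_def y_inf_def by simp
    hence "f = restrict completion_map (carrier S)"
      by (intro extensionalityI[where A = "carrier S"]) (use f(2) in auto)
    ultimately show "f = restrict completion_map (carrier S) \<and> \<sigma> = restrict (\<lambda>i. i) {..<n}" by blast
  next
    assume eq: "f = restrict completion_map (carrier S) \<and> \<sigma> = restrict (\<lambda>i. i) {..<n}"
    have "restrict completion_map (carrier S) \<in> ring_hom S G"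
      using completion_map_hom unfolding G_def ring_hom_def by auto
    moreover have "restrict completion_map (carrier S) (x i) = y_inf (restrict (\<lambda>i. i) {..<n} i)" if "i < n" for i
      using that x_closed gabber_basis_eq[OF that] unfolding y_inf_def by auto
    moreover have "compose (carrier S) (restrict gabber_proj (carrier G)) (restrict completion_map (carrier S)) =
        restrict \<pi> (carrier S)"
      using ring_hom_closed[OF completion_map_hom] gabber_proj_completion_map
      unfolding compose_def G_def by (auto simp: restrict_def)
    moreover have "compose {..<n} (restrict (\<lambda>i. i) {..<n}) (restrict (\<lambda>i. i) {..<n}) = restrict (\<lambda>i. i) {..<n}"
      unfolding compose_def by (auto simp: restrict_def)
    ultimately show "factorization (f, \<sigma>)"
      unfolding factorization_def pair_maps_def pair_comp_def idx_pair_map_def using eq by auto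
  qed
  have 3: "\<exists>!F. factorization F"
    using fact_iff by (metis (no_types, lifting) surj_pair)
  have iso: "to_adic \<in> ring_iso G (adic_completion S J)" unfolding G_def JK by (rule to_adic_iso)
  have 4: "\<exists>\<psi> \<in> ring_iso G (adic_completion S J). \<forall>s \<in> carrier S. \<psi> (f s) = to_adic_completion S J s"
    if "factorization (f, \<sigma>)" for f \<sigma>
  proof (intro bexI[OF _ iso] ballI)
    fix s assume "s \<in> carrier S"
    thus "to_adic (f s) = to_adic_completion S J s"
      using that fact_iff to_adic_completion_map unfolding JK by simp
  qed
  have 5: "G \<simeq> adic_completion S J" unfolding is_ring_iso_def using iso by blast
  show ?thesis using 1 2 3 4 5 by blast
qed

end
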